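(* Almost all feasible instances of 2-TSP with Vertex Requisitions (2-TSPVR) are solvable in $O(n)$ time. Precisely: let $\chi_n$ be the set of all bipartite graphs $\bar G=(X_n,X,\bar U)$ that correspond to feasible instances of 2-TSPVR with $n$ vertices. There exist an algorithm that solves 2-TSPVR to optimality and a constant $C$ such that, if $\chi_n^{*}\subseteq\chi_n$ denotes the set of graphs $\bar G\in\chi_n$ such that the algorithm solves every instance with bipartite graph $\bar G$ (i.e. for every choice of non-negative arc weights) in time at most $Cn$, then $|\chi_n^{*}|/|\chi_n|\to 1$ as $n\to\infty$.
   Context: 2-TSPVR. An instance consists of a set $X=\{x_1,\dots,x_n\}$ of vertices of a complete digraph with non-negative arc weights $\rho(x,y)$, $x\ne y$, and subsets (requisitions) $X^1,\dots,X^n\subseteq X$ with $1\le |X^i|\le 2$ for all $i$. $F$ is the set of bijections $f:\{1,\dots,n\}\to X$ with $f(i)\in X^i$ for all $i$; the instance is feasible if $F\neq\emptyset$. The cost of $f\in F$ is $\rho(f)=\sum_{i=1}^{n-1}\rho(f(i),f(i+1))+\rho(f(n),f(1))$; solving the instance means finding $f^*\in F$ with $\rho(f^* )=\min_{f\in F}\rho(f)$. Indices are cyclic ($n+1:=1$). Only the arcs that start in $X^i$ and end in $X^{i+1}$ for some $i\in\{1,\dots,n\}$ are given in the input (so the input has size $O(n)$; the weights $\rho(x,y)$ with $x\in X^i$, $y\in X^{i+1}$ are accessible in constant time from $i$). Time is counted with arithmetic operations and comparisons on weights taking unit time (standard unit-cost random access machine). Bipartite graph. For $X_n=\{1,\dots,n\}$,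 the bipartite graph of an instance is $\bar G=(X_n,X,\bar U)$ with edge set $\bar U=\{\{i,x\}: i\in X_n,\ x\in X^i\}$. It is determined by the requisitions $X^1,\dots,X^n$ alone, and the instance is feasible if and only if $\bar G$ has a perfect matching. Thus $\chi_n$ is the set of (labelled) bipartite graphs with parts $X_n$ and $X$ in which each vertex of $X_n$ has degree 1 or 2 and which have a perfect matching. *)

theory Defs
  imports Complex_Main
begin

section \<open>2-TSP with Vertex Requisitions\<close>

text \<open>
  The vertex \<open>x\<^sub>j\<close> is identified with its index \<open>j\<close>, so that \<open>X = {1..n}\<close>. An instance is given by
  \<open>n\<close>, the requisitions \<open>R i = X\<^sup>i\<close> for \<open>i \<in> {1..n}\<close> (values of \<open>R\<close> elsewhere are irrelevant)
  and the weight function \<open>\<rho>\<close> (whose diagonal carries no information).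
\<close>

definition requisitions :: "nat \<Rightarrow> (nat \<Rightarrow> nat set) \<Rightarrow> bool" where
  "requisitions n R \<longleftrightarrow> n \<ge> 1 \<and> (\<forall>i\<in>{1..n}. R i \<subseteq> {1..n} \<and> 1 \<le> card (R i) \<and> card (R i) \<le> 2)"

definition tspvr_instance :: "nat \<Rightarrow> (nat \<Rightarrow> nat set) \<Rightarrow> (nat \<Rightarrow> nat \<Rightarrow> real) \<Rightarrow> bool" where
  "tspvr_instance n R \<rho> \<longleftrightarrow>
     requisitions n R \<and> (\<forall>x\<in>{1..n}. \<forall>y\<in>{1..n}. x \<noteq> y \<longrightarrow> 0 \<le> \<rho> x y)"

definition solutions :: "nat \<Rightarrow> (nat \<Rightarrow> nat set) \<Rightarrow> (nat \<Rightarrow> nat) set" where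
  "solutions n R = {f. bij_betw f {1..n} {1..n} \<and> (\<forall>i\<in>{1..n}. f i \<in> R i)}"

definition feasible :: "nat \<Rightarrow> (nat \<Rightarrow> nat set) \<Rightarrow> bool" where
  "feasible n R \<longleftrightarrow> solutions n R \<noteq> {}"

definition tour_cost :: "nat \<Rightarrow> (nat \<Rightarrow> nat \<Rightarrow> real) \<Rightarrow> (nat \<Rightarrow> nat) \<Rightarrow> real" where
  "tour_cost n \<rho> f = (\<Sum>i = 1..n - 1. \<rho> (f i) (f (i + 1))) + \<rho> (f n) (f 1)"

definition optimal :: "nat \<Rightarrow> (nat \<Rightarrow> nat set) \<Rightarrow> (nat \<Rightarrow> nat \<Rightarrow> real) \<Rightarrow> (nat \<Rightarrow> nat) \<Rightarrow> bool" where
  "optimal n R \<rho> f \<longleftrightarrow> is_arg_min (tour_cost n \<rho>) (\<lambda>g. g \<in> solutions n R) f"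

text \<open>
  The bipartite graph with parts \<open>X\<^sub>n\<close> and \<open>X\<close> is represented by its set of edges; the
  pair \<open>(i, x)\<close> is the edge joining \<open>i \<in> X\<^sub>n\<close> and \<open>x \<in> X\<close>.
\<close>

definition bipartite_graph :: "nat \<Rightarrow> (nat \<Rightarrow> nat set) \<Rightarrow> (nat \<times> nat) set" where
  "bipartite_graph n R = {(i, x). i \<in> {1..n} \<and> x \<in> R i}"

definition chi :: "nat \<Rightarrow> (nat \<times> nat) set set" where
  "chi n = {bipartite_graph n R | R. requisitions n R \<and> feasible n R}"


section \<open>Unit-cost random access machine\<close>

text \<open>
  A machine has an unbounded memory of natural numbers (used for indices and addresses) and an
  unbounded memory of weights, both initially zero, random access to a read-only
  input consisting of a list of naturals and a list of weights, and an output tape. A program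
  is a finite list of instructions; every executed instruction costs one time unit, and the
  machine halts when the program counter leaves the program.

  Index arithmetic is restricted to addition and truncated subtraction, since
  multiplication of unbounded integers at unit cost would make the model unreasonably strong.
  Information flows from weights to indices only through comparisons, and weight
  constants are rational so that a program is a finite object.

  In the instructions, \<open>d\<close> is a destination, \<open>a\<close>, \<open>b\<close>, \<open>s\<close> are source registers, and
  \<open>l\<close> is an absolute jump target.
\<close>

datatype instr =
    Const nat nat
  | Copy nat nat
  | Add nat nat nat
  | Sub nat nat nat
  | Load nat nat
  | Store nat nat
  | Read nat nat
  | Write nat
  | WConst nat rat
  | WCopy nat nat
  | WAdd nat nat nat
  | WSub nat nat nat
  | WMult nat nat nat
  | WDiv nat nat nat
  | WLoad nat nat
  | WStore nat nat
  | WRead nat nat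
  | Jump nat
  | JumpEq nat nat nat
  | JumpLess nat nat nat
  | WJumpEq nat nat nat
  | WJumpLess nat nat nat

record config =
  pc :: nat
  mem :: "nat \<Rightarrow> nat"
  wmem :: "nat \<Rightarrow> real"
  printed :: "nat list"

type_synonym input = "nat list \<times> real list"

definition lookup :: "'a::zero list \<Rightarrow> nat \<Rightarrow> 'a" where
  "lookup xs k = (if k < length xs then xs ! k else 0)"

definition set_mem :: "nat \<Rightarrow> nat \<Rightarrow> config \<Rightarrow> config" where
  "set_mem k v c = c\<lparr>pc := pc c + 1, mem := (mem c)(k := v)\<rparr>"

definition set_wmem :: "nat \<Rightarrow> real \<Rightarrow> config \<Rightarrow> config" where
  "set_wmem k v c = c\<lparr>pc := pc c + 1, wmem := (wmem c)(k := v)\<rparr>"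

definition branch :: "bool \<Rightarrow> nat \<Rightarrow> config \<Rightarrow> config" where
  "branch cond l c = c\<lparr>pc := (if cond then l else pc c + 1)\<rparr>"

fun exec :: "input \<Rightarrow> instr \<Rightarrow> config \<Rightarrow> config" where
  "exec I (Const d k) c = set_mem d k c"
| "exec I (Copy d a) c = set_mem d (mem c a) c"
| "exec I (Add d a b) c = set_mem d (mem c a + mem c b) c"
| "exec I (Sub d a b) c = set_mem d (mem c a - mem c b) c"
| "exec I (Load d a) c = set_mem d (mem c (mem c a)) c"
| "exec I (Store a s) c = set_mem (mem c a) (mem c s) c"
| "exec I (Read d a) c = set_mem d (lookup (fst I) (mem c a)) c"
| "exec I (Write s) c = c\<lparr>pc := pc c + 1, printed := printed c @ [mem c s]\<rparr>"
| "exec I (WConst d q) c = set_wmem d (of_rat q) c"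
| "exec I (WCopy d a) c = set_wmem d (wmem c a) c"
| "exec I (WAdd d a b) c = set_wmem d (wmem c a + wmem c b) c"
| "exec I (WSub d a b) c = set_wmem d (wmem c a - wmem c b) c"
| "exec I (WMult d a b) c = set_wmem d (wmem c a * wmem c b) c"
| "exec I (WDiv d a b) c = set_wmem d (wmem c a / wmem c b) c"
| "exec I (WLoad d a) c = set_wmem d (wmem c (mem c a)) c"
| "exec I (WStore a s) c = set_wmem (mem c a) (wmem c s) c"
| "exec I (WRead d a) c = set_wmem d (lookup (snd I) (mem c a)) c"
| "exec I (Jump l) c = branch True l c"
| "exec I (JumpEq a b l) c = branch (mem c a = mem c b) l c"
| "exec I (JumpLess a b l) c = branch (mem c a < mem c b) l c"
| "exec I (WJumpEq a b l) c = branch (wmem c a = wmem c b) l c"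
| "exec I (WJumpLess a b l) c = branch (wmem c a < wmem c b) l c"

definition halted :: "instr list \<Rightarrow> config \<Rightarrow> bool" where
  "halted P c \<longleftrightarrow> pc c \<ge> length P"

definition step :: "instr list \<Rightarrow> input \<Rightarrow> config \<Rightarrow> config" where
  "step P I c = (if halted P c then c else exec I (P ! pc c) c)"

definition initial :: config where
  "initial = \<lparr>pc = 0, mem = (\<lambda>_. 0), wmem = (\<lambda>_. 0), printed = []\<rparr>"

definition run :: "instr list \<Rightarrow> input \<Rightarrow> nat \<Rightarrow> config" where
  "run P I t = (step P I ^^ t) initial"


section \<open>Solving 2-TSPVR on the machine\<close>

text \<open>
  The set \<open>X\<^sup>i\<close> is given by its minimum and its maximum, which coincide if \<open>|X\<^sup>i| = 1\<close>. Of the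
  weights, the input contains just those of the arcs from \<open>X\<^sup>i\<close> to \<open>X\<^sup>i\<^sup>+\<^sup>1\<close> (indices are cyclic):
  four consecutive entries for each \<open>i\<close>, with \<open>0\<close> in place of a non-existing arc from a
  vertex to itself.
\<close>

definition arc_weight :: "(nat \<Rightarrow> nat \<Rightarrow> real) \<Rightarrow> nat \<Rightarrow> nat \<Rightarrow> real" where
  "arc_weight \<rho> x y = (if x = y then 0 else \<rho> x y)"

definition encode :: "nat \<Rightarrow> (nat \<Rightarrow> nat set) \<Rightarrow> (nat \<Rightarrow> nat \<Rightarrow> real) \<Rightarrow> input" where
  "encode n R \<rho> =
     (n # concat (map (\<lambda>i. [Min (R i), Max (R i)]) [1..<n + 1]),
      concat (map (\<lambda>i. let j = (if i = n then 1 else i + 1) in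
        [arc_weight \<rho> (Min (R i)) (Min (R j)), arc_weight \<rho> (Min (R i)) (Max (R j)),
         arc_weight \<rho> (Max (R i)) (Min (R j)), arc_weight \<rho> (Max (R i)) (Max (R j))]) [1..<n + 1]))"

text \<open>Program \<open>P\<close> halts on the instance after at most \<open>t\<close> steps, having printed an optimal solution.\<close>

definition solves_within ::
  "instr list \<Rightarrow> nat \<Rightarrow> (nat \<Rightarrow> nat set) \<Rightarrow> (nat \<Rightarrow> nat \<Rightarrow> real) \<Rightarrow> nat \<Rightarrow> bool" where
  "solves_within P n R \<rho> t \<longleftrightarrow>
     halted P (run P (encode n R \<rho>) t) \<and>
     (\<exists>f. optimal n R \<rho> f \<and> printed (run P (encode n R \<rho>) t) = map f [1..<n + 1])"

definition solves_tspvr :: "instr list \<Rightarrow> bool" where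
  "solves_tspvr P \<longleftrightarrow>
     (\<forall>n R \<rho>. tspvr_instance n R \<rho> \<and> feasible n R \<longrightarrow> (\<exists>t. solves_within P n R \<rho> t))"

definition chi_star :: "instr list \<Rightarrow> real \<Rightarrow> nat \<Rightarrow> (nat \<times> nat) set set" where
  "chi_star P C n = {G \<in> chi n. \<forall>R \<rho>. tspvr_instance n R \<rho> \<and> bipartite_graph n R = G \<longrightarrow>
     (\<exists>t. real t \<le> C * real n \<and> solves_within P n R \<rho> t)}"

end

(*
Each solution is a perfect matching of the bipartite graph. Repeatedly matching a vertex of degree 1
is forced, and what remains is 2-regular, i.e. a union of k disjoint cycles, each with two perfect
matchings; hence there are exactly 2^k solutions. The cost of a solution is a sum of terms that
depend on the choices made in two cycles only. Aggregating them in a table indexed by pairs of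
(cycle, choice) takes linear time, after which each solution is evaluated in time O((k + 1)^2).
The total is O(n + 2^k (k + 1)^2), which is linear as soon as the number s of solutions satisfies
s^3 <= n^2.

For the counting, sum s and s^2 over all families of requisitions: the first sum is n! n^n, and the
second one is n! times the sum of n^(number of fixed points) over all permutations, hence at most
n! n^n 3 sqrt n. By Cauchy-Schwarz the number N of feasible families satisfies
n! n^n <= 3 sqrt n N, and by Markov's inequality at most n! n^n / n^(2/3) <= 3 n^(-1/6) N of them
have s^3 > n^2.
*)

theory Submission
  imports Defs "HOL-Combinatorics.Permutations" "HOL-Library.FuncSet" "HOL-Analysis.Convex"
begin

section \<open>Structured programs and their compilation\<close>

text \<open>The number of solutions of a uniformly random feasible instance is awkward to analyse
  directly. Pairs (instance, solution) are easy: exactly \<open>n\<close> admissible sets contain a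
  prescribed vertex, so all permutations solve equally many families, and two permutations jointly
  solve a number that depends only on where they agree. Passing from pairs back to instances costs a
  factor of order \<open>sqrt n\<close>. A threshold \<open>n^a\<close> on the number of solutions
  therefore leaves an exceptional share of order \<open>n^(1/2 - a)\<close>, while enumeration takes
  about \<open>n^a\<close> times a squared logarithm. Any \<open>a\<close> strictly between 1/2 and
  1 would serve; \<open>a = 2/3\<close> has the integer form \<open>s^3 \<le> n^2\<close>.

  The machine shapes the algorithm: indices cannot be multiplied, and memory starts as zeros. Hence
  multiples of the table width are tabulated by addition, and the quadratic address range of the
  table costs nothing to clear. Time is a component of the program state, so that one Hoare-style
  argument yields termination, correctness and the bound. The program always finds an optimum; only
  its running time depends on the number of cycles.\<close>

record state =
  nvar :: "nat \<Rightarrow> nat"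
  narr :: "nat \<Rightarrow> nat \<Rightarrow> nat"
  wvar :: "nat \<Rightarrow> real"
  warr :: "nat \<Rightarrow> real"
  outp :: "nat list"
  clock :: nat

datatype basic =
    VConst nat nat
  | VCopy nat nat
  | VAdd nat nat nat
  | VSub nat nat nat
  | Get nat nat nat
  | Put nat nat nat
  | Input nat nat
  | Output nat
  | RZero nat
  | RCopy nat nat
  | RAdd nat nat nat
  | RGet nat nat
  | RPut nat nat
  | RInput nat nat

datatype test = TEq nat nat | TLess nat nat | RLess nat nat

datatype cmd =
    Do basic
  | Seq cmd cmd (infixr ";;" 60)
  | If test cmd cmd
  | While test cmd

definition tick :: "nat \<Rightarrow> state \<Rightarrow> state" where
  "tick t s = s\<lparr>clock := clock s + t\<rparr>"

definition set_nvar :: "nat \<Rightarrow> nat \<Rightarrow> state \<Rightarrow> state" where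
  "set_nvar d v s = s\<lparr>nvar := (nvar s)(d := v)\<rparr>"

definition set_wvar :: "nat \<Rightarrow> real \<Rightarrow> state \<Rightarrow> state" where
  "set_wvar d v s = s\<lparr>wvar := (wvar s)(d := v)\<rparr>"

definition set_narr :: "nat \<Rightarrow> nat \<Rightarrow> nat \<Rightarrow> state \<Rightarrow> state" where
  "set_narr A i v s = s\<lparr>narr := (narr s)(A := (narr s A)(i := v))\<rparr>"

definition set_warr :: "nat \<Rightarrow> real \<Rightarrow> state \<Rightarrow> state" where
  "set_warr i v s = s\<lparr>warr := (warr s)(i := v)\<rparr>"

definition emit :: "nat \<Rightarrow> state \<Rightarrow> state" where
  "emit v s = s\<lparr>outp := outp s @ [v]\<rparr>"

lemmas exec_simps = tick_def set_nvar_def set_wvar_def set_narr_def set_warr_def emit_def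

lemma state_simps [simp]:
  "nvar (tick t s) = nvar s" "narr (tick t s) = narr s" "wvar (tick t s) = wvar s"
  "warr (tick t s) = warr s" "outp (tick t s) = outp s" "clock (tick t s) = clock s + t"
  "nvar (set_nvar d v s) = (nvar s)(d := v)" "narr (set_nvar d v s) = narr s"
  "wvar (set_nvar d v s) = wvar s" "warr (set_nvar d v s) = warr s" "outp (set_nvar d v s) = outp s"
  "clock (set_nvar d v s) = clock s"
  "nvar (set_wvar d w s) = nvar s" "narr (set_wvar d w s) = narr s"
  "wvar (set_wvar d w s) = (wvar s)(d := w)" "warr (set_wvar d w s) = warr s"
  "outp (set_wvar d w s) = outp s" "clock (set_wvar d w s) = clock s"
  "nvar (set_narr A i v s) = nvar s" "narr (set_narr A i v s) = (narr s)(A := (narr s A)(i := v))"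
  "wvar (set_narr A i v s) = wvar s" "warr (set_narr A i v s) = warr s"
  "outp (set_narr A i v s) = outp s" "clock (set_narr A i v s) = clock s"
  "nvar (set_warr i w s) = nvar s" "narr (set_warr i w s) = narr s"
  "wvar (set_warr i w s) = wvar s" "warr (set_warr i w s) = (warr s)(i := w)"
  "outp (set_warr i w s) = outp s" "clock (set_warr i w s) = clock s"
  "nvar (emit v s) = nvar s" "narr (emit v s) = narr s" "wvar (emit v s) = wvar s"
  "warr (emit v s) = warr s" "outp (emit v s) = outp s @ [v]" "clock (emit v s) = clock s"
  by (simp_all add: exec_simps)

text \<open>The ticks are the lengths of the compiled code: 7 stands for six instructions that
  compute an array address and one access, 3 for an access to the single weight array, whose
  addresses are merely shifted by 16.\<close>

fun effect :: "input \<Rightarrow> basic \<Rightarrow> state \<Rightarrow> state" where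
  "effect I (VConst d k) s = tick 1 (set_nvar d k s)"
| "effect I (VCopy d a) s = tick 1 (set_nvar d (nvar s a) s)"
| "effect I (VAdd d a b) s = tick 1 (set_nvar d (nvar s a + nvar s b) s)"
| "effect I (VSub d a b) s = tick 1 (set_nvar d (nvar s a - nvar s b) s)"
| "effect I (Get d A i) s = tick 7 (set_nvar d (narr s A (nvar s i)) s)"
| "effect I (Put A i b) s =
     tick 7 (set_narr A (nvar s i) (nvar s b) s)"
| "effect I (Input d a) s = tick 1 (set_nvar d (lookup (fst I) (nvar s a)) s)"
| "effect I (Output a) s = tick 1 (emit (nvar s a) s)"
| "effect I (RZero d) s = tick 1 (set_wvar d 0 s)"
| "effect I (RCopy d a) s = tick 1 (set_wvar d (wvar s a) s)"
| "effect I (RAdd d a b) s = tick 1 (set_wvar d (wvar s a + wvar s b) s)"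
| "effect I (RGet d i) s = tick 3 (set_wvar d (warr s (nvar s i)) s)"
| "effect I (RPut i b) s = tick 3 (set_warr (nvar s i) (wvar s b) s)"
| "effect I (RInput d a) s = tick 1 (set_wvar d (lookup (snd I) (nvar s a)) s)"

fun holds :: "test \<Rightarrow> state \<Rightarrow> bool" where
  "holds (TEq a b) s \<longleftrightarrow> nvar s a = nvar s b"
| "holds (TLess a b) s \<longleftrightarrow> nvar s a < nvar s b"
| "holds (RLess a b) s \<longleftrightarrow> wvar s a < wvar s b"

section \<open>Timed big-step semantics and total correctness\<close>

text \<open>The ticks mirror the code layout. The true branch lies last, so it pays only for the
  test; the false branch also pays for the jump over it. A loop round pays for the test and the jump
  back, leaving the loop for the test and the jump out.\<close>

inductive big :: "input \<Rightarrow> cmd \<Rightarrow> state \<Rightarrow> state \<Rightarrow> bool" for I where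
  big_Do: "big I (Do b) s (effect I b s)"
| big_Seq: "big I c1 s s1 \<Longrightarrow> big I c2 s1 s2 \<Longrightarrow> big I (c1 ;; c2) s s2"
| big_If_true: "holds t s \<Longrightarrow> big I c1 (tick (Suc 0) s) s1 \<Longrightarrow> big I (If t c1 c2) s s1"
| big_If_false: "\<not> holds t s \<Longrightarrow> big I c2 (tick 2 s) s1 \<Longrightarrow> big I (If t c1 c2) s s1"
| big_While_true: "holds t s \<Longrightarrow> big I c (tick 2 s) s1 \<Longrightarrow> big I (While t c) s1 s2 \<Longrightarrow>
    big I (While t c) s s2"
| big_While_false: "\<not> holds t s \<Longrightarrow> big I (While t c) s (tick 2 s)"

inductive_cases big_DoE: "big I (Do b) s s'"
inductive_cases big_SeqE: "big I (c1 ;; c2) s s'"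
inductive_cases big_IfE: "big I (If t c1 c2) s s'"

text \<open>The existential quantifier includes termination. As the clock belongs to the state, time
  bounds are ordinary postconditions.\<close>

definition wp :: "input \<Rightarrow> cmd \<Rightarrow> (state \<Rightarrow> bool) \<Rightarrow> state \<Rightarrow> bool" where
  "wp I c Q s \<longleftrightarrow> (\<exists>s'. big I c s s' \<and> Q s')"

lemma wp_Do [simp]: "wp I (Do b) Q s \<longleftrightarrow> Q (effect I b s)"
  unfolding wp_def by (blast intro: big_Do elim: big_DoE)

lemma wp_Seq [simp]: "wp I (c1 ;; c2) Q s \<longleftrightarrow> wp I c1 (wp I c2 Q) s"
  unfolding wp_def by (blast intro: big_Seq elim: big_SeqE)

lemma wp_If [simp]:
  "wp I (If t c1 c2) Q s \<longleftrightarrow> (if holds t s then wp I c1 Q (tick (Suc 0) s) else wp I c2 Q (tick 2 s))"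
  unfolding wp_def by (auto intro: big_If_true big_If_false elim: big_IfE)

lemma wp_mono: "wp I c Q s \<Longrightarrow> (\<And>s'. Q s' \<Longrightarrow> Q' s') \<Longrightarrow> wp I c Q' s"
  unfolding wp_def by blast

text \<open>The variant is a parameter of the invariant instead of a function of the state. The
  enumeration loop profits from this: the number of its rounds is visible only through the bits of a
  counter.\<close>

lemma wp_While_variant:
  fixes J :: "nat \<Rightarrow> state \<Rightarrow> bool"
  assumes "J v s"
    and body: "\<And>v s. J v s \<Longrightarrow> holds t s \<Longrightarrow> wp I c (\<lambda>s'. \<exists>v'<v. J v' s') (tick 2 s)"
    and exit: "\<And>v s. J v s \<Longrightarrow> \<not> holds t s \<Longrightarrow> Q (tick 2 s)"
  shows "wp I (While t c) Q s"
  using \<open>J v s\<close>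
proof (induction v arbitrary: s rule: less_induct)
  case (less v)
  show ?case
  proof (cases "holds t s")
    case True
    then obtain s1 v' where "big I c (tick 2 s) s1" "J v' s1" "v' < v"
      using body[OF less.prems] unfolding wp_def by blast
    then show ?thesis
      using less.IH[of v' s1] True unfolding wp_def by (blast intro: big_While_true)
  next
    case False
    then show ?thesis
      using exit less.prems unfolding wp_def by (blast intro: big_While_false)
  qed
qed

lemma wp_While:
  fixes m :: "state \<Rightarrow> nat"
  assumes "J s"
    and "\<And>s. J s \<Longrightarrow> holds t s \<Longrightarrow> wp I c (\<lambda>s'. J s' \<and> m s' < m s) (tick 2 s)"
    and "\<And>s. J s \<Longrightarrow> \<not> holds t s \<Longrightarrow> Q (tick 2 s)"
  shows "wp I (While t c) Q s"
proof (rule wp_While_variant[where J = "\<lambda>v s. J s \<and> m s = v" and v = "m s"])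
  fix v s assume "J s \<and> m s = v" "holds t s"
  then show "wp I c (\<lambda>s'. \<exists>v'<v. J s' \<and> m s' = v') (tick 2 s)"
    using wp_mono[OF assms(2)] by simp
qed (use assms in auto)

lemma wp_count:
  fixes J :: "nat \<Rightarrow> state \<Rightarrow> bool"
  assumes "J l s" "l \<le> h"
    and counter: "\<And>i s. J i s \<Longrightarrow> nvar s d = i \<and> nvar s e = h"
    and body: "\<And>i s. l \<le> i \<Longrightarrow> i < h \<Longrightarrow> J i s \<Longrightarrow> wp I c (J (Suc i)) (tick 2 s)"
    and exit: "\<And>s. J h s \<Longrightarrow> Q (tick 2 s)"
  shows "wp I (While (TLess d e) c) Q s"
proof (rule wp_While[where J = "\<lambda>s. \<exists>i. l \<le> i \<and> i \<le> h \<and> J i s" and m = "\<lambda>s. h - nvar s d"])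
  show "\<exists>i. l \<le> i \<and> i \<le> h \<and> J i s"
    using assms(1,2) by blast
next
  fix s assume *: "\<exists>i. l \<le> i \<and> i \<le> h \<and> J i s" and "holds (TLess d e) s"
  then obtain i where i: "l \<le> i" "i < h" "J i s" "nvar s d = i"
    using counter by force
  show "wp I c (\<lambda>s'. (\<exists>i. l \<le> i \<and> i \<le> h \<and> J i s') \<and> h - nvar s' d < h - nvar s d) (tick 2 s)"
  proof (rule wp_mono[OF body[OF i(1-3)]])
    fix s' assume "J (Suc i) s'"
    then have "l \<le> Suc i \<and> Suc i \<le> h \<and> J (Suc i) s'" "nvar s' d = Suc i"
      using i counter by auto
    then show "(\<exists>i. l \<le> i \<and> i \<le> h \<and> J i s') \<and> h - nvar s' d < h - nvar s d"
      using i(2,4) diff_less_mono2[of i "Suc i" h] by auto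
  qed
next
  fix s assume "\<exists>i. l \<le> i \<and> i \<le> h \<and> J i s" "\<not> holds (TLess d e) s"
  then show "Q (tick 2 s)"
    using counter exit by force
qed

text \<open>
  Cell \<open>i\<close> of array \<open>A < 16\<close> has address \<open>16 * i + A + 32\<close>, so that no array bound has to be
  known; registers 30 and 31 are scratch.
\<close>

definition address :: "nat \<Rightarrow> nat \<Rightarrow> instr list" where
  "address A i =
     [Add 30 i i, Add 30 30 30, Add 30 30 30, Add 30 30 30, Const 31 (32 + A), Add 30 30 31]"

fun compile_basic :: "basic \<Rightarrow> instr list" where
  "compile_basic (VConst d k) = [Const d k]"
| "compile_basic (VCopy d a) = [Copy d a]"
| "compile_basic (VAdd d a b) = [Add d a b]"
| "compile_basic (VSub d a b) = [Sub d a b]"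
| "compile_basic (Get d A i) = address A i @ [Load d 30]"
| "compile_basic (Put A i b) = address A i @ [Store 30 b]"
| "compile_basic (Input d a) = [Read d a]"
| "compile_basic (Output a) = [Write a]"
| "compile_basic (RZero d) = [WConst d 0]"
| "compile_basic (RCopy d a) = [WCopy d a]"
| "compile_basic (RAdd d a b) = [WAdd d a b]"
| "compile_basic (RGet d i) = [Const 31 16, Add 30 i 31, WLoad d 30]"
| "compile_basic (RPut i b) = [Const 31 16, Add 30 i 31, WStore 30 b]"
| "compile_basic (RInput d a) = [WRead d a]"

fun compile_test :: "test \<Rightarrow> nat \<Rightarrow> instr" where
  "compile_test (TEq a b) l = JumpEq a b l"
| "compile_test (TLess a b) l = JumpLess a b l"
| "compile_test (RLess a b) l = WJumpLess a b l"

fun code_size :: "cmd \<Rightarrow> nat" where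
  "code_size (Do b) = length (compile_basic b)"
| "code_size (c1 ;; c2) = code_size c1 + code_size c2"
| "code_size (If t c1 c2) = code_size c1 + code_size c2 + 2"
| "code_size (While t c) = code_size c + 3"

fun compile :: "nat \<Rightarrow> cmd \<Rightarrow> instr list" where
  "compile b (Do x) = compile_basic x"
| "compile b (c1 ;; c2) = compile b c1 @ compile (b + code_size c1) c2"
| "compile b (If t c1 c2) =
     [compile_test t (b + code_size c2 + 2)] @ compile (b + 1) c2 @
     [Jump (b + code_size c2 + code_size c1 + 2)] @ compile (b + code_size c2 + 2) c1"
| "compile b (While t c) =
     [compile_test t (b + 2), Jump (b + code_size c + 3)] @ compile (b + 2) c @ [Jump b]"

lemma length_compile [simp]: "length (compile b c) = code_size c"
  by (induction c arbitrary: b) auto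

fun wf_basic :: "basic \<Rightarrow> bool" where
  "wf_basic (VConst d k) \<longleftrightarrow> d < 30"
| "wf_basic (VCopy d a) \<longleftrightarrow> d < 30 \<and> a < 30"
| "wf_basic (VAdd d a b) \<longleftrightarrow> d < 30 \<and> a < 30 \<and> b < 30"
| "wf_basic (VSub d a b) \<longleftrightarrow> d < 30 \<and> a < 30 \<and> b < 30"
| "wf_basic (Get d A i) \<longleftrightarrow> d < 30 \<and> A < 16 \<and> i < 30"
| "wf_basic (Put A i b) \<longleftrightarrow> A < 16 \<and> i < 30 \<and> b < 30"
| "wf_basic (Input d a) \<longleftrightarrow> d < 30 \<and> a < 30"
| "wf_basic (Output a) \<longleftrightarrow> a < 30"
| "wf_basic (RZero d) \<longleftrightarrow> d < 16"
| "wf_basic (RCopy d a) \<longleftrightarrow> d < 16 \<and> a < 16"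
| "wf_basic (RAdd d a b) \<longleftrightarrow> d < 16 \<and> a < 16 \<and> b < 16"
| "wf_basic (RGet d i) \<longleftrightarrow> d < 16 \<and> i < 30"
| "wf_basic (RPut i b) \<longleftrightarrow> i < 30 \<and> b < 16"
| "wf_basic (RInput d a) \<longleftrightarrow> d < 16 \<and> a < 30"

fun wf_test :: "test \<Rightarrow> bool" where
  "wf_test (TEq a b) \<longleftrightarrow> a < 30 \<and> b < 30"
| "wf_test (TLess a b) \<longleftrightarrow> a < 30 \<and> b < 30"
| "wf_test (RLess a b) \<longleftrightarrow> a < 16 \<and> b < 16"

fun wf_cmd :: "cmd \<Rightarrow> bool" where
  "wf_cmd (Do b) \<longleftrightarrow> wf_basic b"
| "wf_cmd (c1 ;; c2) \<longleftrightarrow> wf_cmd c1 \<and> wf_cmd c2"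
| "wf_cmd (If t c1 c2) \<longleftrightarrow> wf_test t \<and> wf_cmd c1 \<and> wf_cmd c2"
| "wf_cmd (While t c) \<longleftrightarrow> wf_test t \<and> wf_cmd c"

section \<open>Correctness of the compiler\<close>

text \<open>Registers 30 and 31 are left open, so address computations may overwrite them. From
  address 32 on, the sixteen interleaved arrays partition the memory.\<close>

definition simulates :: "state \<Rightarrow> config \<Rightarrow> bool" where
  "simulates s c \<longleftrightarrow>
     (\<forall>d<30. mem c d = nvar s d) \<and> (\<forall>A<16. \<forall>i. mem c (16 * i + (32 + A)) = narr s A i) \<and>
     (\<forall>d<16. wmem c d = wvar s d) \<and> (\<forall>i. wmem c (i + 16) = warr s i) \<and> printed c = outp s"

definition code_at :: "instr list \<Rightarrow> nat \<Rightarrow> instr list \<Rightarrow> bool" where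
  "code_at P b xs \<longleftrightarrow> (\<exists>us vs. P = us @ xs @ vs \<and> length us = b)"

lemma code_at_appendD:
  assumes "code_at P b (xs @ ys)"
  shows "code_at P b xs" "code_at P (b + length xs) ys"
proof -
  obtain us vs where P: "P = us @ (xs @ ys) @ vs" "length us = b"
    using assms unfolding code_at_def by blast
  then have "P = us @ xs @ (ys @ vs) \<and> length us = b"
    by simp
  then show "code_at P b xs"
    unfolding code_at_def by blast
  have "P = (us @ xs) @ ys @ vs \<and> length (us @ xs) = b + length xs"
    using P by simp
  then show "code_at P (b + length xs) ys"
    unfolding code_at_def by blast
qed

lemma code_at_ConsD:
  assumes "code_at P b (x # xs)"
  shows "b < length P" "P ! b = x" "code_at P (Suc b) xs"
proof -
  obtain us vs where P: "P = us @ (x # xs) @ vs" "length us = b"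
    using assms unfolding code_at_def by blast
  then show "b < length P" "P ! b = x"
    by (auto simp: nth_append)
  show "code_at P (Suc b) xs"
    using code_at_appendD(2)[of P b "[x]" xs] assms by simp
qed

lemma step_code_at:
  "code_at P b (x # xs) \<Longrightarrow> pc c = b \<Longrightarrow> step P I c = exec I x c"
  using code_at_ConsD[of P b x xs] by (simp add: step_def halted_def)

definition reaches :: "instr list \<Rightarrow> input \<Rightarrow> config \<Rightarrow> nat \<Rightarrow> config \<Rightarrow> bool" where
  "reaches P I c t c' \<longleftrightarrow> (step P I ^^ t) c = c'"

lemma reaches_0: "reaches P I c 0 c"
  by (simp add: reaches_def)

lemma reaches_trans: "reaches P I c t c' \<Longrightarrow> reaches P I c' u c'' \<Longrightarrow> reaches P I c (t + u) c''"
  unfolding reaches_def add.commute[of t u] by (simp add: funpow_add)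

lemma reaches_Suc: "reaches P I (step P I c) t c' \<Longrightarrow> reaches P I c (Suc t) c'"
  by (simp add: reaches_def funpow_swap1)

lemma reaches_straight_line:
  assumes "code_at P (pc c) xs"
    and "\<And>x c. x \<in> set xs \<Longrightarrow> pc (exec I x c) = Suc (pc c)"
  shows "reaches P I c (length xs) (fold (exec I) xs c) \<and> pc (fold (exec I) xs c) = pc c + length xs"
  using assms
proof (induction xs arbitrary: c)
  case Nil
  then show ?case by (simp add: reaches_0)
next
  case (Cons x xs)
  have step: "step P I c = exec I x c" and pc: "pc (exec I x c) = Suc (pc c)"
    using step_code_at[OF Cons.prems(1)] Cons.prems(2)[of x c] by auto
  have "code_at P (pc (exec I x c)) xs"
    using code_at_ConsD(3)[OF Cons.prems(1)] pc by simp
  then show ?case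
    using Cons.IH[of "exec I x c"] Cons.prems(2) step pc
    by (auto intro: reaches_Suc)
qed

lemma pc_compile_basic: "x \<in> set (compile_basic b) \<Longrightarrow> pc (exec I x c) = Suc (pc c)"
  by (cases b) (auto simp: address_def set_mem_def set_wmem_def)

lemma address_eq_iff:
  "A < 16 \<Longrightarrow> B < 16 \<Longrightarrow> 16 * i + A = 16 * j + B \<longleftrightarrow> i = j \<and> A = (B :: nat)"
proof
  assume "A < 16" "B < 16" "16 * i + A = 16 * j + B"
  then have "(16 * i + A) div 16 = (16 * j + B) div 16" "(16 * i + A) mod 16 = (16 * j + B) mod 16"
    by simp_all
  with \<open>A < 16\<close> \<open>B < 16\<close> show "i = j \<and> A = B"
    by simp
qed auto

lemma compile_basic_sound:
  assumes "wf_basic b" "simulates s c"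
  shows "simulates (effect I b s) (fold (exec I) (compile_basic b) c)"
  using assms
  by (cases b)
    (auto simp: simulates_def address_def set_mem_def set_wmem_def 
       address_eq_iff)

lemma clock_effect: "clock (effect I b s) = clock s + length (compile_basic b)"
  by (cases b) (auto simp:   address_def)

lemma simulates_tick [simp]: "simulates (tick t s) c = simulates s c"
  by (simp add: simulates_def tick_def)

lemma simulates_pc [simp]: "simulates s (c\<lparr>pc := l\<rparr>) = simulates s c"
  by (simp add: simulates_def)

lemma exec_compile_test:
  "wf_test t \<Longrightarrow> simulates s c \<Longrightarrow>
     exec I (compile_test t l) c = c\<lparr>pc := (if holds t s then l else Suc (pc c))\<rparr>"
  by (cases t) (auto simp: simulates_def branch_def)

text \<open>The induction follows the derivation rather than the command, because a loop refers to
  itself. The clock equation is exact, so time bounds carry over to the machine without any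
  loss.\<close>

lemma compile_sound:
  assumes "big I c s s'" "wf_cmd c" "code_at P b (compile b c)" "simulates s cf" "pc cf = b"
  shows "\<exists>t cf'. reaches P I cf t cf' \<and> clock s' = clock s + t \<and> simulates s' cf' \<and>
    pc cf' = b + code_size c"
  using assms
proof (induction arbitrary: b cf rule: big.induct)
  case (big_Do x s)
  have "reaches P I cf (length (compile_basic x)) (fold (exec I) (compile_basic x) cf) \<and>
      pc (fold (exec I) (compile_basic x) cf) = pc cf + length (compile_basic x)"
    using big_Do pc_compile_basic by (intro reaches_straight_line) auto
  then show ?case
    using big_Do compile_basic_sound[of x s cf I] clock_effect[of I x s] by auto
next
  case (big_Seq c1 s s1 c2 s2)
  have code: "code_at P b (compile b c1)" "code_at P (b + code_size c1) (compile (b + code_size c1) c2)"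
    using code_at_appendD[of P b "compile b c1"] big_Seq.prems by auto
  obtain t cf1 where 1: "reaches P I cf t cf1" "clock s1 = clock s + t" "simulates s1 cf1"
      "pc cf1 = b + code_size c1"
    using big_Seq.IH(1)[OF _ code(1), of cf] big_Seq.prems by auto
  then obtain u cf2 where 2: "reaches P I cf1 u cf2" "clock s2 = clock s1 + u" "simulates s2 cf2"
      "pc cf2 = b + code_size c1 + code_size c2"
    using big_Seq.IH(2)[OF _ code(2), of cf1] big_Seq.prems by auto
  show ?case
    using reaches_trans[OF 1(1) 2(1)] 1 2 by (intro exI[of _ "t + u"] exI[of _ cf2]) auto
next
  case (big_If_true t s c1 s1 c2)
  let ?l = "b + code_size c2 + 2"
  have code: "code_at P b (compile_test t ?l # compile (b + 1) c2 @
      [Jump (b + code_size c2 + code_size c1 + 2)] @ compile ?l c1)"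
    using big_If_true.prems by simp
  have code1: "code_at P ?l (compile ?l c1)"
    using code_at_appendD(2)[of P b "compile_test t ?l # compile (b + 1) c2 @
      [Jump (b + code_size c2 + code_size c1 + 2)]" "compile ?l c1"] code by simp
  have 1: "step P I cf = cf\<lparr>pc := ?l\<rparr>"
    using step_code_at[OF code] exec_compile_test[of t s cf I ?l] big_If_true by simp
  obtain u cf1 where 2: "reaches P I (step P I cf) u cf1" "clock s1 = clock (tick (Suc 0) s) + u"
      "simulates s1 cf1" "pc cf1 = ?l + code_size c1"
    using big_If_true.IH[OF _ code1, of "cf\<lparr>pc := ?l\<rparr>"] big_If_true.prems 1 by auto
  show ?case
    using reaches_Suc[OF 2(1)] 2 by (intro exI[of _ "Suc u"] exI[of _ cf1]) auto
next
  case (big_If_false t s c2 s1 c1)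
  let ?l = "b + code_size c2 + 2"
  let ?e = "b + code_size c2 + code_size c1 + 2"
  have code: "code_at P b (compile_test t ?l # compile (b + 1) c2 @ [Jump ?e] @ compile ?l c1)"
    using big_If_false.prems by simp
  have code1: "code_at P (b + 1) (compile (b + 1) c2 @ Jump ?e # compile ?l c1)"
    using code_at_ConsD(3)[OF code] by simp
  have code2: "code_at P (b + 1 + code_size c2) (Jump ?e # compile ?l c1)"
    using code_at_appendD(2)[OF code1] by simp
  have 1: "step P I cf = cf\<lparr>pc := b + 1\<rparr>"
    using step_code_at[OF code] exec_compile_test[of t s cf I ?l] big_If_false by simp
  obtain u cf1 where 2: "reaches P I (step P I cf) u cf1" "clock s1 = clock (tick 2 s) + u"
      "simulates s1 cf1" "pc cf1 = b + 1 + code_size c2"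
    using big_If_false.IH[OF _ code_at_appendD(1)[OF code1], of "cf\<lparr>pc := b + 1\<rparr>"]
      big_If_false.prems 1 by auto
  have 3: "reaches P I cf1 1 (cf1\<lparr>pc := ?e\<rparr>)"
    using step_code_at[OF code2 2(4)] by (simp add: reaches_def branch_def)
  show ?case
    using reaches_trans[OF reaches_Suc[OF 2(1)] 3] 2
    by (intro exI[of _ "Suc u + 1"] exI[of _ "cf1\<lparr>pc := ?e\<rparr>"]) auto
next
  case (big_While_true t s c s1 s2)
  let ?e = "b + code_size c + 3"
  have code: "code_at P b (compile_test t (b + 2) # Jump ?e # compile (b + 2) c @ [Jump b])"
    using big_While_true.prems by simp
  have code1: "code_at P (b + 2) (compile (b + 2) c @ [Jump b])"
    using code_at_ConsD(3)[OF code_at_ConsD(3)[OF code]] by simp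
  have code2: "code_at P (b + 2 + code_size c) [Jump b]"
    using code_at_appendD(2)[OF code1] by simp
  have 1: "step P I cf = cf\<lparr>pc := b + 2\<rparr>"
    using step_code_at[OF code] exec_compile_test[of t s cf I "b + 2"] big_While_true by simp
  obtain u cf1 where 2: "reaches P I (step P I cf) u cf1" "clock s1 = clock (tick 2 s) + u"
      "simulates s1 cf1" "pc cf1 = b + 2 + code_size c"
    using big_While_true.IH(1)[OF _ code_at_appendD(1)[OF code1], of "cf\<lparr>pc := b + 2\<rparr>"]
      big_While_true.prems 1 by auto
  have 3: "reaches P I cf1 1 (cf1\<lparr>pc := b\<rparr>)"
    using step_code_at[OF code2 2(4)] by (simp add: reaches_def branch_def)
  obtain v cf2 where 4: "reaches P I (cf1\<lparr>pc := b\<rparr>) v cf2" "clock s2 = clock s1 + v"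
      "simulates s2 cf2" "pc cf2 = b + code_size (While t c)"
    using big_While_true.IH(2)[OF _ big_While_true.prems(2), of "cf1\<lparr>pc := b\<rparr>"]
      big_While_true.prems 2 by auto
  show ?case
    using reaches_trans[OF reaches_trans[OF reaches_Suc[OF 2(1)] 3] 4(1)] 2 4
    by (intro exI[of _ "Suc u + 1 + v"] exI[of _ cf2]) auto
next
  case (big_While_false t s c)
  let ?e = "b + code_size c + 3"
  have code: "code_at P b (compile_test t (b + 2) # Jump ?e # compile (b + 2) c @ [Jump b])"
    using big_While_false.prems by simp
  have 1: "step P I cf = cf\<lparr>pc := Suc b\<rparr>"
    using step_code_at[OF code] exec_compile_test[of t s cf I "b + 2"] big_While_false by simp
  have 2: "step P I (cf\<lparr>pc := Suc b\<rparr>) = cf\<lparr>pc := ?e\<rparr>"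
    using step_code_at[OF code_at_ConsD(3)[OF code], of "cf\<lparr>pc := Suc b\<rparr>"]
    by (simp add: branch_def)
  have "reaches P I cf 2 (cf\<lparr>pc := ?e\<rparr>)"
    using 1 2 by (simp add: reaches_def numeral_2_eq_2)
  then show ?case
    using big_While_false.prems
    by (intro exI[of _ 2] exI[of _ "cf\<lparr>pc := ?e\<rparr>"]) auto
qed

definition start :: state where
  "start = \<lparr>nvar = (\<lambda>_. 0), narr = (\<lambda>_ _. 0), wvar = (\<lambda>_. 0), warr = (\<lambda>_. 0), outp = [], clock = 0\<rparr>"

theorem compile_run:
  assumes "wf_cmd c" "wp I c Q start"
  obtains s where "Q s" "halted (compile 0 c) (run (compile 0 c) I (clock s))"
    "printed (run (compile 0 c) I (clock s)) = outp s"
proof -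
  obtain s where s: "big I c start s" "Q s"
    using assms unfolding wp_def by blast
  have "code_at (compile 0 c) 0 (compile 0 c)"
    by (auto simp: code_at_def)
  moreover have "simulates start initial"
    by (simp add: simulates_def start_def initial_def)
  ultimately obtain t cf where
    "reaches (compile 0 c) I initial t cf" "clock s = clock start + t" "simulates s cf"
      "pc cf = 0 + code_size c"
    using compile_sound[OF s(1) assms(1), of "compile 0 c" 0 initial] by (auto simp: initial_def)
  then show ?thesis
    using s(2) that[of s] by (simp add: reaches_def run_def start_def halted_def simulates_def)
qed

section \<open>Peeling leaves and tracing cycles\<close>

locale feasible_requisitions =
  fixes n :: nat and R :: "nat \<Rightarrow> nat set"
  assumes requisitions: "requisitions n R" and feasible: "feasible n R"
begin

text \<open>For a singleton the sum counts the element twice, so that \<open>ends i - u\<close>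
  gives back \<open>u\<close> and both sizes of requisitions are treated alike.\<close>

definition ends :: "nat \<Rightarrow> nat" where
  "ends i = Min (R i) + Max (R i)"

text \<open>
  Storing for every vertex just the number and the sum of its incident positions replaces adjacency
  lists: the position at a leaf is that sum, and the position sharing a vertex of degree 2 with
  position \<open>p\<close> is the sum minus \<open>p\<close>. Likewise \<open>ends i - u\<close> is the other end of position \<open>i\<close>.
\<close>

definition incident :: "nat set \<Rightarrow> nat \<Rightarrow> nat set" where
  "incident F x = {i \<in> {1..n} - F. x \<in> R i}"

lemma n_pos: "1 \<le> n"
  using requisitions by (simp add: requisitions_def)

lemma R_subset: "i \<in> {1..n} \<Longrightarrow> R i \<subseteq> {1..n}"
  using requisitions by (simp add: requisitions_def)

lemma finite_R: "i \<in> {1..n} \<Longrightarrow> finite (R i)"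
  using R_subset finite_subset by blast

lemma R_nonempty: "i \<in> {1..n} \<Longrightarrow> R i \<noteq> {}"
  using requisitions unfolding requisitions_def by (metis card.empty not_one_le_zero)

lemma card_R_le: "i \<in> {1..n} \<Longrightarrow> card (R i) \<le> 2"
  using requisitions by (simp add: requisitions_def)

lemma R_eq_Min_Max:
  assumes "i \<in> {1..n}"
  shows "R i = {Min (R i), Max (R i)}"
proof (rule sym, rule card_seteq)
  show "finite (R i)" "{Min (R i), Max (R i)} \<subseteq> R i"
    using assms finite_R R_nonempty by auto
  show "card (R i) \<le> card {Min (R i), Max (R i)}"
  proof (cases "Min (R i) = Max (R i)")
    case True
    then have "R i \<subseteq> {Min (R i)}"
      using finite_R[OF assms] by (metis Max_ge Min_le antisym singletonI subsetI)
    then show ?thesis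
      using card_mono[of "{Min (R i)}" "R i"] by (simp add: card_insert_if)
  qed (use card_R_le[OF assms] in simp)
qed

lemma pair_eq_diff: "S = {a, b} \<Longrightarrow> u \<in> S \<Longrightarrow> S = {u, a + b - (u :: nat)}"
  by auto

lemma R_eq_ends:
  assumes "i \<in> {1..n}" "u \<in> R i"
  shows "R i = {u, ends i - u}"
  unfolding ends_def by (rule pair_eq_diff[OF R_eq_Min_Max[OF assms(1)] assms(2)])

lemma ends_diff_in_R: "i \<in> {1..n} \<Longrightarrow> u \<in> R i \<Longrightarrow> ends i - u \<in> R i"
  using R_eq_ends[of i u] by (metis insertCI)

lemma R_pos: "i \<in> {1..n} \<Longrightarrow> u \<in> R i \<Longrightarrow> 1 \<le> u \<and> u \<le> n"
  using R_subset[of i] by auto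

lemma finite_incident [simp]: "finite (incident F x)"
  by (simp add: incident_def)

lemma incident_insert: "incident (insert i F) x = incident F x - {i}"
  by (auto simp: incident_def)

lemma solutions_cover:
  assumes "g \<in> solutions n R" "x \<in> {1..n}"
  obtains i where "i \<in> {1..n}" "g i = x" "x \<in> R i"
proof -
  have "x \<in> g ` {1..n}"
    using assms unfolding solutions_def bij_betw_def by simp
  then show ?thesis
    using assms(1) that unfolding solutions_def by blast
qed

lemma solutions_inj: "g \<in> solutions n R \<Longrightarrow> inj_on g {1..n}"
  by (simp add: solutions_def bij_betw_def)

lemma solutions_R: "g \<in> solutions n R \<Longrightarrow> i \<in> {1..n} \<Longrightarrow> g i \<in> R i"
  by (simp add: solutions_def)

lemma solution_exists: "\<exists>g. g \<in> solutions n R"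
  using feasible by (simp add: feasible_def ex_in_conv)

text \<open>The last clause separates the two parts of the problem: a vertex given to a position of
  \<open>F\<close> occurs in no remaining requisition, so later choices cannot collide with
  it.\<close>

definition peeled :: "nat set \<Rightarrow> (nat \<Rightarrow> nat) \<Rightarrow> bool" where
  "peeled F A \<longleftrightarrow> F \<subseteq> {1..n} \<and> (\<forall>g\<in>solutions n R. \<forall>i\<in>F. g i = A i) \<and>
     (\<forall>i\<in>F. incident F (A i) = {})"

lemma peeled_empty [simp]: "peeled {} A"
  by (simp add: peeled_def)

text \<open>A position of \<open>F\<close> cannot be the one that takes \<open>x\<close>, because
  the vertex it takes has no remaining incidences.\<close>

lemma peeled_cover:
  assumes "peeled F A" "g \<in> solutions n R" "x \<in> {1..n}" "incident F x \<noteq> {}"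
  obtains i where "i \<in> incident F x" "g i = x"
proof -
  obtain i where i: "i \<in> {1..n}" "g i = x" "x \<in> R i"
    using solutions_cover[OF assms(2,3)] .
  then have "i \<notin> F"
    using assms unfolding peeled_def by auto
  then show ?thesis
    using i that[of i] unfolding incident_def by blast
qed

text \<open>Some remaining position must take \<open>v\<close>, and \<open>i\<close> is the only
  candidate. Once \<open>i\<close> is removed, no incidence of \<open>v\<close> remains, which
  restores the last clause of \<open>peeled\<close>.\<close>

lemma peeled_insert:
  assumes "peeled F A" "incident F v = {i}"
  shows "peeled (insert i F) (A(i := v))"
proof -
  have i: "i \<in> {1..n}" "i \<notin> F" "v \<in> R i"
    using assms(2) by (auto simp: incident_def)
  have "g i = v" if g: "g \<in> solutions n R" for g
  proof -
    have "v \<in> {1..n}"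
      using R_subset[OF i(1)] i(3) by blast
    then obtain j where "j \<in> incident F v" "g j = v"
      using peeled_cover[OF assms(1) g] assms(2) by blast
    then show ?thesis
      using assms(2) by simp
  qed
  moreover have "g j = (A(i := v)) j" if "g \<in> solutions n R" "j \<in> F" for g j
    using assms(1) that i(2) unfolding peeled_def by auto
  moreover have "incident (insert i F) ((A(i := v)) j) = {}" if "j \<in> F" for j
    using assms(1) that i(2) unfolding peeled_def incident_insert by auto
  moreover have "insert i F \<subseteq> {1..n}"
    using assms(1) i(1) unfolding peeled_def by blast
  ultimately show ?thesis
    using assms(2) unfolding peeled_def by (simp add: incident_insert)
qed

lemma peeled_residual_regular:
  assumes "peeled F A" and ne1: "\<forall>x\<in>{1..n}. card (incident F x) \<noteq> 1"
    and i: "i \<in> {1..n} - F"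
  shows "card (R i) = 2 \<and> (\<forall>x\<in>R i. card (incident F x) = 2)"
proof -
  obtain g where g: "g \<in> solutions n R"
    using solution_exists ..
  define V where "V = {1..n} - F"
  have finV: "finite V" and inj: "inj_on g V"
    using inj_on_subset[OF solutions_inj[OF g], of V] by (simp_all add: V_def Diff_subset)
  have sub: "R i \<subseteq> g ` V" if i: "i \<in> V" for i
  proof
    fix x assume x: "x \<in> R i"
    then have "x \<in> {1..n}" "incident F x \<noteq> {}"
      using i R_subset[of i] unfolding V_def incident_def by blast+
    then obtain j where "j \<in> incident F x" "g j = x"
      using peeled_cover[OF assms(1) g] by blast
    then show "x \<in> g ` V"
      by (auto simp: incident_def V_def)
  qed
  have ge2: "card (incident F x) \<ge> 2" if x: "x \<in> g ` V" for x
  proof -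
    obtain j where j: "j \<in> V" "x = g j"
      using x by blast
    then have "x \<in> R j" "j \<in> {1..n}"
      using solutions_R[OF g, of j] unfolding V_def by blast+
    then have "j \<in> incident F x" "x \<in> {1..n}"
      using j(1) R_subset[of j] unfolding incident_def V_def by blast+
    then have "card (incident F x) \<noteq> 0" "card (incident F x) \<noteq> 1"
      using ne1 by auto
    then show ?thesis
      by linarith
  qed
  have "(\<Sum>x\<in>g ` V. card (incident F x)) = (\<Sum>x\<in>g ` V. \<Sum>i\<in>V. if x \<in> R i then 1 else 0)"
    using finV by (intro sum.cong refl) (simp add: sum.If_cases incident_def V_def Int_def)
  also have "\<dots> = (\<Sum>i\<in>V. \<Sum>x\<in>g ` V. if x \<in> R i then 1 else 0)"
    by (rule sum.swap)
  also have "\<dots> = (\<Sum>i\<in>V. card (R i))"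
  proof (intro sum.cong refl)
    fix i assume "i \<in> V"
    then have "g ` V \<inter> {x. x \<in> R i} = R i"
      using sub by blast
    then show "(\<Sum>x\<in>g ` V. if x \<in> R i then 1 else 0) = card (R i)"
      using finV by (simp add: sum.If_cases)
  qed
  finally have eq: "(\<Sum>x\<in>g ` V. card (incident F x)) = (\<Sum>i\<in>V. card (R i))" .
  have le: "(\<Sum>i\<in>V. card (R i)) \<le> (\<Sum>i\<in>V. 2)"
    using card_R_le by (intro sum_mono) (auto simp: V_def)
  have ge: "(\<Sum>x\<in>g ` V. 2) \<le> (\<Sum>x\<in>g ` V. card (incident F x))"
    using ge2 by (intro sum_mono) auto
  have two: "(\<Sum>x\<in>g ` V. 2) = (\<Sum>i\<in>V. 2::nat)"
    using inj by (simp add: card_image)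
  have "card (R i) = 2" if "i \<in> V" for i
  proof (rule ccontr)
    assume "card (R i) \<noteq> 2"
    then have "(\<Sum>i\<in>V. card (R i)) < (\<Sum>i\<in>V. 2)"
      using that card_R_le finV by (intro sum_strict_mono_ex1) (force simp: V_def)+
    then show False
      using eq ge two by linarith
  qed
  moreover have "card (incident F x) = 2" if "x \<in> g ` V" for x
  proof (rule ccontr)
    assume "card (incident F x) \<noteq> 2"
    then have "(\<Sum>x\<in>g ` V. 2) < (\<Sum>x\<in>g ` V. card (incident F x))"
      using that ge2 finV by (intro sum_strict_mono_ex1) force+
    then show False
      using eq le two by linarith
  qed
  ultimately show ?thesis
    using sub i V_def by blast
qed

end

section \<open>Cycles of the 2-regular residual graph\<close>

locale residual_cycles = feasible_requisitions +
  fixes F :: "nat set" and A :: "nat \<Rightarrow> nat"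
  assumes peeled: "peeled F A"
    and no_leaf: "\<forall>x\<in>{1..n}. card (incident F x) \<noteq> 1"
begin

lemma F_subset: "F \<subseteq> {1..n}"
  using peeled by (simp add: peeled_def)

lemma card_R: "i \<in> {1..n} - F \<Longrightarrow> card (R i) = 2"
  using peeled_residual_regular[OF peeled no_leaf] by blast

lemma card_incident: "i \<in> {1..n} - F \<Longrightarrow> x \<in> R i \<Longrightarrow> card (incident F x) = 2"
  using peeled_residual_regular[OF peeled no_leaf] by blast

lemma ends_diff_neq:
  assumes "i \<in> {1..n} - F" "u \<in> R i"
  shows "ends i - u \<noteq> u"
  using R_eq_ends[of i u] card_R[of i] assms by auto

lemma incident_pair:
  assumes "p \<in> {1..n} - F" "x \<in> R p"
  obtains j where "incident F x = {p, j}" "j \<noteq> p" "\<Sum>(incident F x) - p = j"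
    "j \<in> {1..n} - F" "x \<in> R j"
proof -
  have p: "p \<in> incident F x"
    using assms by (simp add: incident_def)
  then have "card (incident F x - {p}) = 1"
    using card_incident[OF assms] by simp
  then obtain j where j: "incident F x - {p} = {j}"
    using card_1_singletonE by blast
  then have "incident F x = {p, j}" "j \<noteq> p"
    using p by auto
  then show ?thesis
    using that j by (auto simp: incident_def)
qed

text \<open>Degree 2 in the form used below: two distinct residual positions exhaust a
  vertex.\<close>

lemma three_incident:
  assumes "x \<in> R i" "x \<in> R j" "x \<in> R l" "{i, j, l} \<subseteq> {1..n} - F" "i \<noteq> j"
  shows "l = i \<or> l = j"
proof (rule ccontr)
  assume "\<not> ?thesis"
  then have "card {i, j, l} = 3"
    using assms(5) by auto
  moreover have "card {i, j, l} \<le> card (incident F x)"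
    using assms by (intro card_mono) (auto simp: incident_def)
  ultimately show False
    using card_incident[of i x] assms by simp
qed

text \<open>\<open>U\<close> is a union of whole cycles numbered by \<open>B\<close>, and
  \<open>A0\<close>, \<open>A1\<close> are their two alternating matchings. The two clauses with
  witnesses \<open>j\<close> close the cycles without recording an order: each vertex that is one
  option of a position is the other option of a position in the same block. The numbering starts at
  1, since 0 is reserved for forced positions.\<close>

definition resolved ::
  "nat set \<Rightarrow> nat \<Rightarrow> (nat \<Rightarrow> nat) \<Rightarrow> (nat \<Rightarrow> nat) \<Rightarrow> (nat \<Rightarrow> nat) \<Rightarrow> bool" where
  "resolved U k A0 A1 B \<longleftrightarrow> U \<subseteq> {1..n} - F \<and>
     (\<forall>i\<in>U. B i \<in> {1..k} \<and> A0 i \<noteq> A1 i \<and> R i = {A0 i, A1 i}) \<and> {1..k} \<subseteq> B ` U \<and>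
     (\<forall>i\<in>U. \<exists>j\<in>U. B j = B i \<and> A0 j = A1 i) \<and>
     (\<forall>i\<in>U. \<exists>j\<in>U. B j = B i \<and> A1 j = A0 i) \<and>
     (\<forall>g\<in>solutions n R. \<forall>i\<in>U. \<forall>j\<in>U. B i = B j \<longrightarrow> (g i = A0 i \<longleftrightarrow> g j = A0 j))"

text \<open>
  The visited part \<open>V\<close> of a cycle, from position \<open>o1\<close> to position \<open>p\<close>. Its order is not recorded: that
  \<open>A0\<close> and \<open>A1\<close> match up except at the two extremes suffices to see that the first visited
  position to be met again is \<open>o1\<close>.
\<close>

definition path ::
  "nat set \<Rightarrow> nat \<Rightarrow> nat set \<Rightarrow> nat \<Rightarrow> (nat \<Rightarrow> nat) \<Rightarrow> (nat \<Rightarrow> nat) \<Rightarrow> bool" where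
  "path U o1 V p A0 A1 \<longleftrightarrow> V \<subseteq> {1..n} - F - U \<and> o1 \<in> V \<and> p \<in> V \<and>
     (\<forall>q\<in>V. A0 q \<noteq> A1 q \<and> R q = {A0 q, A1 q}) \<and>
     (\<forall>q\<in>V - {p}. \<exists>q'\<in>V. A0 q' = A1 q) \<and>
     (\<forall>q\<in>V - {o1}. \<exists>q'\<in>V - {p}. A1 q' = A0 q) \<and>
     (\<forall>g\<in>solutions n R. \<forall>q\<in>V. g q = A0 q \<longleftrightarrow> g o1 = A0 o1)"

lemma resolved_empty: "resolved {} 0 A0 A1 B"
  by (simp add: resolved_def)

lemma path_start:
  assumes "o1 \<in> {1..n} - F - U" "A0 o1 \<in> R o1" "A1 o1 = ends o1 - A0 o1"
  shows "path U o1 {o1} o1 A0 A1"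
  using assms R_eq_ends[of o1 "A0 o1"] ends_diff_neq[of o1 "A0 o1"] unfolding path_def by auto

text \<open>If \<open>j\<close> lay in \<open>U\<close>, the closure clauses of
  \<open>resolved\<close> would supply a second position of \<open>U\<close> at the vertex
  \<open>A1 p\<close>. Together with \<open>p\<close>, which is outside \<open>U\<close>, that makes
  three positions at one vertex.\<close>

lemma path_next:
  assumes "path U o1 V p A0 A1" "resolved U k A0 A1 B"
  obtains j where "\<Sum>(incident F (A1 p)) - p = j" "j \<in> {1..n} - F - U" "j \<noteq> p" "A1 p \<in> R j"
    "incident F (A1 p) = {p, j}"
proof -
  have p: "p \<in> {1..n} - F" "A1 p \<in> R p" "p \<notin> U"
    using assms(1) unfolding path_def by auto
  obtain j where j: "incident F (A1 p) = {p, j}" "j \<noteq> p" "\<Sum>(incident F (A1 p)) - p = j"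
      "j \<in> {1..n} - F" "A1 p \<in> R j"
    using incident_pair[OF p(1,2)] .
  have "j \<notin> U"
  proof
    assume jU: "j \<in> U"
    then have A: "A0 j \<noteq> A1 j" "A1 p = A0 j \<or> A1 p = A1 j"
      using assms(2) j(5) unfolding resolved_def by auto
    have "\<exists>l\<in>U. l \<noteq> j \<and> A1 p \<in> R l"
    proof (cases "A1 p = A0 j")
      case True
      then obtain l where "l \<in> U" "A1 l = A1 p"
        using assms(2) jU unfolding resolved_def by metis
      then show ?thesis
        using assms(2) A True unfolding resolved_def by (metis insertCI)
    next
      case False
      then obtain l where "l \<in> U" "A0 l = A1 p"
        using assms(2) jU A unfolding resolved_def by metis
      then show ?thesis
        using assms(2) A False unfolding resolved_def by (metis insertCI)
    qed
    then obtain l where "l \<in> U" "l \<noteq> j" "A1 p \<in> R l"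
      by blast
    moreover have "l \<in> {1..n} - F"
      using \<open>l \<in> U\<close> assms(2) unfolding resolved_def by blast
    ultimately show False
      using three_incident[of "A1 p" p j l] p j by auto
  qed
  then show ?thesis
    using that j by blast
qed

text \<open>In any solution the vertex \<open>A1 p\<close> is taken by exactly one of
  \<open>p\<close> and \<open>j\<close>. So \<open>j\<close> takes its entry vertex iff
  \<open>p\<close> does not take its exit vertex, i.e. iff \<open>p\<close> takes its own entry
  vertex; the choice at \<open>o1\<close> propagates along the path.\<close>

lemma path_step:
  assumes path: "path U o1 V p A0 A1" and inc: "incident F (A1 p) = {p, j}" "j \<noteq> p"
    and j: "j \<in> {1..n} - F - U" "A1 p \<in> R j" "j \<notin> V"
    and A0': "A0' = A0(j := A1 p)" and A1': "A1' = A1(j := ends j - A1 p)"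
  shows "path U o1 (insert j V) j A0' A1'"
proof -
  have V: "q \<noteq> j" if "q \<in> V" for q
    using path j that unfolding path_def by auto
  have Rj: "R j = {A1 p, ends j - A1 p}" "A1 p \<noteq> ends j - A1 p"
    using R_eq_ends[of j "A1 p"] ends_diff_neq[of j "A1 p"] j by auto
  have alternate: "g j = A1 p \<longleftrightarrow> g o1 = A0 o1" if g: "g \<in> solutions n R" for g
  proof -
    have p: "p \<in> {1..n}" "A1 p \<in> R p" "A0 p \<noteq> A1 p" "R p = {A0 p, A1 p}"
      using path unfolding path_def by auto
    obtain l where "l \<in> incident F (A1 p)" "g l = A1 p"
      using peeled_cover[OF peeled g, of "A1 p"] inc(1) R_subset p by blast
    moreover have "g p \<noteq> g j"
      using inj_on_eq_iff[OF solutions_inj[OF g], of p j] inc(2) p j by auto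
    ultimately have "g j = A1 p \<longleftrightarrow> g p \<noteq> A1 p"
      using inc(1) by auto
    also have "\<dots> \<longleftrightarrow> g p = A0 p"
      using solutions_R[OF g p(1)] p by auto
    also have "\<dots> \<longleftrightarrow> g o1 = A0 o1"
      using path g unfolding path_def by blast
    finally show ?thesis .
  qed
  have p: "p \<in> V" and o1: "o1 \<in> V"
    using path unfolding path_def by auto
  have "\<exists>q'\<in>insert j V. A0' q' = A1' q" if q: "q \<in> insert j V - {j}" for q
  proof (cases "q = p")
    case True
    then show ?thesis
      using V[OF p] by (auto simp: A0' A1')
  next
    case False
    then obtain q' where "q' \<in> V" "A0 q' = A1 q"
      using path q False unfolding path_def by blast
    then show ?thesis
      using V that by (auto simp: A0' A1')
  qed
  moreover have "\<exists>q'\<in>insert j V - {j}. A1' q' = A0' q" if q: "q \<in> insert j V - {o1}" for q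
  proof (cases "q = j")
    case True
    then show ?thesis
      using V[OF p] p by (auto simp: A0' A1')
  next
    case False
    then obtain q' where "q' \<in> V" "A1 q' = A0 q"
      using path q False unfolding path_def by blast
    then show ?thesis
      using V False by (auto simp: A0' A1')
  qed
  moreover have "g q = A0' q \<longleftrightarrow> g o1 = A0' o1" if "g \<in> solutions n R" "q \<in> insert j V" for g q
  proof (cases "q = j")
    case False
    then have "g q = A0 q \<longleftrightarrow> g o1 = A0 o1"
      using path that unfolding path_def by blast
    then show ?thesis
      using False V[OF o1] by (simp add: A0')
  qed (use alternate[OF that(1)] V[OF o1] in \<open>simp add: A0'\<close>)
  moreover have "\<forall>q\<in>insert j V. A0' q \<noteq> A1' q \<and> R q = {A0' q, A1' q}"
    using path Rj V unfolding path_def A0' A1' by auto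
  ultimately show ?thesis
    using path j unfolding path_def by blast
qed

text \<open>The path can close only at its start, with \<open>A1 p = A0 o1\<close>. If
  \<open>A1 p = A1 j\<close>, then the position whose \<open>A0\<close> equals \<open>A1 j\<close>
  is a third one at this vertex. If \<open>A1 p = A0 j\<close> with \<open>j \<noteq> o1\<close>,
  then the position other than \<open>p\<close> whose \<open>A1\<close> equals \<open>A0 j\<close>
  must be \<open>j\<close> by degree 2, which brings back the first case.\<close>

lemma path_close:
  assumes path: "path U o1 V p A0 A1" and inc: "incident F (A1 p) = {p, j}" "j \<noteq> p" "j \<in> V"
    and resolved: "resolved U k A0 A1 B" and B: "\<forall>q\<in>V. B q = Suc k"
  shows "resolved (U \<union> V) (Suc k) A0 A1 B"
proof -
  have V: "V \<subseteq> {1..n} - F" "p \<in> V" "o1 \<in> V" and VU: "V \<inter> U = {}"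
    and AV: "\<And>q. q \<in> V \<Longrightarrow> A0 q \<noteq> A1 q \<and> R q = {A0 q, A1 q}"
    using path unfolding path_def by auto
  have j: "A1 p = A0 j \<or> A1 p = A1 j" "A1 p \<in> R j"
    using AV[OF inc(3)] inc(1) by (auto simp: incident_def)
  have three: "l = p \<or> l = j" if "A1 p \<in> R l" "l \<in> V" for l
  proof -
    have "{p, j, l} \<subseteq> {1..n} - F"
      using V inc(3) that(2) by blast
    moreover have "A1 p \<in> R p"
      using AV[OF V(2)] by simp
    ultimately show ?thesis
      using three_incident[of "A1 p" p j l] that(1) inc(2) j(2) by blast
  qed
  have "A1 p \<noteq> A1 j"
  proof
    assume eq: "A1 p = A1 j"
    have "\<exists>l\<in>V. A0 l = A1 j"
      using path inc unfolding path_def by blast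
    then obtain l where "l \<in> V" "A0 l = A1 j"
      by blast
    then have "l = p \<or> l = j"
      using three AV[of l] eq by auto
    then show False
      using \<open>A0 l = A1 j\<close> eq AV[of p] AV[of j] inc V by auto
  qed
  then have eq: "A1 p = A0 j"
    using j by blast
  have jo: "j = o1"
  proof (rule ccontr)
    assume "j \<noteq> o1"
    then have "\<exists>l\<in>V - {p}. A1 l = A0 j"
      using path inc unfolding path_def by blast
    then obtain l where l: "l \<in> V" "l \<noteq> p" "A1 l = A1 p"
      using eq by auto
    then have "l = j"
      using three AV[of l] by auto
    then show False
      using l \<open>A1 p \<noteq> A1 j\<close> by simp
  qed
  have "\<forall>q\<in>V - {p}. \<exists>q'\<in>V. A0 q' = A1 q" "\<exists>q'\<in>V. A0 q' = A1 p"
    using path eq inc(3) unfolding path_def by auto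
  then have fwd: "\<exists>q'\<in>V. A0 q' = A1 q" if "q \<in> V" for q
    using that by (cases "q = p") auto
  have "\<forall>q\<in>V - {o1}. \<exists>q'\<in>V. A1 q' = A0 q" "\<exists>q'\<in>V. A1 q' = A0 o1"
    using path eq jo V(2) unfolding path_def by blast+
  then have bwd: "\<exists>q'\<in>V. A1 q' = A0 q" if "q \<in> V" for q
    using that by (cases "q = o1") auto
  have "\<forall>i\<in>U. B i \<in> {1..k}"
    using resolved unfolding resolved_def by blast
  then have BU: "B i \<noteq> Suc k" if "i \<in> U" for i
    using that by fastforce
  have 1: "\<forall>i\<in>U \<union> V. B i \<in> {1..Suc k} \<and> A0 i \<noteq> A1 i \<and> R i = {A0 i, A1 i}"
    using resolved AV B unfolding resolved_def by fastforce
  have "{1..k} \<subseteq> B ` U"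
    using resolved unfolding resolved_def by blast
  moreover have "{1..Suc k} = insert (Suc k) {1..k}"
    by auto
  moreover have "Suc k \<in> B ` V"
    using B V by (metis imageI)
  ultimately have 2: "{1..Suc k} \<subseteq> B ` (U \<union> V)"
    by auto
  have 3: "\<exists>l\<in>U \<union> V. B l = B i \<and> A0 l = A1 i" if "i \<in> U \<union> V" for i
  proof (cases "i \<in> V")
    case True
    then show ?thesis
      using fwd[OF True] B by (metis UnI2)
  next
    case False
    then have "i \<in> U"
      using that by blast
    then show ?thesis
      using resolved unfolding resolved_def by blast
  qed
  have 4: "\<exists>l\<in>U \<union> V. B l = B i \<and> A1 l = A0 i" if "i \<in> U \<union> V" for i
  proof (cases "i \<in> V")
    case True
    then show ?thesis
      using bwd[OF True] B by (metis UnI2)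
  next
    case False
    then have "i \<in> U"
      using that by blast
    then show ?thesis
      using resolved unfolding resolved_def by blast
  qed
  have 5: "g i = A0 i \<longleftrightarrow> g l = A0 l"
    if "g \<in> solutions n R" "i \<in> U \<union> V" "l \<in> U \<union> V" "B i = B l" for g i l
  proof (cases "i \<in> V")
    case True
    then have "l \<in> V"
      using that B BU by (metis UnE)
    then show ?thesis
      using path that True unfolding path_def by blast
  next
    case False
    then have "l \<in> U"
      using that B BU by (metis UnE)
    then show ?thesis
      using resolved that False unfolding resolved_def by blast
  qed
  have "U \<union> V \<subseteq> {1..n} - F"
    using V resolved unfolding resolved_def by blast
  then show ?thesis
    unfolding resolved_def by (intro conjI 1 2) (use 3 4 5 in blast)+
qed

section \<open>Solutions as independent choices, one per cycle\<close>

definition choice ::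
  "(nat \<Rightarrow> nat) \<Rightarrow> (nat \<Rightarrow> nat) \<Rightarrow> (nat \<Rightarrow> nat) \<Rightarrow> (nat \<Rightarrow> bool) \<Rightarrow> nat \<Rightarrow> nat" where
  "choice A0 A1 B b i = (if b (B i) then A1 i else A0 i)"

text \<open>Forced positions form block 0 with two equal options, so that one formula describes the
  choice at every position, whatever the bit of block 0.\<close>

definition decomposed ::
  "nat \<Rightarrow> (nat \<Rightarrow> nat) \<Rightarrow> (nat \<Rightarrow> nat) \<Rightarrow> (nat \<Rightarrow> nat) \<Rightarrow> bool" where
  "decomposed k A0 A1 B \<longleftrightarrow> resolved ({1..n} - F) k A0 A1 B \<and>
     (\<forall>i\<in>F. A0 i = A i \<and> A1 i = A i \<and> B i = 0)"

text \<open>Only injectivity is at stake. A forced and a residual position cannot collide by the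
  last clause of \<open>peeled\<close>, and two forced ones agree with an actual solution. Two
  residual positions that collide share a vertex, and degree 2 leaves no room for the further
  position which the closure clauses provide.\<close>

lemma choice_in_solutions:
  assumes "decomposed k A0 A1 B"
  shows "choice A0 A1 B b \<in> solutions n R"
proof -
  let ?f = "choice A0 A1 B b"
  let ?V = "{1..n} - F"
  obtain g where g: "g \<in> solutions n R"
    using solution_exists ..
  have fF: "?f i = A i" "g i = A i" if "i \<in> F" for i
    using assms peeled g that unfolding decomposed_def choice_def peeled_def by auto
  have res: "resolved ?V k A0 A1 B"
    using assms unfolding decomposed_def by blast
  have AV: "A0 i \<noteq> A1 i" "R i = {A0 i, A1 i}" if "i \<in> ?V" for i
    using res that unfolding resolved_def by auto
  have fR: "?f i \<in> R i" if "i \<in> {1..n}" for i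
  proof (cases "i \<in> F")
    case True
    then show ?thesis
      using fF solutions_R[OF g that] by simp
  next
    case False
    then show ?thesis
      using AV[of i] that by (auto simp: choice_def)
  qed
  have "inj_on ?f {1..n}"
  proof (rule inj_onI, rule ccontr)
    fix i j assume i: "i \<in> {1..n}" and j: "j \<in> {1..n}" and eq: "?f i = ?f j" and "i \<noteq> j"
    have "i \<in> F \<longleftrightarrow> j \<in> F"
    proof -
      have "l \<in> F" if "m \<in> F" "l \<in> {1..n}" "?f l = ?f m" for l m
      proof -
        have "incident F (A m) = {}"
          using peeled that(1) unfolding peeled_def by blast
        then show ?thesis
          using that(2,3) fF(1)[OF that(1)] fR[OF that(2)] unfolding incident_def by auto
      qed
      then show ?thesis
        using i j eq by metis
    qed
    then consider "i \<in> F" "j \<in> F" | "i \<in> ?V" "j \<in> ?V"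
      using i j by blast
    then show False
    proof cases
      case 1
      then show False
        using fF eq solutions_inj[OF g] i j \<open>i \<noteq> j\<close> by (metis inj_onD)
    next
      case 2
      have three: "l = i \<or> l = j" if "?f i \<in> R l" "l \<in> ?V" for l
        using three_incident[of "?f i" i j l] fR[OF i] fR[OF j] eq that 2 \<open>i \<noteq> j\<close> by auto
      \<comment> \<open>If both positions take the shared vertex as their \<open>A0\<close>, closure
        yields a position that has it as its \<open>A1\<close>, necessarily a third one. The other
        uniform case is symmetric.\<close>
      have no0: "\<not> (A0 i = v \<and> A0 j = v)" if "v = ?f i" for v
      proof
        assume *: "A0 i = v \<and> A0 j = v"
        obtain l where l: "l \<in> ?V" "A1 l = A0 i"
          using res 2 unfolding resolved_def by meson
        then show False
          using * three[of l] AV[of l] that by auto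
      qed
      have no1: "\<not> (A1 i = v \<and> A1 j = v)" if "v = ?f i" for v
      proof
        assume *: "A1 i = v \<and> A1 j = v"
        obtain l where l: "l \<in> ?V" "A0 l = A1 i"
          using res 2 unfolding resolved_def by meson
        then show False
          using * three[of l] AV[of l] that by auto
      qed
      \<comment> \<open>Closure yields a position in the block of \<open>m\<close> whose
        \<open>A0\<close> is the shared vertex. By degree 2 it is \<open>l\<close>; so
        \<open>l\<close> and \<open>m\<close> lie in one block although their choices require
        different bits.\<close>
      have mix: False
        if "A0 l = ?f i" "A1 m = ?f i" "l \<in> {i, j}" "m \<in> {i, j}" "l \<noteq> m" "?f l = ?f i" "?f m = ?f i"
        for l m
      proof -
        have lm: "l \<in> ?V" "m \<in> ?V"
          using that(3,4) 2 by auto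
        have "\<exists>q\<in>?V. B q = B m \<and> A0 q = A1 m"
          using res lm(2) unfolding resolved_def by blast
        then obtain q where q: "q \<in> ?V" "A0 q = A1 m" "B q = B m"
          by blast
        then have "?f i \<in> R q"
          using AV(2)[OF q(1)] that(2) by simp
        then have "q = i \<or> q = j"
          using three q(1) by blast
        moreover have "q \<noteq> m"
          using AV(1)[OF lm(2)] q(2) by auto
        ultimately have "q = l"
          using that(3-5) by blast
        then have "b (B l) = b (B m)"
          using q(3) by simp
        moreover have "\<not> b (B l)" "b (B m)"
          using that(1,2,6,7) AV(1)[OF lm(1)] AV(1)[OF lm(2)] unfolding choice_def by metis+
        ultimately show False
          by simp
      qed
      have "?f i = A0 i \<or> ?f i = A1 i" "?f j = A0 j \<or> ?f j = A1 j"
        by (auto simp: choice_def)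
      then show False
        using no0[of "?f i"] no1[of "?f i"] mix[of i j] mix[of j i] eq \<open>i \<noteq> j\<close>
        by (metis insertCI)
    qed
  qed
  moreover have "?f ` {1..n} \<subseteq> {1..n}"
    using fR R_subset by (metis image_subsetI subsetD)
  ultimately have "bij_betw ?f {1..n} {1..n}"
    by (simp add: bij_betw_def endo_inj_surj)
  then show ?thesis
    using fR unfolding solutions_def by blast
qed

lemma solutions_are_choices:
  assumes "decomposed k A0 A1 B" "g \<in> solutions n R"
  obtains b where "\<And>i. i \<in> {1..n} \<Longrightarrow> g i = choice A0 A1 B b i"
proof -
  let ?V = "{1..n} - F"
  have res: "resolved ?V k A0 A1 B"
    using assms unfolding decomposed_def by blast
  \<comment> \<open>The bit of a block records whether some position in it departs from
    \<open>A0\<close>; by the last clause of \<open>resolved\<close> then all of them do.\<close>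
  have "g i = choice A0 A1 B (\<lambda>c. \<exists>j\<in>?V. B j = c \<and> g j \<noteq> A0 j) i" if i: "i \<in> {1..n}" for i
  proof (cases "i \<in> F")
    case True
    then show ?thesis
      using assms peeled unfolding decomposed_def peeled_def by (auto simp: choice_def)
  next
    case False
    then have "(\<exists>j\<in>?V. B j = B i \<and> g j \<noteq> A0 j) \<longleftrightarrow> g i \<noteq> A0 i"
      using res i assms(2) unfolding resolved_def by (smt (verit) DiffI)
    moreover have "g i \<in> {A0 i, A1 i}"
      using res i False solutions_R[OF assms(2) i] unfolding resolved_def by blast
    ultimately show ?thesis
      by (auto simp: choice_def)
  qed
  then show ?thesis
    using that by blast
qed

text \<open>Each block from 1 to \<open>k\<close> contains a position, and its two options differ.
  This makes the \<open>2 ^ k\<close> choices distinct as solutions.\<close>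

lemma choices_distinct:
  assumes "decomposed k A0 A1 B" "\<And>i. i \<in> {1..n} \<Longrightarrow> choice A0 A1 B b i = choice A0 A1 B b' i"
    and "c \<in> {1..k}"
  shows "b c \<longleftrightarrow> b' c"
proof -
  obtain i where "i \<in> {1..n} - F" "B i = c" "A0 i \<noteq> A1 i"
    using assms(1,3) unfolding decomposed_def resolved_def by blast
  then show ?thesis
    using assms(2)[of i] by (auto simp: choice_def split: if_splits)
qed

end

section \<open>The program\<close>

abbreviation (input) "vN \<equiv> 2 :: nat"
abbreviation (input) "vN1 \<equiv> 3 :: nat"
abbreviation (input) "vI \<equiv> 4 :: nat"
abbreviation (input) "vP \<equiv> 5 :: nat"
abbreviation (input) "vA \<equiv> 6 :: nat"
abbreviation (input) "vB \<equiv> 7 :: nat"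
abbreviation (input) "vC \<equiv> 8 :: nat"
abbreviation (input) "vD \<equiv> 9 :: nat"
abbreviation (input) "vX \<equiv> 10 :: nat"
abbreviation (input) "vV \<equiv> 11 :: nat"
abbreviation (input) "vE \<equiv> 12 :: nat"
abbreviation (input) "vY \<equiv> 13 :: nat"
abbreviation (input) "vQ \<equiv> 14 :: nat"
abbreviation (input) "vK \<equiv> 15 :: nat"
abbreviation (input) "vU \<equiv> 16 :: nat"
abbreviation (input) "vM \<equiv> 17 :: nat"
abbreviation (input) "vO \<equiv> 18 :: nat"
abbreviation (input) "vJ \<equiv> 19 :: nat"
abbreviation (input) "vK1 \<equiv> 20 :: nat"
abbreviation (input) "vFlag \<equiv> 21 :: nat"
abbreviation (input) "vK2 \<equiv> 22 :: nat"
abbreviation (input) "vTwo \<equiv> 23 :: nat"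
abbreviation (input) "vFour \<equiv> 24 :: nat"
abbreviation (input) "vOne \<equiv> 25 :: nat"
abbreviation (input) "vW \<equiv> 26 :: nat"
abbreviation (input) "vBI \<equiv> 27 :: nat"
abbreviation (input) "vBJ \<equiv> 28 :: nat"
abbreviation (input) "vZero \<equiv> 29 :: nat"

abbreviation (input) "rW \<equiv> 2 :: nat"
abbreviation (input) "rZ \<equiv> 3 :: nat"
abbreviation (input) "rCost \<equiv> 4 :: nat"
abbreviation (input) "rBest \<equiv> 5 :: nat"

abbreviation (input) "aDeg \<equiv> 2 :: nat"
abbreviation (input) "aInc \<equiv> 3 :: nat"
abbreviation (input) "aMin \<equiv> 4 :: nat"
abbreviation (input) "aEnds \<equiv> 5 :: nat"
abbreviation (input) "aA0 \<equiv> 6 :: nat"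
abbreviation (input) "aA1 \<equiv> 7 :: nat"
abbreviation (input) "aBlk \<equiv> 8 :: nat"
abbreviation (input) "aOff \<equiv> 9 :: nat"
abbreviation (input) "aCur \<equiv> 10 :: nat"
abbreviation (input) "aBst \<equiv> 11 :: nat"

abbreviation skip :: cmd where
  "skip \<equiv> Do (VCopy vQ vQ)"

section \<open>Reading the input\<close>

definition link :: "nat \<Rightarrow> cmd" where
  "link x =
     Do (Get vD aDeg x) ;; Do (VAdd vD vD vOne) ;; Do (Put aDeg x vD) ;;
     Do (Get vD aInc x) ;; Do (VAdd vD vD vI) ;; Do (Put aInc x vD)"

text \<open>The test keeps a singleton requisition from being counted as two incidences.\<close>

definition load_one :: cmd where
  "load_one =
     Do (Input vA vP) ;; Do (VAdd vP vP vOne) ;; Do (Input vB vP) ;; Do (VAdd vP vP vOne) ;;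
     Do (Put aMin vI vA) ;; Do (VAdd vC vA vB) ;; Do (Put aEnds vI vC) ;;
     link vA ;; If (TLess vA vB) (link vB) skip ;;
     Do (VAdd vI vI vOne)"

text \<open>\<open>vZero\<close> is never written: it keeps the initial value 0, which is also the
  input address of \<open>n\<close>.\<close>

definition load_instance :: cmd where
  "load_instance =
     Do (VConst vOne 1) ;; Do (VConst vTwo 2) ;; Do (VConst vFour 4) ;;
     Do (Input vN vZero) ;; Do (VAdd vN1 vN vOne) ;; Do (VConst vI 1) ;; Do (VConst vP 1) ;;
     While (TLess vI vN1) load_one"

lemma concat_map_nth:
  assumes "\<And>x. x \<in> set xs \<Longrightarrow> length (f x) = m" "i < length xs" "k < m"
  shows "m * i + k < length (concat (map f xs)) \<and> concat (map f xs) ! (m * i + k) = f (xs ! i) ! k"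
  using assms
proof (induction xs arbitrary: i)
  case (Cons x xs)
  then show ?case
  proof (cases i)
    case (Suc l)
    have "m * l + k < length (concat (map f xs)) \<and> concat (map f xs) ! (m * l + k) = f (xs ! l) ! k"
      using Cons.IH[of l] Cons.prems Suc by simp
    moreover have "length (f x) = m"
      using Cons.prems by simp
    ultimately show ?thesis
      using Suc by (simp add: nth_append)
  qed (auto simp: nth_append)
qed simp

definition next_pos :: "nat \<Rightarrow> nat \<Rightarrow> nat" where
  "next_pos n i = (if i = n then 1 else i + 1)"

lemma concat_map_upt_nth:
  assumes "i \<in> {1..n}" "\<And>j. length (f j) = m" "k < m"
  shows "m * (i - 1) + k < length (concat (map f [1..<n + 1])) \<and>
    concat (map f [1..<n + 1]) ! (m * (i - 1) + k) = f i ! k"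
proof -
  have "i - 1 < length [1..<n + 1]" "[1..<n + 1] ! (i - 1) = i"
    using assms(1) by (auto simp del: upt_Suc)
  then show ?thesis
    using concat_map_nth[of "[1..<n + 1]" f m "i - 1" k] assms(2,3) by metis
qed

lemma lookup_encode_size: "lookup (fst (encode n R \<rho>)) 0 = n"
  by (simp add: encode_def lookup_def del: upt_Suc)

lemma lookup_encode_Min:
  assumes "i \<in> {1..n}"
  shows "lookup (fst (encode n R \<rho>)) (2 * i - 1) = Min (R i)"
    and "lookup (fst (encode n R \<rho>)) (2 * i) = Max (R i)"
proof -
  let ?f = "\<lambda>i. [Min (R i), Max (R i)]"
  note * = concat_map_upt_nth[OF assms, of ?f 2]
  obtain l where l: "i = Suc l"
    using assms by (cases i) auto
  show "lookup (fst (encode n R \<rho>)) (2 * i - 1) = Min (R i)"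
    using *[of 0] l by (simp add: encode_def lookup_def del: upt_Suc)
  show "lookup (fst (encode n R \<rho>)) (2 * i) = Max (R i)"
    using *[of 1] l by (simp add: encode_def lookup_def del: upt_Suc)
qed

lemma next_pos_range: "i \<in> {1..n} \<Longrightarrow> next_pos n i \<in> {1..n}"
  by (auto simp: next_pos_def)

text \<open>Within the four entries of a position, the offset is a two-digit binary number: the high
  digit selects the tail of the arc, the low digit its head.\<close>

lemma lookup_encode_weight:
  assumes "i \<in> {1..n}"
  shows "lookup (snd (encode n R \<rho>)) (4 * (i - 1) + 2 * of_bool p + of_bool q) =
    arc_weight \<rho> (if p then Max (R i) else Min (R i))
      (if q then Max (R (next_pos n i)) else Min (R (next_pos n i)))"
proof -
  let ?f = "\<lambda>i. let j = (if i = n then 1 else i + 1) in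
    [arc_weight \<rho> (Min (R i)) (Min (R j)), arc_weight \<rho> (Min (R i)) (Max (R j)),
     arc_weight \<rho> (Max (R i)) (Min (R j)), arc_weight \<rho> (Max (R i)) (Max (R j))]"
  define k :: nat where "k = 2 * of_bool p + of_bool q"
  have "k < 4"
    by (auto simp: k_def)
  then have "4 * (i - 1) + k < length (concat (map ?f [1..<n + 1])) \<and>
      concat (map ?f [1..<n + 1]) ! (4 * (i - 1) + k) = ?f i ! k"
    by (intro concat_map_upt_nth[OF assms]) (simp_all add: Let_def)
  then have "lookup (snd (encode n R \<rho>)) (4 * (i - 1) + k) = ?f i ! k"
    by (simp add: encode_def lookup_def del: upt_Suc)
  also have "\<dots> = arc_weight \<rho> (if p then Max (R i) else Min (R i))
      (if q then Max (R (next_pos n i)) else Min (R (next_pos n i)))"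
    by (auto simp: k_def next_pos_def Let_def numeral_eq_Suc)
  finally show ?thesis
    by (simp add: k_def add.assoc)
qed

locale tspvr = feasible_requisitions +
  fixes \<rho> :: "nat \<Rightarrow> nat \<Rightarrow> real"
begin

abbreviation inp :: input where
  "inp \<equiv> encode n R \<rho>"

definition constants :: "state \<Rightarrow> bool" where
  "constants s \<longleftrightarrow> nvar s vN = n \<and> nvar s vN1 = Suc n \<and> nvar s vOne = 1 \<and> nvar s vTwo = 2 \<and>
     nvar s vFour = 4 \<and> nvar s vZero = 0"

text \<open>Frame condition of the phases before the search: what they have to hand over in its
  initial state.\<close>

definition untouched :: "state \<Rightarrow> bool" where
  "untouched s \<longleftrightarrow> (\<forall>i. narr s aOff i = 0) \<and> (\<forall>i. narr s aCur i = 0) \<and> (\<forall>i. narr s aBst i = 0) \<and>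
     warr s = (\<lambda>_. 0) \<and> outp s = [] \<and> nvar s vFlag = 0"

definition blank :: "state \<Rightarrow> bool" where
  "blank s \<longleftrightarrow> untouched s \<and> (\<forall>i. narr s aA0 i = 0) \<and> (\<forall>i. narr s aA1 i = 0) \<and>
     (\<forall>i. narr s aBlk i = 0) \<and> nvar s vK = 0"

definition requisition_arrays :: "nat \<Rightarrow> state \<Rightarrow> bool" where
  "requisition_arrays m s \<longleftrightarrow> (\<forall>j\<in>{1..<m}. narr s aMin j = Min (R j) \<and> narr s aEnds j = ends j)"

definition degrees :: "(nat \<Rightarrow> nat set) \<Rightarrow> state \<Rightarrow> bool" where
  "degrees N s \<longleftrightarrow> (\<forall>x\<in>{1..n}. narr s aDeg x = card (N x) \<and> narr s aInc x = \<Sum>(N x))"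

definition incident_below :: "nat \<Rightarrow> nat \<Rightarrow> nat set" where
  "incident_below i x = {j \<in> {1..<i}. x \<in> R j}"

lemma incident_below_Suc:
  "1 \<le> i \<Longrightarrow> incident_below (Suc i) x =
     (if x \<in> R i then insert i (incident_below i x) else incident_below i x)"
  by (auto simp: incident_below_def less_Suc_eq)

lemma incident_below_simps [simp]:
  "finite (incident_below i x)" "i \<notin> incident_below i x" "incident_below (Suc 0) x = {}"
  by (auto simp: incident_below_def)

lemma incident_below_all: "incident_below (Suc n) x = incident {} x"
  by (auto simp: incident_below_def incident_def)

definition loaded :: "nat \<Rightarrow> state \<Rightarrow> bool" where
  "loaded i s \<longleftrightarrow> constants s \<and> blank s \<and> requisition_arrays i s \<and> degrees (incident_below i) s"

lemma constants_cong: "(\<And>d. d \<in> {vN, vN1, vOne, vTwo, vFour, vZero} \<Longrightarrow> nvar s' d = nvar s d) \<Longrightarrow>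
    constants s' = constants s"
  by (simp add: constants_def)

lemma constants_simps [simp]:
  "constants (tick t s) = constants s"
  "d \<notin> {vN, vN1, vOne, vTwo, vFour, vZero} \<Longrightarrow> constants (set_nvar d v s) = constants s"
  "constants (set_narr A i v s) = constants s" "constants (set_wvar d w s) = constants s"
  "constants (set_warr i w s) = constants s" "constants (emit v s) = constants s"
  by (rule constants_cong; auto)+

lemma untouched_simps [simp]:
  "untouched (tick t s) = untouched s"
  "d \<noteq> vFlag \<Longrightarrow> untouched (set_nvar d v s) = untouched s"
  "A \<notin> {aOff, aCur, aBst} \<Longrightarrow> untouched (set_narr A i v s) = untouched s"
  "untouched (set_wvar d w s) = untouched s"
  by (simp_all add: untouched_def)

lemma requisition_arrays_simps [simp]:
  "requisition_arrays m (tick t s) = requisition_arrays m s"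
  "requisition_arrays m (set_nvar d v s) = requisition_arrays m s"
  "A \<notin> {aMin, aEnds} \<Longrightarrow> requisition_arrays m (set_narr A i v s) = requisition_arrays m s"
  "requisition_arrays m (set_wvar d w s) = requisition_arrays m s"
  "requisition_arrays m (set_warr i w s) = requisition_arrays m s"
  "requisition_arrays m (emit v s) = requisition_arrays m s"
  by (simp_all add: requisition_arrays_def)

lemma degrees_simps [simp]:
  "degrees N (tick t s) = degrees N s"
  "degrees N (set_nvar d v s) = degrees N s"
  "A \<notin> {aDeg, aInc} \<Longrightarrow> degrees N (set_narr A i v s) = degrees N s"
  by (simp_all add: degrees_def)

lemma loaded_tick [simp]: "loaded i (tick t s) = loaded i s"
  by (simp add: loaded_def blank_def)

text \<open>The input pointer stands at \<open>2 * i - 1\<close>, behind the leading entry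
  \<open>n\<close>; the equation is kept additive to avoid truncated subtraction. The actual cost is
  at most 81, and 100 is a round bound.\<close>

lemma wp_load_one:
  assumes "loaded i s" "nvar s vI = i" "Suc (nvar s vP) = 2 * i" "i \<in> {1..n}"
  shows "wp inp load_one (\<lambda>s'. loaded (Suc i) s' \<and> nvar s' vI = Suc i \<and>
    Suc (nvar s' vP) = 2 * Suc i \<and> clock s' \<le> clock s + 100) s"
proof -
  define a b where "a = Min (R i)" and "b = Max (R i)"
  define p where "p = nvar s vP"
  have R: "x \<in> R i \<longleftrightarrow> x = a \<or> x = b" for x
    using R_eq_Min_Max[OF assms(4)] unfolding a_def b_def by blast
  have ab: "a \<le> b"
    unfolding a_def b_def using R_nonempty[OF assms(4)] finite_R[OF assms(4)] by simp
  have p: "2 * i - 1 = p" "2 * i = Suc p"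
    using assms(3) unfolding p_def by auto
  have look: "lookup (fst inp) p = a" "lookup (fst inp) (Suc p) = b"
    using lookup_encode_Min[OF assms(4), of R \<rho>] p unfolding a_def b_def by simp_all
  have N: "incident_below (Suc i) x =
      (if x = a \<or> x = b then insert i (incident_below i x) else incident_below i x)" for x
    using incident_below_Suc[of i x] assms(4) R by auto
  have range: "1 \<le> a" "a \<le> n" "1 \<le> b" "b \<le> n"
    using R_pos[OF assms(4), of a] R_pos[OF assms(4), of b] R by auto
  have deg: "narr s aDeg x = card (incident_below i x)" "narr s aInc x = \<Sum>(incident_below i x)"
    if "x \<in> {1..n}" for x
    using assms(1) that unfolding loaded_def degrees_def by auto
  have c: "nvar s vOne = 1"
    using assms(1) unfolding loaded_def constants_def by simp
  have arrays: "requisition_arrays (Suc i) s'"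
    if "\<And>j. j \<noteq> i \<Longrightarrow> narr s' aMin j = narr s aMin j \<and> narr s' aEnds j = narr s aEnds j"
      "narr s' aMin i = a" "narr s' aEnds i = a + b" for s'
    unfolding requisition_arrays_def
  proof
    fix j assume "j \<in> {1..<Suc i}"
    then show "narr s' aMin j = Min (R j) \<and> narr s' aEnds j = ends j"
      using that assms(1) unfolding loaded_def requisition_arrays_def
      by (cases "j = i") (auto simp: a_def b_def ends_def)
  qed
  show ?thesis
    unfolding load_one_def link_def loaded_def
    using ab range deg c look assms(1-3) p
    by (simp add: exec_simps p_def[symmetric] arrays degrees_def N loaded_def constants_def
      blank_def untouched_def)
qed

lemma wp_load_instance:
  "wp inp load_instance (\<lambda>s. loaded (Suc n) s \<and> clock s \<le> 102 * n + 9) start"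
proof -
  have "wp inp (While (TLess vI vN1) load_one) (\<lambda>s. loaded (Suc n) s \<and> clock s \<le> 102 * n + 9) s"
    if s: "loaded 1 s" "nvar s vI = 1" "nvar s vP = 1" "clock s = 7" for s
  proof (rule wp_count[where h = "Suc n" and l = 1 and
        J = "\<lambda>i s. loaded i s \<and> nvar s vI = i \<and> Suc (nvar s vP) = 2 * i \<and> clock s \<le> 102 * (i - 1) + 7"])
    fix i s assume i: "1 \<le> i" "i < Suc n"
      and "loaded i s \<and> nvar s vI = i \<and> Suc (nvar s vP) = 2 * i \<and> clock s \<le> 102 * (i - 1) + 7"
    then show "wp inp load_one (\<lambda>s. loaded (Suc i) s \<and> nvar s vI = Suc i \<and>
        Suc (nvar s vP) = 2 * Suc i \<and> clock s \<le> 102 * (Suc i - 1) + 7) (tick 2 s)"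
      by (intro wp_mono[OF wp_load_one[of i]]) auto
  next
    show "nvar s vI = i \<and> nvar s vN1 = Suc n"
      if "loaded i s \<and> nvar s vI = i \<and> Suc (nvar s vP) = 2 * i \<and> clock s \<le> 102 * (i - 1) + 7" for i s
      using that unfolding loaded_def constants_def by simp
  qed (use s in auto)
  then show ?thesis
    unfolding load_instance_def
    by (simp add: exec_simps lookup_encode_size start_def loaded_def constants_def blank_def
        untouched_def requisition_arrays_def degrees_def)
qed

end

section \<open>Peeling leaves in linear time\<close>

text \<open>The incidence sum of a leaf is its only position. If the requisition of that position is
  a singleton, the other end is the leaf itself, whose entries have just been cleared; truncated
  subtraction leaves them at 0, as it should.\<close>

definition peel_step :: cmd where
  "peel_step =
     Do (Get vE aInc vV) ;; Do (Put aA0 vE vV) ;; Do (Put aA1 vE vV) ;;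
     Do (Put aDeg vV vZero) ;; Do (Put aInc vV vZero) ;;
     Do (Get vY aEnds vE) ;; Do (VSub vY vY vV) ;;
     Do (Get vD aDeg vY) ;; Do (VSub vD vD vOne) ;; Do (Put aDeg vY vD) ;;
     Do (Get vQ aInc vY) ;; Do (VSub vQ vQ vE) ;; Do (Put aInc vY vQ) ;;
     Do (VCopy vV vY)"

text \<open>Removing a position can create a new leaf only at its other end. Following that end at
  once keeps all vertices already swept free of leaves, so a single sweep suffices.\<close>

definition peel :: cmd where
  "peel =
     Do (VConst vX 1) ;;
     While (TLess vX vN1)
       (Do (VCopy vV vX) ;; Do (Get vD aDeg vV) ;; While (TEq vD vOne) peel_step ;;
        Do (VAdd vX vX vOne))"

context tspvr
begin

text \<open>Vertices are numbered from 1, so an entry 0 marks a position without a vertex.\<close>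

definition assigned :: "state \<Rightarrow> nat set" where
  "assigned s = {i \<in> {1..n}. narr s aA0 i \<noteq> 0}"

definition peeling :: "state \<Rightarrow> bool" where
  "peeling s \<longleftrightarrow> constants s \<and> untouched s \<and> requisition_arrays (Suc n) s \<and> nvar s vK = 0 \<and>
     (\<forall>i. narr s aBlk i = 0) \<and> (\<forall>i. narr s aA1 i = narr s aA0 i) \<and>
     peeled (assigned s) (narr s aA0) \<and> degrees (incident (assigned s)) s"

lemma assigned_simps [simp]:
  "assigned (tick t s) = assigned s" "assigned (set_nvar d v s) = assigned s"
  "A \<noteq> aA0 \<Longrightarrow> assigned (set_narr A i v s) = assigned s"
  by (simp_all add: assigned_def)

lemma peeling_simps [simp]:
  "peeling (tick t s) = peeling s"
  "d \<notin> {vN, vN1, vOne, vTwo, vFour, vZero, vFlag, vK} \<Longrightarrow> peeling (set_nvar d v s) = peeling s"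
  by (simp_all add: peeling_def)

lemma finite_assigned [simp]: "finite (assigned s)"
  by (simp add: assigned_def)

lemma card_assigned_le: "card (assigned s) \<le> n"
proof -
  have "assigned s \<subseteq> {1..n}"
    by (auto simp: assigned_def)
  from card_mono[OF _ this] show ?thesis
    by simp
qed

lemma incident_insert_leaf:
  assumes "incident F v = {i}"
  shows "incident (insert i F) x =
    (if x = v then {} else if x = ends i - v then incident F x - {i} else incident F x)"
proof -
  have "i \<in> {1..n}" "v \<in> R i"
    using assms by (auto simp: incident_def)
  then have "R i = {v, ends i - v}"
    by (rule R_eq_ends)
  then have "i \<notin> incident F x" if "x \<noteq> v" "x \<noteq> ends i - v"
    using that by (simp add: incident_def)
  then show ?thesis
    using assms by (auto simp: incident_insert)
qed

lemma wp_peel_step: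
  assumes "peeling s" "nvar s vV = v" "v \<in> {1..n}" "card (incident (assigned s) v) = 1"
  shows "wp inp peel_step (\<lambda>s'. peeling s' \<and> nvar s' vX = nvar s vX \<and>
    (\<exists>i. incident (assigned s) v = {i} \<and> assigned s' = insert i (assigned s) \<and>
       nvar s' vV = ends i - v) \<and>
    nvar s' vD = card (incident (assigned s') (nvar s' vV)) \<and> clock s' \<le> clock s + 90) s"
proof -
  obtain i where i: "incident (assigned s) v = {i}"
    using assms(4) card_1_singletonE by blast
  let ?F = "assigned s"
  define y where "y = ends i - v"
  have iR: "i \<in> {1..n}" "v \<in> R i" "i \<notin> ?F"
    using i by (auto simp: incident_def)
  have yR: "y \<in> R i"
    unfolding y_def by (rule ends_diff_in_R[OF iR(1,2)])
  then have y: "y \<in> {1..n}"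
    using R_subset[OF iR(1)] by blast
  have deg: "narr s aDeg x = card (incident ?F x)" "narr s aInc x = \<Sum>(incident ?F x)"
    if "x \<in> {1..n}" for x
    using assms(1) that unfolding peeling_def degrees_def by auto
  have e: "narr s aEnds i = ends i"
    using assms(1) iR(1) unfolding peeling_def requisition_arrays_def by simp
  have c: "nvar s vOne = 1" "nvar s vZero = 0"
    using assms(1) unfolding peeling_def constants_def by simp_all
  have F': "assigned s' = insert i ?F" if "narr s' aA0 = (narr s aA0)(i := v)" for s'
    using iR(1) assms(3) that by (auto simp: assigned_def)
  have peeled': "peeled (insert i ?F) ((narr s aA0)(i := v))"
    using peeled_insert[OF _ i] assms(1) unfolding peeling_def by blast
  have inc: "incident (insert i ?F) x =
      (if x = v then {} else if x = y then incident ?F x - {i} else incident ?F x)" for x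
    unfolding y_def by (rule incident_insert_leaf[OF i])
  have iy: "i \<in> incident ?F y"
    using iR yR by (simp add: incident_def)
  have sum: "\<Sum>(incident ?F y - {i}) = \<Sum>(incident ?F y) - i"
    using iy by (simp add: sum_diff1_nat)
  have A1: "narr s aA1 = narr s aA0"
    using assms(1) unfolding peeling_def by auto
  show ?thesis
    unfolding peel_step_def
    using assms(1-3) c e y i iy
    by (simp add: exec_simps deg y_def[symmetric] peeling_def F' peeled' inc sum A1 constants_def untouched_def
        requisition_arrays_def degrees_def card_Diff_singleton)
qed

text \<open>Chains may be long, but every round assigns one more position. Charging 92 (90 for the
  body, 2 for the loop test) to each assigned position bounds all chains of the sweep together by
  \<open>92 * n\<close>.\<close>

lemma wp_peel_chain:
  assumes "peeling s" "nvar s vX = x" "nvar s vV = v" "v \<in> {1..n}"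
    and "nvar s vD = card (incident (assigned s) v)"
    and "\<forall>y\<in>{1..x}. y \<noteq> v \<longrightarrow> card (incident (assigned s) y) \<noteq> 1" and "x \<le> n"
    and "clock s \<le> T + 92 * card (assigned s)"
  shows "wp inp (While (TEq vD vOne) peel_step) (\<lambda>s'. peeling s' \<and> nvar s' vX = x \<and>
    (\<forall>y\<in>{1..x}. card (incident (assigned s') y) \<noteq> 1) \<and>
    clock s' \<le> T + 2 + 92 * card (assigned s')) s"
proof (rule wp_While[where m = "\<lambda>s. n - card (assigned s)" and
      J = "\<lambda>s. peeling s \<and> nvar s vX = x \<and> nvar s vV \<in> {1..n} \<and>
        nvar s vD = card (incident (assigned s) (nvar s vV)) \<and>
        (\<forall>y\<in>{1..x}. y \<noteq> nvar s vV \<longrightarrow> card (incident (assigned s) y) \<noteq> 1) \<and>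
        clock s \<le> T + 92 * card (assigned s)"], goal_cases)
  case 1
  show ?case
    using assms by simp
next
  case (2 s)
  then have one: "card (incident (assigned s) (nvar s vV)) = 1"
    by (simp add: peeling_def constants_def)
  show ?case
  proof (rule wp_mono[OF wp_peel_step[of "tick 2 s" "nvar s vV"]], goal_cases)
    case (5 s')
    then obtain i where i: "incident (assigned s) (nvar s vV) = {i}"
        "assigned s' = insert i (assigned s)" "nvar s' vV = ends i - nvar s vV"
      by auto
    have iR: "i \<in> {1..n}" "nvar s vV \<in> R i" "i \<notin> assigned s"
      using i(1) by (auto simp: incident_def)
    have "nvar s' vV \<in> {1..n}"
      using ends_diff_in_R[OF iR(1,2)] R_subset[OF iR(1)] i(3) by auto
    moreover have "card (incident (assigned s') y) \<noteq> 1" if "y \<in> {1..x}" "y \<noteq> nvar s' vV" for y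
      using 2 that i by (auto simp: incident_insert_leaf[OF i(1)])
    moreover have "card (assigned s') = Suc (card (assigned s))"
      using i iR by simp
    moreover have "card (assigned s') \<le> n"
      by (rule card_assigned_le)
    ultimately show ?case
      using 5 2 by auto
  qed (use 2 one in auto)
next
  case (3 s)
  then have "card (incident (assigned s) (nvar s vV)) \<noteq> 1"
    by (simp add: peeling_def constants_def)
  then have "card (incident (assigned s) y) \<noteq> 1" if "y \<in> {1..x}" for y
    using 3 that by (cases "y = nvar s vV") blast+
  then show ?case
    using 3 by simp
qed

lemma wp_peel:
  assumes "loaded (Suc n) s"
  shows "wp inp peel (\<lambda>s'. peeling s' \<and> (\<forall>y\<in>{1..n}. card (incident (assigned s') y) \<noteq> 1) \<and>
    clock s' \<le> clock s + 110 * n + 30) s"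
proof -
  have init: "peeling s" "assigned s = {}"
    using assms unfolding loaded_def peeling_def blank_def assigned_def degrees_def
    by (simp_all add: incident_below_all)
  have "wp inp (While (TLess vX vN1)
       (Do (VCopy vV vX) ;; Do (Get vD aDeg vV) ;; While (TEq vD vOne) peel_step ;;
        Do (VAdd vX vX vOne))) (\<lambda>s'. peeling s' \<and> (\<forall>y\<in>{1..n}. card (incident (assigned s') y) \<noteq> 1) \<and>
    clock s' \<le> clock s + 110 * n + 30) s1"
    if s1: "peeling s1" "assigned s1 = {}" "nvar s1 vX = 1" "clock s1 = clock s + 1" for s1
  proof (rule wp_count[where h = "Suc n" and l = 1 and
        J = "\<lambda>x s'. peeling s' \<and> nvar s' vX = x \<and>
          (\<forall>y\<in>{1..<x}. card (incident (assigned s') y) \<noteq> 1) \<and>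
          clock s' \<le> clock s + 1 + 15 * x + 92 * card (assigned s')"], goal_cases)
    case (4 x s2)
    let ?s3 = "tick 7 (set_nvar vD (narr s2 aDeg x) (tick 1 (set_nvar vV x (tick 2 s2))))"
    have p3: "peeling ?s3" "assigned ?s3 = assigned s2"
      using 4(3) by simp_all
    have s3: "effect inp (Get vD aDeg vV) (effect inp (VCopy vV vX) (tick 2 s2)) = ?s3"
      using 4 by (simp add: set_nvar_def)
    have *: "wp inp (While (TEq vD vOne) peel_step) (\<lambda>s'. peeling s' \<and> nvar s' vX = x \<and>
      (\<forall>y\<in>{1..x}. card (incident (assigned s') y) \<noteq> 1) \<and>
      clock s' \<le> (clock s + 1 + 15 * x + 10) + 2 + 92 * card (assigned s')) ?s3"
    proof (rule wp_peel_chain[where v = x])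
      show "nvar ?s3 vD = card (incident (assigned ?s3) x)"
        using 4 unfolding p3(2) peeling_def degrees_def by (simp add: exec_simps)
      show "\<forall>y\<in>{1..x}. y \<noteq> x \<longrightarrow> card (incident (assigned ?s3) y) \<noteq> 1"
        using 4 unfolding p3(2) by auto
      show "clock ?s3 \<le> (clock s + 1 + 15 * x + 10) + 92 * card (assigned ?s3)"
        using 4 unfolding p3(2) by (simp add: exec_simps)
    qed (use 4 p3 in \<open>auto simp: exec_simps\<close>)
    show ?case
      unfolding wp_Seq wp_Do s3
    proof (rule wp_mono[OF *], goal_cases)
      case (1 s')
      then have "nvar s' vOne = 1"
        by (simp add: peeling_def constants_def)
      then show ?case
        using 1 4 by (simp add: atLeastLessThanSuc_atLeastAtMost)
    qed
  next
    case (5 s')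
    then show ?case
      using card_assigned_le[of s'] by (auto simp: less_Suc_eq_le)
  qed (use s1 in \<open>auto simp: peeling_def constants_def\<close>)
  then show ?thesis
    using init unfolding peel_def by simp
qed

end

section \<open>Tracing the cycles in linear time\<close>

text \<open>The position is entered through \<open>vU\<close> and left through its other end;
  subtracting the position from the incidence sum there gives the next one. The final read tells
  whether that one has been visited already.\<close>

definition visit :: cmd where
  "visit =
     Do (Put aA0 vE vU) ;; Do (Get vV aEnds vE) ;; Do (VSub vV vV vU) ;; Do (Put aA1 vE vV) ;;
     Do (Put aBlk vE vK) ;; Do (Get vQ aInc vV) ;; Do (VSub vE vQ vE) ;; Do (VCopy vU vV) ;;
     Do (Get vD aA0 vE)"

definition trace_cycles :: cmd where
  "trace_cycles =
     Do (VConst vI 1) ;;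
     While (TLess vI vN1)
       (Do (Get vD aA0 vI) ;;
        If (TEq vD vZero)
          (Do (VAdd vK vK vOne) ;; Do (VCopy vE vI) ;; Do (Get vU aMin vI) ;; visit ;;
           While (TEq vD vZero) visit)
          skip ;;
        Do (VAdd vI vI vOne))"

context residual_cycles
begin

lemma resolved_cong:
  assumes "resolved U k A0 A1 B" "\<And>i. i \<in> U \<Longrightarrow> A0' i = A0 i \<and> A1' i = A1 i \<and> B' i = B i"
  shows "resolved U k A0' A1' B'"
proof -
  have "B' ` U = B ` U"
    using assms(2) by (auto simp: image_def)
  then show ?thesis
    using assms unfolding resolved_def by (smt (verit, best))
qed

end

locale tspvr_residual = tspvr + residual_cycles +
  assumes A_pos: "\<And>i. i \<in> F \<Longrightarrow> A i \<noteq> 0"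
begin

definition forced_fixed :: "state \<Rightarrow> bool" where
  "forced_fixed s \<longleftrightarrow> constants s \<and> untouched s \<and> requisition_arrays (Suc n) s \<and>
     degrees (incident F) s \<and>
     (\<forall>i\<in>F. narr s aA0 i = A i \<and> narr s aA1 i = A i \<and> narr s aBlk i = 0)"

lemma forced_fixed_simps [simp]:
  "forced_fixed (tick t s) = forced_fixed s"
  "d \<notin> {vN, vN1, vOne, vTwo, vFour, vZero, vFlag} \<Longrightarrow> forced_fixed (set_nvar d v s) = forced_fixed s"
  "a \<in> {aA0, aA1, aBlk} \<Longrightarrow> i \<notin> F \<Longrightarrow> forced_fixed s \<Longrightarrow> forced_fixed (set_narr a i v s)"
  by (auto simp: forced_fixed_def)

lemma F_assigned: "forced_fixed s \<Longrightarrow> F \<subseteq> assigned s"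
  using F_subset A_pos by (auto simp: forced_fixed_def assigned_def)

lemma wp_visit:
  assumes "forced_fixed s" "e = nvar s vE" "e \<in> {1..n} - F" "u = nvar s vU" "u \<in> R e"
  shows "wp inp visit (\<lambda>s'. forced_fixed s' \<and> narr s' aA0 = (narr s aA0)(e := u) \<and>
    narr s' aA1 = (narr s aA1)(e := ends e - u) \<and> narr s' aBlk = (narr s aBlk)(e := nvar s vK) \<and>
    nvar s' vE = \<Sum>(incident F (ends e - u)) - e \<and> nvar s' vU = ends e - u \<and>
    nvar s' vD = narr s' aA0 (nvar s' vE) \<and> nvar s' vI = nvar s vI \<and> nvar s' vK = nvar s vK \<and>
    assigned s' = insert e (assigned s) \<and> clock s' = clock s + 45) s"
proof -
  have "ends e - u \<in> {1..n}" and u: "1 \<le> u"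
    using ends_diff_in_R[of e u] R_subset[of e] R_pos[of e u] assms by auto
  then have inc: "narr s aInc (ends e - u) = \<Sum>(incident F (ends e - u))"
    using assms(1) unfolding forced_fixed_def degrees_def by blast
  have ends: "narr s aEnds e = ends e"
    using assms(1,3) unfolding forced_fixed_def requisition_arrays_def by simp
  have asg: "assigned s' = insert e (assigned s)" if "narr s' aA0 = (narr s aA0)(e := u)" for s'
    using that assms(3) u by (auto simp: assigned_def)
  show ?thesis
    using assms inc ends asg by (simp add: visit_def del: fun_upd_apply) (simp add: asg)
qed

text \<open>\<open>V\<close> and \<open>p\<close> are ghosts: the registers already refer to the
  next position \<open>vE\<close>, entered through the vertex \<open>vU\<close> by which
  \<open>p\<close> was left.\<close>

definition tracing :: "nat set \<Rightarrow> nat \<Rightarrow> nat \<Rightarrow> state \<Rightarrow> bool" where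
  "tracing U k o1 s \<longleftrightarrow> forced_fixed s \<and> nvar s vI = o1 \<and> nvar s vK = Suc k \<and>
     resolved U k (narr s aA0) (narr s aA1) (narr s aBlk) \<and>
     nvar s vD = narr s aA0 (nvar s vE) \<and>
     (\<exists>V p. path U o1 V p (narr s aA0) (narr s aA1) \<and> assigned s = F \<union> U \<union> V \<and>
        (\<forall>q\<in>V. narr s aBlk q = Suc k) \<and> nvar s vU = narr s aA1 p \<and>
        incident F (narr s aA1 p) = {p, nvar s vE} \<and> nvar s vE \<noteq> p \<and> nvar s vE \<in> {1..n} - F - U \<and>
        narr s aA1 p \<in> R (nvar s vE))"

lemma tracing_tick [simp]: "tracing U k o1 (tick t s) = tracing U k o1 s"
  by (simp add: tracing_def)

lemma tracingI:
  assumes "forced_fixed s" "nvar s vI = o1" "nvar s vK = Suc k"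
    "resolved U k (narr s aA0) (narr s aA1) (narr s aBlk)"
    "nvar s vD = narr s aA0 (nvar s vE)"
    "path U o1 V p (narr s aA0) (narr s aA1)" "assigned s = F \<union> U \<union> V"
    "\<forall>q\<in>V. narr s aBlk q = Suc k" "nvar s vU = narr s aA1 p"
    "nvar s vE = \<Sum>(incident F (narr s aA1 p)) - p"
  shows "tracing U k o1 s"
proof -
  obtain j where "\<Sum>(incident F (narr s aA1 p)) - p = j" "j \<in> {1..n} - F - U" "j \<noteq> p"
      "narr s aA1 p \<in> R j" "incident F (narr s aA1 p) = {p, j}"
    using path_next[OF assms(6,4)] by blast
  then show ?thesis
    using assms unfolding tracing_def by (intro conjI exI[of _ V] exI[of _ p]) simp_all
qed

lemma wp_first_visit:
  assumes s: "forced_fixed s" "nvar s vI = o1" "nvar s vE = o1" "nvar s vU = u" "u \<in> R o1"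
    "nvar s vK = Suc k" "o1 \<in> {1..n} - assigned s"
    and res: "resolved (assigned s - F) k (narr s aA0) (narr s aA1) (narr s aBlk)"
  shows "wp inp visit (\<lambda>s'. tracing (assigned s - F) k o1 s' \<and>
    card (assigned s') = Suc (card (assigned s)) \<and> clock s' = clock s + 45) s"
proof -
  have F: "F \<subseteq> assigned s"
    using F_assigned s(1) by blast
  have o1: "o1 \<in> {1..n} - F"
    using s(7) F by blast
  show ?thesis
  proof (rule wp_mono[OF wp_visit[of s o1 u]], goal_cases)
    case (6 s')
    have "tracing (assigned s - F) k o1 s'"
    proof (rule tracingI[where V = "{o1}" and p = o1])
      show "resolved (assigned s - F) k (narr s' aA0) (narr s' aA1) (narr s' aBlk)"
        by (rule resolved_cong[OF res]) (use 6 s(7) in auto)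
      show "path (assigned s - F) o1 {o1} o1 (narr s' aA0) (narr s' aA1)"
        by (rule path_start) (use 6 s o1 in auto)
      show "assigned s' = F \<union> (assigned s - F) \<union> {o1}"
        using 6 F by auto
    qed (use 6 s in simp_all)
    then show ?case
      using 6 s(7) by simp
  qed (use s o1 in auto)
qed

lemma wp_next_visit:
  assumes "tracing U k o1 s" "nvar s vD = 0"
  shows "wp inp visit (\<lambda>s'. tracing U k o1 s' \<and>
    card (assigned s') = Suc (card (assigned s)) \<and> clock s' = clock s + 45) s"
proof -
  define j where "j = nvar s vE"
  obtain V p where *: "path U o1 V p (narr s aA0) (narr s aA1)" "assigned s = F \<union> U \<union> V"
      "\<forall>q\<in>V. narr s aBlk q = Suc k" "nvar s vU = narr s aA1 p"
      "incident F (narr s aA1 p) = {p, j}" "j \<noteq> p" "j \<in> {1..n} - F - U" "narr s aA1 p \<in> R j"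
    using assms(1) unfolding tracing_def j_def by blast
  have s: "forced_fixed s" "nvar s vI = o1" "nvar s vK = Suc k"
      "resolved U k (narr s aA0) (narr s aA1) (narr s aBlk)" "narr s aA0 j = 0"
    using assms unfolding tracing_def j_def by simp_all
  have "j \<notin> assigned s"
    using s(5) by (simp add: assigned_def)
  then have jV: "j \<notin> V"
    using *(2) by blast
  have pj: "p \<noteq> j"
    using *(6) by simp
  show ?thesis
  proof (rule wp_mono[OF wp_visit[of s j "narr s aA1 p"]], goal_cases)
    case (6 s')
    have "tracing U k o1 s'"
    proof (rule tracingI[where V = "insert j V" and p = j])
      show "resolved U k (narr s' aA0) (narr s' aA1) (narr s' aBlk)"
        by (rule resolved_cong[OF s(4)]) (use 6 *(7) in auto)
      show "path U o1 (insert j V) j (narr s' aA0) (narr s' aA1)"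
        by (rule path_step[OF *(1,5,6,7,8) jV]) (use 6 in auto)
      show "assigned s' = F \<union> U \<union> insert j V"
        using 6 *(2) by auto
    qed (use 6 s *(3) in simp_all)
    then show ?case
      using 6 \<open>j \<notin> assigned s\<close> by simp
  qed (use s * j_def in auto)
qed

text \<open>The next position lies outside \<open>F\<close> and \<open>U\<close>, so a nonzero mark
  on it can only stem from the current path; then \<open>path_close\<close> applies.\<close>

lemma tracing_closed:
  assumes "tracing U k o1 s" "nvar s vD \<noteq> 0"
  shows "resolved (assigned s - F) (Suc k) (narr s aA0) (narr s aA1) (narr s aBlk) \<and>
    o1 \<in> assigned s \<and> U \<subseteq> assigned s"
proof -
  define j where "j = nvar s vE"
  obtain V p where *: "path U o1 V p (narr s aA0) (narr s aA1)" "assigned s = F \<union> U \<union> V"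
      "\<forall>q\<in>V. narr s aBlk q = Suc k" "nvar s vU = narr s aA1 p"
      "incident F (narr s aA1 p) = {p, j}" "j \<noteq> p" "j \<in> {1..n} - F - U" "narr s aA1 p \<in> R j"
    using assms(1) unfolding tracing_def j_def by blast
  have res: "resolved U k (narr s aA0) (narr s aA1) (narr s aBlk)" and "narr s aA0 j \<noteq> 0"
    using assms unfolding tracing_def j_def by simp_all
  then have "j \<in> assigned s"
    using *(7) by (simp add: assigned_def)
  then have "j \<in> V"
    using *(2,7) by blast
  have "U \<subseteq> {1..n} - F" "V \<subseteq> {1..n} - F" "o1 \<in> V"
    using res *(1) unfolding resolved_def path_def by auto
  then have "assigned s - F = U \<union> V"
    using *(2) by blast
  then show ?thesis
    using path_close[OF *(1,5,6) \<open>j \<in> V\<close> res *(3)] *(2) \<open>o1 \<in> V\<close> by auto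
qed

definition traced :: "nat \<Rightarrow> state \<Rightarrow> bool" where
  "traced i s \<longleftrightarrow> forced_fixed s \<and> {1..<i} \<subseteq> assigned s \<and>
     resolved (assigned s - F) (nvar s vK) (narr s aA0) (narr s aA1) (narr s aBlk)"

text \<open>Every visit assigns a fresh position. Charging 47 (45 for \<open>visit\<close>, 2 for
  the loop test) to each of them keeps the total linear, whatever the lengths of the cycles.\<close>

lemma wp_trace_one:
  assumes "traced i s" "nvar s vI = i" "i \<in> {1..n}" "clock s \<le> T + 47 * card (assigned s)"
    and "narr s aA0 i = 0"
  shows "wp inp (Do (VAdd vK vK vOne) ;; Do (VCopy vE vI) ;; Do (Get vU aMin vI) ;; visit ;;
           While (TEq vD vZero) visit)
    (\<lambda>s'. traced (Suc i) s' \<and> nvar s' vI = i \<and> clock s' \<le> T + 11 + 47 * card (assigned s')) s"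
proof -
  define U k where "U = assigned s - F" and "k = nvar s vK"
  have s: "forced_fixed s" "{1..<i} \<subseteq> assigned s"
      "resolved (assigned s - F) k (narr s aA0) (narr s aA1) (narr s aBlk)"
    using assms(1) unfolding traced_def k_def by auto
  have c: "nvar s vOne = 1" "narr s aMin i = Min (R i)"
    using s(1) assms(3) unfolding forced_fixed_def constants_def requisition_arrays_def by auto
  let ?s = "effect inp (Get vU aMin vI) (effect inp (VCopy vE vI) (effect inp (VAdd vK vK vOne) s))"
  have asg: "assigned ?s = assigned s"
    by simp
  have loop: "wp inp (While (TEq vD vZero) visit) (\<lambda>s'. traced (Suc i) s' \<and> nvar s' vI = i \<and>
      clock s' \<le> T + 11 + 47 * card (assigned s')) s1"
    if "tracing U k i s1" "clock s1 \<le> T + 9 + 47 * card (assigned s1)" for s1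
  proof (rule wp_While[where m = "\<lambda>s. n - card (assigned s)" and
      J = "\<lambda>s. tracing U k i s \<and> clock s \<le> T + 9 + 47 * card (assigned s)"], goal_cases)
    case (2 s2)
    then have "nvar s2 vD = 0"
      by (simp add: tracing_def forced_fixed_def constants_def)
    with 2 have "wp inp visit (\<lambda>s'. tracing U k i s' \<and>
      card (assigned s') = Suc (card (assigned s2)) \<and> clock s' = 47 + clock s2) (tick 2 s2)"
      using wp_next_visit[of U k i "tick 2 s2"] by simp
    then show ?case
    proof (rule wp_mono, goal_cases)
      case (1 s')
      then show ?case
        using 2 card_assigned_le[of s'] by auto
    qed
  next
    case (3 s2)
    then have "nvar s2 vD \<noteq> 0"
      by (simp add: tracing_def forced_fixed_def constants_def)
    then have closed: "resolved (assigned s2 - F) (Suc k) (narr s2 aA0) (narr s2 aA1) (narr s2 aBlk)"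
        "i \<in> assigned s2" "U \<subseteq> assigned s2"
      using tracing_closed 3(1) by blast+
    have s2: "forced_fixed s2" "nvar s2 vI = i" "nvar s2 vK = Suc k"
      using 3(1) unfolding tracing_def by auto
    have "assigned s \<subseteq> assigned s2"
      using closed(3) F_assigned[OF s2(1)] unfolding U_def by blast
    then have "{1..<Suc i} \<subseteq> assigned s2"
      using s(2) closed(2) by (auto simp: less_Suc_eq)
    then show ?case
      using 3 s2 closed(1) by (simp add: traced_def)
  qed (use that in auto)
  have "wp inp visit (\<lambda>s'. tracing (assigned ?s - F) k i s' \<and>
    card (assigned s') = Suc (card (assigned ?s)) \<and> clock s' = clock ?s + 45) ?s"
  proof (rule wp_first_visit[where u = "Min (R i)"])
    show "i \<in> {1..n} - assigned ?s"
      using assms(3,5) by (simp add: assigned_def)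
    show "Min (R i) \<in> R i"
      using R_nonempty[OF assms(3)] finite_R[OF assms(3)] by simp
  qed (use s assms(2) c in \<open>auto simp: k_def\<close>)
  then show ?thesis
    unfolding wp_Seq wp_Do
  proof (rule wp_mono, goal_cases)
    case (1 s')
    show ?case
      by (rule loop) (use 1 assms(4) in \<open>auto simp: U_def\<close>)
  qed
qed

lemma wp_trace_cycles:
  assumes "forced_fixed s" "assigned s = F" "nvar s vK = 0"
  shows "wp inp trace_cycles (\<lambda>s'. forced_fixed s' \<and>
    decomposed (nvar s' vK) (narr s' aA0) (narr s' aA1) (narr s' aBlk) \<and>
    clock s' \<le> clock s + 80 * n + 60) s"
proof -
  let ?Q = "\<lambda>s'. forced_fixed s' \<and>
    decomposed (nvar s' vK) (narr s' aA0) (narr s' aA1) (narr s' aBlk) \<and>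
    clock s' \<le> clock s + 80 * n + 60"
  have "wp inp (While (TLess vI vN1)
       (Do (Get vD aA0 vI) ;;
        If (TEq vD vZero)
          (Do (VAdd vK vK vOne) ;; Do (VCopy vE vI) ;; Do (Get vU aMin vI) ;; visit ;;
           While (TEq vD vZero) visit)
          skip ;;
        Do (VAdd vI vI vOne))) ?Q s1"
    if "traced 1 s1" "nvar s1 vI = 1" "clock s1 = clock s + 1" for s1
  proof (rule wp_count[where h = "Suc n" and l = 1 and
        J = "\<lambda>i s'. traced i s' \<and> nvar s' vI = i \<and>
          clock s' \<le> clock s + 1 + 30 * i + 47 * card (assigned s')"], goal_cases)
    case (3 i s2)
    then show ?case
      by (simp add: traced_def forced_fixed_def constants_def)
  next
    case (4 i s2)
    have s2: "forced_fixed s2"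
      using 4 by (simp add: traced_def)
    then have c: "nvar s2 vOne = 1" "nvar s2 vZero = 0"
      by (simp_all add: forced_fixed_def constants_def)
    have tr: "traced i (tick t (set_nvar vD d s2))" for t d
      using 4 by (simp add: traced_def)
    show ?case
    proof (cases "narr s2 aA0 i = 0")
      case True
      let ?s3 = "tick (Suc 0) (tick 7 (set_nvar vD 0 (tick 2 s2)))"
      have "wp inp (Do (VAdd vK vK vOne) ;; Do (VCopy vE vI) ;; Do (Get vU aMin vI) ;; visit ;;
           While (TEq vD vZero) visit)
        (\<lambda>s'. traced (Suc i) s' \<and> nvar s' vI = i \<and>
           clock s' \<le> (clock s + 1 + 30 * i + 10) + 11 + 47 * card (assigned s')) ?s3"
        by (rule wp_trace_one) (use 4 True in \<open>auto simp: traced_def\<close>)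
      then have "wp inp (Do (VAdd vK vK vOne) ;; Do (VCopy vE vI) ;; Do (Get vU aMin vI) ;; visit ;;
           While (TEq vD vZero) visit) (wp inp (Do (VAdd vI vI vOne)) (\<lambda>s'. traced (Suc i) s' \<and>
           nvar s' vI = Suc i \<and> clock s' \<le> clock s + 1 + 30 * Suc i + 47 * card (assigned s'))) ?s3"
      proof (rule wp_mono, goal_cases)
        case (1 s')
        then have "nvar s' vOne = 1"
          by (simp add: traced_def forced_fixed_def constants_def)
        then show ?case
          using 1 by (simp add: traced_def)
      qed
      then show ?thesis
        using 4 True c by simp
    next
      case False
      then have "i \<in> assigned s2"
        using 4 by (simp add: assigned_def)
      then have "traced (Suc i) s2"
        using 4 by (auto simp: traced_def less_Suc_eq)
      then show ?thesis
        using 4 False c by (simp add: traced_def)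
    qed
  next
    case (5 s2)
    then have asg: "assigned s2 = {1..n}"
      unfolding traced_def assigned_def by (auto simp: less_Suc_eq_le)
    then show ?case
      using 5 unfolding traced_def decomposed_def by (auto simp: forced_fixed_def)
  qed (use that in auto)
  then show ?thesis
    using assms by (simp add: trace_cycles_def traced_def resolved_empty)
qed

end

section \<open>Aggregating the cost in a table\<close>

text \<open>The machine does not multiply indices, so the multiples of the row length are tabulated
  by repeated addition.\<close>

definition fill_offsets :: cmd where
  "fill_offsets =
     Do (VAdd vM vN vN) ;; Do (VAdd vM vM vTwo) ;; Do (VConst vO 0) ;; Do (VConst vP 0) ;;
     While (TLess vP vM) (Do (Put aOff vP vO) ;; Do (VAdd vO vO vM) ;; Do (VAdd vP vP vOne))"

text \<open>\<open>a\<close> and \<open>b\<close> are resolved when the program is built, which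
  gives four pieces of code. An option is the maximum of its requisition exactly if it exceeds the
  minimum (in a singleton both coincide); these comparisons select the weight among the four input
  entries.\<close>

definition accumulate :: "bool \<Rightarrow> bool \<Rightarrow> cmd" where
  "accumulate a b =
     Do (VCopy vP vW) ;;
     Do (Get vA (if a then aA1 else aA0) vI) ;; Do (Get vC aMin vI) ;;
     If (TLess vC vA) (Do (VAdd vP vP vTwo)) skip ;;
     Do (Get vA (if b then aA1 else aA0) vJ) ;; Do (Get vC aMin vJ) ;;
     If (TLess vC vA) (Do (VAdd vP vP vOne)) skip ;;
     Do (RInput rW vP) ;;
     Do (if a then VAdd vX vBI vOne else VCopy vX vBI) ;; Do (Get vO aOff vX) ;;
     Do (VAdd vO vO vBJ) ;; Do (if b then VAdd vO vO vOne else VCopy vO vO) ;;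
     Do (RGet rZ vO) ;; Do (RAdd rZ rZ rW) ;; Do (RPut vO rZ)"

definition fill_table :: cmd where
  "fill_table =
     Do (VConst vI 1) ;; Do (VConst vW 0) ;;
     While (TLess vI vN1)
       (If (TEq vI vN) (Do (VConst vJ 1)) (Do (VAdd vJ vI vOne)) ;;
        Do (Get vBI aBlk vI) ;; Do (VAdd vBI vBI vBI) ;;
        Do (Get vBJ aBlk vJ) ;; Do (VAdd vBJ vBJ vBJ) ;;
        accumulate False False ;; accumulate False True ;;
        accumulate True False ;; accumulate True True ;;
        Do (VAdd vW vW vFour) ;; Do (VAdd vI vI vOne))"

text \<open>The entry of block \<open>c\<close> is twice \<open>c\<close> plus its bit instead of
  the bit alone: this is the row or column index in the table. There are \<open>k + 2\<close>
  entries, for block 0, the cycles and a sentinel.\<close>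

definition init_counter :: cmd where
  "init_counter =
     Do (VAdd vK1 vK vOne) ;; Do (VAdd vK2 vK1 vOne) ;; Do (VConst vP 0) ;; Do (VConst vD 0) ;;
     While (TLess vP vK2) (Do (Put aCur vP vD) ;; Do (VAdd vD vD vTwo) ;; Do (VAdd vP vP vOne))"

definition evaluate_row :: cmd where
  "evaluate_row =
     While (TLess vV vK1)
       (Do (Get vB aCur vV) ;; Do (VAdd vB vB vO) ;; Do (RGet rZ vB) ;; Do (RAdd rCost rCost rZ) ;;
        Do (VAdd vV vV vOne))"

definition evaluate :: cmd where
  "evaluate =
     Do (RZero rCost) ;; Do (VConst vU 0) ;;
     While (TLess vU vK1)
       (Do (Get vA aCur vU) ;; Do (Get vO aOff vA) ;; Do (VConst vV 0) ;; evaluate_row ;;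
        Do (VAdd vU vU vOne))"

definition copy_counter :: cmd where
  "copy_counter =
     While (TLess vU vK1) (Do (Get vA aCur vU) ;; Do (Put aBst vU vA) ;; Do (VAdd vU vU vOne))"

text \<open>\<open>vFlag\<close> stays 0 until the first candidate is stored, which replaces an
  infinite initial cost; afterwards only an improvement resets it.\<close>

definition record_best :: cmd where
  "record_best =
     If (RLess rCost rBest) (Do (VConst vFlag 0)) skip ;;
     If (TEq vFlag vZero)
       (Do (RCopy rBest rCost) ;; Do (VConst vFlag 1) ;; Do (VConst vU 0) ;; copy_counter)
       skip"

text \<open>As \<open>vD\<close> is twice \<open>vC\<close>, the test holds exactly if the bit of
  block \<open>vC\<close> is set.\<close>

definition carry :: cmd where
  "carry =
     While (TLess vD vA)
       (Do (Put aCur vC vD) ;; Do (VAdd vC vC vOne) ;; Do (VAdd vD vD vTwo) ;; Do (Get vA aCur vC))"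

definition increment :: cmd where
  "increment =
     Do (VConst vC 1) ;; Do (VConst vD 2) ;; Do (Get vA aCur vC) ;; carry ;;
     Do (VAdd vD vD vOne) ;; Do (Put aCur vC vD)"

text \<open>After \<open>increment\<close>, \<open>vC\<close> is the index of the bit just set, so
  the loop ends when this is the sentinel. The initial 0 admits the first round.\<close>

definition enumerate :: cmd where
  "enumerate = Do (VConst vC 0) ;; While (TLess vC vK1) (evaluate ;; record_best ;; increment)"

definition write_solution :: cmd where
  "write_solution =
     Do (VConst vI 1) ;;
     While (TLess vI vN1)
       (Do (Get vC aBlk vI) ;; Do (Get vA aBst vC) ;; Do (VAdd vC vC vC) ;;
        If (TEq vA vC) (Do (Get vB aA0 vI)) (Do (Get vB aA1 vI)) ;;
        Do (Output vB) ;; Do (VAdd vI vI vOne))"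

locale tspvr_decomposed = tspvr_residual +
  fixes k :: nat and A0 A1 B :: "nat \<Rightarrow> nat"
  assumes decomposed: "decomposed k A0 A1 B"
begin

text \<open>Room for all indices \<open>2 * c\<close> and \<open>2 * c + 1\<close> with
  \<open>c \<le> k \<le> n\<close>. The addresses of the table may reach order \<open>n^2\<close>,
  but memory starts at zero and only the cells that are addressed cost time.\<close>

definition stride :: nat where
  "stride = 2 * n + 2"

lemma block_range:
  assumes "i \<in> {1..n}"
  shows "B i \<le> k" "A0 i \<in> R i" "A1 i \<in> R i"
proof -
  have "B i \<le> k \<and> A0 i \<in> R i \<and> A1 i \<in> R i"
  proof (cases "i \<in> F")
    case True
    then have "A0 i = A i" "A1 i = A i" "B i = 0"
      using decomposed unfolding decomposed_def by auto
    moreover obtain g where "g \<in> solutions n R"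
      using solution_exists ..
    then have "A i \<in> R i"
      using peeled True solutions_R[of g i] assms unfolding peeled_def by auto
    ultimately show ?thesis
      by simp
  next
    case False
    then show ?thesis
      using decomposed assms unfolding decomposed_def resolved_def by auto
  qed
  then show "B i \<le> k" "A0 i \<in> R i" "A1 i \<in> R i"
    by auto
qed

lemma k_le_n: "k \<le> n"
proof -
  have "{1..k} \<subseteq> B ` ({1..n} - F)"
    using decomposed unfolding decomposed_def resolved_def by blast
  then have "card {1..k} \<le> card ({1..n} - F)"
    by (meson surj_card_le finite_Diff finite_atLeastAtMost)
  also have "\<dots> \<le> card {1..n}"
    by (rule card_mono) auto
  finally show ?thesis
    by simp
qed

definition ready :: "state \<Rightarrow> bool" where
  "ready s \<longleftrightarrow> constants s \<and> requisition_arrays (Suc n) s \<and> nvar s vK = k \<and>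
     narr s aA0 = A0 \<and> narr s aA1 = A1 \<and> narr s aBlk = B \<and> outp s = []"

lemma ready_simps [simp]:
  "ready (tick t s) = ready s"
  "d \<notin> {vN, vN1, vOne, vTwo, vFour, vZero, vK} \<Longrightarrow> ready (set_nvar d v s) = ready s"
  "a \<notin> {aMin, aEnds, aA0, aA1, aBlk} \<Longrightarrow> ready (set_narr a i v s) = ready s"
  "ready (set_wvar d w s) = ready s" "ready (set_warr i w s) = ready s"
  by (simp_all add: ready_def)

lemma ready_registers:
  assumes "ready s"
  shows "nvar s vN = n" "nvar s vN1 = Suc n" "nvar s vOne = 1" "nvar s vTwo = 2" "nvar s vFour = 4"
    "nvar s vZero = 0" "nvar s vK = k" "narr s aA0 = A0" "narr s aA1 = A1" "narr s aBlk = B"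
  using assms by (simp_all add: ready_def constants_def)

definition offsets :: "state \<Rightarrow> bool" where
  "offsets s \<longleftrightarrow> (\<forall>p<stride. narr s aOff p = p * stride)"

lemma offsets_simps [simp]:
  "offsets (tick t s) = offsets s" "offsets (set_nvar d v s) = offsets s"
  "a \<noteq> aOff \<Longrightarrow> offsets (set_narr a i v s) = offsets s"
  "offsets (set_wvar d w s) = offsets s" "offsets (set_warr i w s) = offsets s"
  by (simp_all add: offsets_def)

lemma wp_fill_offsets:
  assumes "ready s" "nvar s vFlag = 0" "warr s = (\<lambda>_. 0)"
  shows "wp inp fill_offsets (\<lambda>s'. ready s' \<and> offsets s' \<and> nvar s' vFlag = 0 \<and>
    warr s' = (\<lambda>_. 0) \<and> clock s' \<le> clock s + 30 * n + 30) s"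
proof -
  have "wp inp (While (TLess vP vM)
      (Do (Put aOff vP vO) ;; Do (VAdd vO vO vM) ;; Do (VAdd vP vP vOne)))
      (\<lambda>s'. ready s' \<and> offsets s' \<and> nvar s' vFlag = 0 \<and>
        warr s' = (\<lambda>_. 0) \<and> clock s' \<le> clock s + 30 * n + 30) s1"
    if "ready s1" "nvar s1 vM = stride" "nvar s1 vO = 0" "nvar s1 vP = 0" "nvar s1 vFlag = 0"
      "warr s1 = (\<lambda>_. 0)" "clock s1 = clock s + 4" for s1
  proof (rule wp_count[where h = stride and l = 0 and
        J = "\<lambda>p s'. ready s' \<and> nvar s' vP = p \<and> nvar s' vM = stride \<and> nvar s' vO = p * stride \<and>
          (\<forall>q<p. narr s' aOff q = q * stride) \<and> nvar s' vFlag = 0 \<and> warr s' = (\<lambda>_. 0) \<and>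
          clock s' = clock s + 4 + 11 * p"], goal_cases)
    case (4 p s2)
    then show ?case
      using ready_registers[of s2] by (simp add: less_Suc_eq)
  next
    case (5 s2)
    then show ?case
      by (simp add: offsets_def stride_def)
  qed (use that in auto)
  then show ?thesis
    using assms ready_registers[OF assms(1)] by (simp add: fill_offsets_def stride_def)
qed

definition select :: "bool \<Rightarrow> nat \<Rightarrow> nat" where
  "select a i = (if a then A1 i else A0 i)"

definition pos_weight :: "nat \<Rightarrow> bool \<Rightarrow> bool \<Rightarrow> real" where
  "pos_weight i a b = arc_weight \<rho> (select a i) (select b (next_pos n i))"

definition cell :: "nat \<Rightarrow> bool \<Rightarrow> bool \<Rightarrow> nat" where
  "cell i a b = (2 * B i + of_bool a) * stride + (2 * B (next_pos n i) + of_bool b)"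

text \<open>\<open>Z\<close> holds the triples (position, its option, option of the next position)
  added so far. Many triples may fall into one cell, which is the purpose of the
  aggregation.\<close>

definition table :: "(nat \<times> bool \<times> bool) set \<Rightarrow> state \<Rightarrow> bool" where
  "table Z s \<longleftrightarrow> (\<forall>z. warr s z = (\<Sum>(i, a, b)\<in>Z. if cell i a b = z then pos_weight i a b else 0))"

lemma table_simps [simp]:
  "table Z (tick t s) = table Z s" "table Z (set_nvar d v s) = table Z s"
  "table Z (set_narr a i v s) = table Z s" "table Z (set_wvar d w s) = table Z s"
  by (simp_all add: table_def)

lemma table_insert:
  assumes "table Z s" "finite Z" "(i, a, b) \<notin> Z" "z = cell i a b" "v = warr s z + pos_weight i a b"
  shows "table (insert (i, a, b) Z) (set_warr z v s)"
  using assms by (auto simp: table_def)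

lemma select_in_R: "i \<in> {1..n} \<Longrightarrow> select a i \<in> R i"
  using block_range by (simp add: select_def)

lemma select_Min_Max:
  assumes "i \<in> {1..n}"
  shows "(if Min (R i) < select a i then Max (R i) else Min (R i)) = select a i"
proof -
  have "select a i = Min (R i) \<or> select a i = Max (R i)"
    using select_in_R[OF assms, of a] R_eq_Min_Max[OF assms] by blast
  moreover have "Min (R i) \<le> select a i"
    using select_in_R[OF assms, of a] finite_R[OF assms] by simp
  ultimately show ?thesis
    by auto
qed

lemma lookup_pos_weight:
  assumes "i \<in> {1..n}"
  shows "lookup (snd inp) (4 * (i - 1) + 2 * of_bool (Min (R i) < select a i) +
    of_bool (Min (R (next_pos n i)) < select b (next_pos n i))) = pos_weight i a b"
  unfolding lookup_encode_weight[OF assms] pos_weight_def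
  using select_Min_Max[OF assms, of a] select_Min_Max[OF next_pos_range[OF assms], of b] by simp

definition at_position :: "nat \<Rightarrow> state \<Rightarrow> bool" where
  "at_position i s \<longleftrightarrow> ready s \<and> offsets s \<and> nvar s vFlag = 0 \<and> nvar s vI = i \<and>
     nvar s vJ = next_pos n i \<and> nvar s vW = 4 * (i - 1) \<and> nvar s vBI = 2 * B i \<and>
     nvar s vBJ = 2 * B (next_pos n i)"

lemma at_position_simps [simp]:
  "at_position i (tick t s) = at_position i s"
  "d \<in> {vP, vA, vC, vX, vO, vQ} \<Longrightarrow> at_position i (set_nvar d v s) = at_position i s"
  "at_position i (set_wvar d w s) = at_position i s"
  "at_position i (set_warr z w s) = at_position i s"
  by (auto simp: at_position_def)

lemma wp_accumulate:
  assumes "at_position i s" "i \<in> {1..n}" "table Z s" "finite Z" "(i, a, b) \<notin> Z"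
  shows "wp inp (accumulate a b) (\<lambda>s'. at_position i s' \<and> table (insert (i, a, b) Z) s' \<and>
    clock s' \<le> clock s + 60) s"
proof -
  define j where "j = next_pos n i"
  have j: "j \<in> {1..n}"
    unfolding j_def by (rule next_pos_range[OF assms(2)])
  have s: "ready s" "offsets s" "nvar s vI = i" "nvar s vJ = j" "nvar s vW = 4 * (i - 1)"
      "nvar s vBI = 2 * B i" "nvar s vBJ = 2 * B j"
    using assms(1) unfolding at_position_def j_def by simp_all
  have mins: "narr s aMin i = Min (R i)" "narr s aMin j = Min (R j)"
    using s(1) assms(2) j unfolding ready_def requisition_arrays_def by simp_all
  have sel: "narr s (if a then aA1 else aA0) l = select a l" for a l
    using ready_registers(8,9)[OF s(1)] by (simp add: select_def)
  define P where "P = 4 * (i - 1) + 2 * of_bool (Min (R i) < select a i) +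
    of_bool (Min (R j) < select b j)"
  have P: "lookup (snd inp) P = pos_weight i a b"
    unfolding P_def j_def by (rule lookup_pos_weight[OF assms(2)])
  have "2 * B i + of_bool a < stride"
    using block_range(1)[OF assms(2)] k_le_n by (auto simp: stride_def)
  then have off: "narr s aOff (2 * B i + of_bool a) = (2 * B i + of_bool a) * stride"
    using s(2) unfolding offsets_def by blast
  define z where "z = cell i a b"
  have z: "(2 * B i + of_bool a) * stride + 2 * B j + of_bool b = z"
    by (simp add: z_def cell_def j_def)
  have ins: "table (insert (i, a, b) Z) s'" if "warr s' = (warr s)(z := warr s z + pos_weight i a b)" for s'
    using table_insert[OF assms(3-5) z_def refl] that by (simp add: table_def)
  note [simp] = s mins ready_registers[OF s(1)]
  show ?thesis
    using assms(1) P off z ins unfolding P_def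
    by (cases a; cases b; cases "Min (R i) < select a i"; cases "Min (R j) < select b j";
        simp add: accumulate_def select_def)
qed

lemma wp_fill_table:
  assumes "ready s" "offsets s" "nvar s vFlag = 0" "warr s = (\<lambda>_. 0)"
  shows "wp inp fill_table (\<lambda>s'. ready s' \<and> offsets s' \<and> nvar s' vFlag = 0 \<and>
    table ({1..n} \<times> UNIV) s' \<and> clock s' \<le> clock s + 290 * n + 10) s"
proof -
  have "wp inp (While (TLess vI vN1)
       (If (TEq vI vN) (Do (VConst vJ 1)) (Do (VAdd vJ vI vOne)) ;;
        Do (Get vBI aBlk vI) ;; Do (VAdd vBI vBI vBI) ;;
        Do (Get vBJ aBlk vJ) ;; Do (VAdd vBJ vBJ vBJ) ;;
        accumulate False False ;; accumulate False True ;;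
        accumulate True False ;; accumulate True True ;;
        Do (VAdd vW vW vFour) ;; Do (VAdd vI vI vOne)))
      (\<lambda>s'. ready s' \<and> offsets s' \<and> nvar s' vFlag = 0 \<and> table ({1..n} \<times> UNIV) s' \<and>
        clock s' \<le> clock s + 290 * n + 10) s1"
    if s1: "ready s1" "offsets s1" "nvar s1 vFlag = 0" "table {} s1" "nvar s1 vI = 1" "nvar s1 vW = 0"
      "clock s1 = clock s + 2" for s1
  proof (rule wp_count[where h = "Suc n" and l = 1 and
        J = "\<lambda>i s'. ready s' \<and> offsets s' \<and> nvar s' vFlag = 0 \<and> nvar s' vI = i \<and>
          nvar s' vW = 4 * (i - 1) \<and> table ({1..<i} \<times> UNIV) s' \<and>
          clock s' + 290 \<le> clock s + 2 + 290 * i"], goal_cases)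
    case (3 i s2)
    then show ?case
      using ready_registers(2) by blast
  next
    case (4 i s2)
    let ?Z = "{1..<i} \<times> (UNIV :: (bool \<times> bool) set)"
    have i: "i \<in> {1..n}"
      using 4 by simp
    have r: "ready s2"
      using 4 by blast
    \<comment> \<open>The rest of the round, treated once for both ways of computing the cyclic
      successor.\<close>
    define G where "G = wp inp (accumulate False False) (wp inp (accumulate False True)
        (wp inp (accumulate True False) (wp inp (accumulate True True)
          (wp inp (Do (VAdd vW vW vFour)) (wp inp (Do (VAdd vI vI vOne))
          (\<lambda>s'. ready s' \<and> offsets s' \<and> nvar s' vFlag = 0 \<and> nvar s' vI = Suc i \<and>
          nvar s' vW = 4 * (Suc i - 1) \<and> table ({1..<Suc i} \<times> UNIV) s' \<and>
          clock s' + 290 \<le> clock s + 2 + 290 * Suc i))))))"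
    have acc: "G s3"
      if s3: "at_position i s3" "table ?Z s3" "clock s3 \<le> clock s2 + 40" for s3
      unfolding G_def
    proof (rule wp_mono[OF wp_accumulate[of i s3 ?Z False False]], goal_cases)
      case (6 s4)
      show ?case
      proof (rule wp_mono[OF wp_accumulate[of i s4 "insert (i, False, False) ?Z" False True]], goal_cases)
        case (6 s5)
        show ?case
        proof (rule wp_mono[OF wp_accumulate[of i s5 "insert (i, False, True) (insert (i, False, False) ?Z)"
              True False]], goal_cases)
          case (6 s6)
          show ?case
          proof (rule wp_mono[OF wp_accumulate[of i s6
                  "insert (i, True, False) (insert (i, False, True) (insert (i, False, False) ?Z))"
                  True True]], goal_cases)
            case (6 s7)
            let ?Z' = "insert (i, True, True) (insert (i, True, False)
              (insert (i, False, True) (insert (i, False, False) ?Z)))"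
            have Z': "?Z' = {1..<Suc i} \<times> UNIV"
            proof (rule set_eqI)
              fix x :: "nat \<times> bool \<times> bool"
              obtain l a b where x: "x = (l, a, b)"
                by (cases x)
              show "x \<in> ?Z' \<longleftrightarrow> x \<in> {1..<Suc i} \<times> UNIV"
                unfolding x using i by (cases a; cases b) (auto simp: less_Suc_eq)
            qed
            have s7: "ready s7" "offsets s7" "nvar s7 vFlag = 0" "nvar s7 vI = i"
                "nvar s7 vW = 4 * (i - 1)"
              using 6 unfolding at_position_def by auto
            have "clock s7 \<le> clock s2 + 280"
              using 6 \<open>_ \<and> _ \<and> clock s6 \<le> _\<close> \<open>_ \<and> _ \<and> clock s5 \<le> _\<close> \<open>_ \<and> _ \<and> clock s4 \<le> _\<close> s3(3)
              by linarith
            then show ?case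
              using 6 4 s7 ready_registers[OF s7(1)] i unfolding Z' by simp
          qed (use 6 i in auto)
        qed (use 6 i in auto)
      qed (use 6 i in auto)
    qed (use s3 i in auto)
    show ?case
      unfolding wp_Seq G_def[symmetric]
    proof (cases "i = n")
      case True
      then show "wp inp (If (TEq vI vN) (Do (VConst vJ 1)) (Do (VAdd vJ vI vOne))) 
          (wp inp (Do (Get vBI aBlk vI)) (wp inp (Do (VAdd vBI vBI vBI))
            (wp inp (Do (Get vBJ aBlk vJ)) (wp inp (Do (VAdd vBJ vBJ vBJ)) G)))) (tick 2 s2)"
        using 4 i ready_registers[OF r] acc by (simp add: at_position_def next_pos_def)
    next
      case False
      then show "wp inp (If (TEq vI vN) (Do (VConst vJ 1)) (Do (VAdd vJ vI vOne))) 
          (wp inp (Do (Get vBI aBlk vI)) (wp inp (Do (VAdd vBI vBI vBI))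
            (wp inp (Do (Get vBJ aBlk vJ)) (wp inp (Do (VAdd vBJ vBJ vBJ)) G)))) (tick 2 s2)"
        using 4 i ready_registers[OF r] by (simp add: acc at_position_def next_pos_def)
    qed
  next
    case (5 s2)
    then show ?case
      by (simp add: atLeastLessThanSuc_atLeastAtMost)
  qed (use s1 in auto)
  then show ?thesis
    using assms by (simp add: fill_table_def table_def)
qed

end

section \<open>Enumerating all choices with a binary counter\<close>

lemma digits_eq:
  assumes "p * m + q = p' * m + (q' :: nat)" "q < m" "q' < m"
  shows "p = p' \<and> q = q'"
proof -
  have "(p * m + q) div m = p" "(p * m + q) mod m = q" "(p' * m + q') div m = p'" "(p' * m + q') mod m = q'"
    using assms(2,3) by auto
  then show ?thesis
    using assms(1) by metis
qed

text \<open>Adding 1 clears the run of ones below the lowest zero and sets that zero. Halving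
  removes one digit of the run per induction step.\<close>

lemma bit_Suc_carry:
  fixes m :: nat
  assumes "\<And>i. i < j \<Longrightarrow> bit m i" "\<not> bit m j"
  shows "bit (Suc m) i \<longleftrightarrow> (if i < j then False else if i = j then True else bit m i)"
  using assms
proof (induction j arbitrary: m i)
  case 0
  then have "even m"
    by (simp add: bit_0)
  then have "Suc m div 2 = m div 2"
    by presburger
  then show ?case
    using \<open>even m\<close> by (cases i) (simp_all add: bit_0 bit_Suc)
next
  case (Suc j)
  have "odd m"
    using Suc.prems(1)[of 0] by (simp add: bit_0)
  then have half: "Suc m div 2 = Suc (m div 2)" "even (Suc m)"
    by presburger+
  have "bit (Suc (m div 2)) l \<longleftrightarrow> (if l < j then False else if l = j then True else bit (m div 2) l)" for l
    by (rule Suc.IH) (use Suc.prems in \<open>auto simp flip: bit_Suc\<close>)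
  then show ?case
    using half by (cases i) (simp_all add: bit_0 bit_Suc)
qed

lemma bit_imp_ge: "bit (m :: nat) k \<Longrightarrow> 2 ^ k \<le> m"
  by (metis bit_take_bit_iff less_irrefl not_le_imp_less take_bit_nat_eq_self_iff)

context tspvr_decomposed
begin

text \<open>Block \<open>c\<close> is governed by binary digit \<open>c - 1\<close>, and block 0
  always by \<open>False\<close>.\<close>

definition bits :: "nat \<Rightarrow> nat \<Rightarrow> bool" where
  "bits m c \<longleftrightarrow> 1 \<le> c \<and> bit m (c - 1)"

definition assignment_cost :: "(nat \<Rightarrow> bool) \<Rightarrow> real" where
  "assignment_cost b = (\<Sum>i\<in>{1..n}. pos_weight i (b (B i)) (b (B (next_pos n i))))"

lemma cell_eq_iff:
  assumes "i \<in> {1..n}" "u \<le> k" "v \<le> k"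
  shows "cell i a b = (2 * u + of_bool x) * stride + (2 * v + of_bool y) \<longleftrightarrow>
    u = B i \<and> v = B (next_pos n i) \<and> a = x \<and> b = y"
proof
  have lt: "2 * B (next_pos n i) + of_bool b < stride" "2 * v + of_bool y < stride"
    using block_range(1)[OF next_pos_range[OF assms(1)]] assms(3) k_le_n by (auto simp: stride_def)
  assume "cell i a b = (2 * u + of_bool x) * stride + (2 * v + of_bool y)"
  then have "2 * B i + of_bool a = 2 * u + of_bool x \<and>
      2 * B (next_pos n i) + of_bool b = 2 * v + of_bool y"
    unfolding cell_def by (rule digits_eq[OF _ lt])
  then show "u = B i \<and> v = B (next_pos n i) \<and> a = x \<and> b = y"
    by (cases a; cases b; cases x; cases y; simp; presburger)
qed (simp add: cell_def)

text \<open>For fixed bits \<open>b\<close>, each position contributes to exactly one of the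
  selected cells: the one given by its own block, the block of its successor and the bits of both.
  Interchanging the sums collects the cost position by position.\<close>

lemma table_total:
  assumes "table ({1..n} \<times> UNIV) s"
  shows "(\<Sum>u\<in>{..k}. \<Sum>v\<in>{..k}. warr s ((2 * u + of_bool (b u)) * stride + (2 * v + of_bool (b v)))) =
    assignment_cost b"
proof -
  let ?z = "\<lambda>u v. (2 * u + of_bool (b u)) * stride + (2 * v + of_bool (b v))"
  let ?Z = "{1..n} \<times> (UNIV :: (bool \<times> bool) set)"
  have "(\<Sum>u\<in>{..k}. \<Sum>v\<in>{..k}. warr s (?z u v)) =
      (\<Sum>u\<in>{..k}. \<Sum>v\<in>{..k}. \<Sum>(i, x, y)\<in>?Z. if cell i x y = ?z u v then pos_weight i x y else 0)"
    using assms by (simp add: table_def)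
  also have "\<dots> = (\<Sum>u\<in>{..k}. \<Sum>v\<in>{..k}. \<Sum>(i, x, y)\<in>?Z.
      if u = B i \<and> v = B (next_pos n i) \<and> x = b u \<and> y = b v then pos_weight i x y else 0)"
  proof (intro sum.cong refl, clarify)
    fix u v i x y
    assume "u \<le> k" "v \<le> k" "i \<in> {1..n}"
    then show "(if cell i x y = ?z u v then pos_weight i x y else 0) =
        (if u = B i \<and> v = B (next_pos n i) \<and> x = b u \<and> y = b v then pos_weight i x y else 0)"
      by (subst cell_eq_iff) auto
  qed
  also have "\<dots> = (\<Sum>u\<in>{..k}. \<Sum>(i, x, y)\<in>?Z. \<Sum>v\<in>{..k}.
      if u = B i \<and> v = B (next_pos n i) \<and> x = b u \<and> y = b v then pos_weight i x y else 0)"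
    by (subst sum.swap) (simp add: case_prod_unfold)
  also have "\<dots> = (\<Sum>(i, x, y)\<in>?Z. \<Sum>u\<in>{..k}. \<Sum>v\<in>{..k}.
      if u = B i \<and> v = B (next_pos n i) \<and> x = b u \<and> y = b v then pos_weight i x y else 0)"
    by (subst sum.swap) (simp add: case_prod_unfold)
  also have "\<dots> = (\<Sum>(i, x, y)\<in>?Z.
      if x = b (B i) \<and> y = b (B (next_pos n i)) then pos_weight i x y else 0)"
  proof (intro sum.cong refl, clarify)
    fix i x y assume i: "i \<in> {1..n}"
    have le: "B i \<le> k" "B (next_pos n i) \<le> k"
      using block_range(1) i next_pos_range by blast+
    have "(\<Sum>u\<in>{..k}. \<Sum>v\<in>{..k}.
        if u = B i \<and> v = B (next_pos n i) \<and> x = b u \<and> y = b v then pos_weight i x y else 0) =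
      (\<Sum>u\<in>{..k}. \<Sum>v\<in>{..k}. if v = B (next_pos n i) then
        (if u = B i \<and> x = b (B i) \<and> y = b (B (next_pos n i)) then pos_weight i x y else 0) else 0)"
      by (intro sum.cong refl) auto
    also have "\<dots> = (\<Sum>u\<in>{..k}. if u = B i then
        (if x = b (B i) \<and> y = b (B (next_pos n i)) then pos_weight i x y else 0) else 0)"
      using le by (intro sum.cong refl) simp
    also have "\<dots> = (if x = b (B i) \<and> y = b (B (next_pos n i)) then pos_weight i x y else 0)"
      using le by simp
    finally show "(\<Sum>u\<in>{..k}. \<Sum>v\<in>{..k}.
        if u = B i \<and> v = B (next_pos n i) \<and> x = b u \<and> y = b v then pos_weight i x y else 0) =
      (if x = b (B i) \<and> y = b (B (next_pos n i)) then pos_weight i x y else 0)" .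
  qed
  also have "\<dots> = (\<Sum>i\<in>{1..n}. \<Sum>(x, y)\<in>UNIV.
      if x = b (B i) \<and> y = b (B (next_pos n i)) then pos_weight i x y else 0)"
    by (subst sum.cartesian_product) (simp add: case_prod_unfold)
  also have "\<dots> = assignment_cost b"
    unfolding assignment_cost_def
  proof (intro sum.cong refl)
    fix i
    have "(\<Sum>(x, y)\<in>UNIV. if x = b (B i) \<and> y = b (B (next_pos n i)) then pos_weight i x y else 0) =
      (\<Sum>p\<in>UNIV. if p = (b (B i), b (B (next_pos n i))) then
        pos_weight i (b (B i)) (b (B (next_pos n i))) else 0)"
    proof (rule sum.cong[OF refl], clarify)
      fix x y
      show "(if x = b (B i) \<and> y = b (B (next_pos n i)) then pos_weight i x y else 0) =
        (if (x, y) = (b (B i), b (B (next_pos n i))) then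
          pos_weight i (b (B i)) (b (B (next_pos n i))) else 0)"
        by (cases "x = b (B i)"; cases "y = b (B (next_pos n i))") simp_all
    qed
    then show "(\<Sum>(x, y)\<in>UNIV. if x = b (B i) \<and> y = b (B (next_pos n i)) then pos_weight i x y else 0) =
      pos_weight i (b (B i)) (b (B (next_pos n i)))"
      by simp
  qed
  finally show ?thesis .
qed

text \<open>
  Entry \<open>Suc k\<close> is a sentinel: it stops every carry, and it is set exactly when all \<open>2 ^ k\<close> values
  are exhausted. Block 0 consists of the forced positions; its bit is always 0.
\<close>

definition counter :: "nat \<Rightarrow> state \<Rightarrow> bool" where
  "counter m s \<longleftrightarrow> (\<forall>c\<le>Suc k. narr s aCur c = 2 * c + of_bool (bits m c))"

lemma counter_simps [simp]:
  "counter m (tick t s) = counter m s" "counter m (set_nvar d v s) = counter m s"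
  "a \<noteq> aCur \<Longrightarrow> counter m (set_narr a i v s) = counter m s"
  "counter m (set_wvar d w s) = counter m s"
  by (simp_all add: counter_def)

definition prepared :: "state \<Rightarrow> bool" where
  "prepared s \<longleftrightarrow> ready s \<and> offsets s \<and> table ({1..n} \<times> UNIV) s \<and> nvar s vK1 = Suc k"

lemma prepared_simps [simp]:
  "prepared (tick t s) = prepared s"
  "d \<notin> {vN, vN1, vOne, vTwo, vFour, vZero, vK, vK1} \<Longrightarrow> prepared (set_nvar d v s) = prepared s"
  "a \<in> {aCur, aBst} \<Longrightarrow> prepared (set_narr a i v s) = prepared s"
  "prepared (set_wvar d w s) = prepared s"
  by (auto simp add: prepared_def)

lemma wp_init_counter:
  assumes "ready s" "offsets s" "nvar s vFlag = 0" "table ({1..n} \<times> UNIV) s"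
  shows "wp inp init_counter (\<lambda>s'. prepared s' \<and> nvar s' vFlag = 0 \<and> counter 0 s' \<and>
    clock s' \<le> clock s + 11 * n + 40) s"
proof -
  have "wp inp (While (TLess vP vK2) (Do (Put aCur vP vD) ;; Do (VAdd vD vD vTwo) ;; Do (VAdd vP vP vOne)))
    (\<lambda>s'. prepared s' \<and> nvar s' vFlag = 0 \<and> counter 0 s' \<and> clock s' \<le> clock s + 11 * n + 40) s1"
    if "prepared s1" "nvar s1 vFlag = 0" "nvar s1 vK2 = Suc (Suc k)" "nvar s1 vP = 0" "nvar s1 vD = 0"
      "clock s1 = clock s + 4" for s1
  proof (rule wp_count[where h = "Suc (Suc k)" and l = 0 and
        J = "\<lambda>c s'. prepared s' \<and> nvar s' vFlag = 0 \<and> nvar s' vK2 = Suc (Suc k) \<and> nvar s' vP = c \<and>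
          nvar s' vD = 2 * c \<and> (\<forall>d<c. narr s' aCur d = 2 * d) \<and> clock s' = clock s + 4 + 11 * c"],
        goal_cases)
    case (4 c s2)
    then have "ready s2"
      by (simp add: prepared_def)
    then show ?case
      using 4 ready_registers[of s2] by (simp add: less_Suc_eq)
  next
    case (5 s2)
    then show ?case
      using k_le_n by (simp add: counter_def bits_def less_Suc_eq_le)
  qed (use that in auto)
  then show ?thesis
    using assms ready_registers[OF assms(1)] by (simp add: init_counter_def prepared_def)
qed

lemma wp_evaluate_row:
  assumes "prepared s" "counter m s" "nvar s vU = u" "nvar s vO = o'" "nvar s vV = 0"
  shows "wp inp evaluate_row (\<lambda>s'. prepared s' \<and> counter m s' \<and> nvar s' vU = u \<and>
    nvar s' vC = nvar s vC \<and> nvar s' vFlag = nvar s vFlag \<and> wvar s' rBest = wvar s rBest \<and>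
    narr s' = narr s \<and>
    wvar s' rCost = wvar s rCost + (\<Sum>v\<in>{..k}. warr s' (o' + (2 * v + of_bool (bits m v)))) \<and>
    warr s' = warr s \<and> clock s' = clock s + 15 * Suc k + 2) s"
  unfolding evaluate_row_def
proof (rule wp_count[where h = "Suc k" and l = 0 and
      J = "\<lambda>v s'. prepared s' \<and> counter m s' \<and> nvar s' vU = u \<and> nvar s' vO = o' \<and> nvar s' vV = v \<and>
    nvar s' vC = nvar s vC \<and> nvar s' vFlag = nvar s vFlag \<and> wvar s' rBest = wvar s rBest \<and>
    narr s' = narr s \<and>
    wvar s' rCost = wvar s rCost + (\<Sum>v\<in>{..<v}. warr s' (o' + (2 * v + of_bool (bits m v)))) \<and>
    warr s' = warr s \<and> clock s' = clock s + 15 * v"], goal_cases)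
  case (3 v s2)
  then show ?case
    by (simp add: prepared_def)
next
  case (4 v s2)
  then have r: "ready s2" and "counter m s2" "v \<le> Suc k"
    by (simp_all add: prepared_def)
  then have v: "narr s2 aCur v = 2 * v + of_bool (bits m v)"
    unfolding counter_def by blast
  show ?case
    using 4 v ready_registers[OF r] by (simp add: add.commute add.left_commute)
next
  case (5 s2)
  then show ?case
    by (simp add: lessThan_Suc_atMost)
qed (use assms in auto)

lemma wp_evaluate:
  assumes "prepared s" "counter m s"
  shows "wp inp evaluate (\<lambda>s'. prepared s' \<and> counter m s' \<and> nvar s' vFlag = nvar s vFlag \<and>
    wvar s' rBest = wvar s rBest \<and> narr s' = narr s \<and> wvar s' rCost = assignment_cost (bits m) \<and>
    clock s' \<le> clock s + 40 * (k + 1) ^ 2) s"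
proof -
  have "wp inp (While (TLess vU vK1)
       (Do (Get vA aCur vU) ;; Do (Get vO aOff vA) ;; Do (VConst vV 0) ;; evaluate_row ;;
        Do (VAdd vU vU vOne)))
    (\<lambda>s'. prepared s' \<and> counter m s' \<and> nvar s' vFlag = nvar s vFlag \<and>
    wvar s' rBest = wvar s rBest \<and> narr s' = narr s \<and> wvar s' rCost = assignment_cost (bits m) \<and>
    clock s' \<le> clock s + 40 * (k + 1) ^ 2) s1"
    if s1: "prepared s1" "counter m s1" "nvar s1 vFlag = nvar s vFlag" "nvar s1 vU = 0"
      "wvar s1 rBest = wvar s rBest" "narr s1 = narr s" "wvar s1 rCost = 0" "clock s1 = clock s + 2" for s1
  proof (rule wp_count[where h = "Suc k" and l = 0 and
      J = "\<lambda>u s'. prepared s' \<and> counter m s' \<and> nvar s' vU = u \<and> nvar s' vFlag = nvar s vFlag \<and>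
        wvar s' rBest = wvar s rBest \<and> narr s' = narr s \<and>
        wvar s' rCost = (\<Sum>u\<in>{..<u}. \<Sum>v\<in>{..k}.
          warr s' ((2 * u + of_bool (bits m u)) * stride + (2 * v + of_bool (bits m v)))) \<and>
        clock s' = clock s + 2 + (15 * Suc k + 20) * u"], goal_cases)
    case (3 v s2)
    then show ?case
      by (simp add: prepared_def)
  next
    case (4 u s2)
    then have r: "ready s2" and "counter m s2" "u \<le> Suc k"
      by (simp_all add: prepared_def)
    then have u: "narr s2 aCur u = 2 * u + of_bool (bits m u)"
      unfolding counter_def by blast
    have "2 * u + of_bool (bits m u) < stride"
      using 4(2) k_le_n by (auto simp: stride_def)
    then have o': "narr s2 aOff (2 * u + of_bool (bits m u)) = (2 * u + of_bool (bits m u)) * stride"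
      using 4(3) unfolding prepared_def offsets_def by blast
    let ?s3 = "effect inp (VConst vV 0) (effect inp (Get vO aOff vA) (effect inp (Get vA aCur vU) (tick 2 s2)))"
    have s3: "prepared ?s3" "counter m ?s3" "nvar ?s3 vU = u"
        "nvar ?s3 vO = (2 * u + of_bool (bits m u)) * stride" "nvar ?s3 vV = 0"
      using 4 u o' by simp_all
    show ?case
      unfolding wp_Seq wp_Do[of _ _ _ "tick 2 s2"] wp_Do[of _ "Get vO aOff vA"] wp_Do[of _ "VConst vV 0"]
    proof (rule wp_mono[OF wp_evaluate_row[OF s3]], goal_cases)
      case (1 s4)
      then have "ready s4"
        by (simp add: prepared_def)
      then have "nvar s4 vOne = 1"
        by (rule ready_registers)
      then show ?case
        using 1 4 by (simp add: algebra_simps)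
    qed
  next
    case (5 s2)
    \<comment> \<open>With \<open>x = k + 1\<close> the left side is
      \<open>15 * x^2 + 20 * x + 4\<close>, at most \<open>39 * x^2\<close> because
      \<open>x \<ge> 1\<close>.\<close>
    have "2 + (15 * Suc k + 20) * Suc k + 2 \<le> 40 * (k + 1) ^ 2"
      by (simp add: power2_eq_square algebra_simps)
    then have "clock s2 + 2 \<le> clock s + 40 * (k + 1) ^ 2"
      using 5 by simp
    moreover have "wvar s2 rCost = assignment_cost (bits m)"
      using 5 table_total[of s2 "bits m"] by (simp add: prepared_def lessThan_Suc_atMost)
    ultimately show ?case
      using 5 by simp
  qed (use s1 in auto)
  then show ?thesis
    using assms by (simp add: evaluate_def)
qed

definition best_of :: "nat \<Rightarrow> state \<Rightarrow> bool" where
  "best_of m s \<longleftrightarrow> (if m = 0 then nvar s vFlag = 0 else nvar s vFlag = 1 \<and>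
     (\<exists>m0<m. wvar s rBest = assignment_cost (bits m0) \<and>
        (\<forall>c\<le>k. narr s aBst c = 2 * c + of_bool (bits m0 c))) \<and>
     (\<forall>m'<m. wvar s rBest \<le> assignment_cost (bits m')))"

lemma best_of_simps [simp]:
  "best_of m (tick t s) = best_of m s"
  "d \<noteq> vFlag \<Longrightarrow> best_of m (set_nvar d v s) = best_of m s"
  "a \<noteq> aBst \<Longrightarrow> best_of m (set_narr a i v s) = best_of m s"
  "d \<noteq> rBest \<Longrightarrow> best_of m (set_wvar d w s) = best_of m s"
  by (simp_all add: best_of_def)

lemma wp_copy_counter:
  assumes "prepared s" "counter m s" "nvar s vU = 0"
  shows "wp inp copy_counter (\<lambda>s'. prepared s' \<and> counter m s' \<and> nvar s' vFlag = nvar s vFlag \<and>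
    wvar s' = wvar s \<and> (\<forall>c\<le>k. narr s' aBst c = 2 * c + of_bool (bits m c)) \<and>
    clock s' \<le> clock s + 20 * Suc k) s"
  unfolding copy_counter_def
proof (rule wp_count[where h = "Suc k" and l = 0 and
      J = "\<lambda>u s'. prepared s' \<and> counter m s' \<and> nvar s' vU = u \<and> nvar s' vFlag = nvar s vFlag \<and>
    wvar s' = wvar s \<and> (\<forall>c<u. narr s' aBst c = 2 * c + of_bool (bits m c)) \<and>
    clock s' = clock s + 17 * u"], goal_cases)
  case (3 v s2)
  then show ?case
    by (simp add: prepared_def)
next
  case (4 u s2)
  then have r: "ready s2" and "counter m s2" "u \<le> Suc k"
    by (simp_all add: prepared_def)
  then have u: "narr s2 aCur u = 2 * u + of_bool (bits m u)"
    unfolding counter_def by blast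
  show ?case
    using 4 u ready_registers[OF r] by (simp add: less_Suc_eq)
next
  case (5 s2)
  then show ?case
    by (simp add: less_Suc_eq_le)
qed (use assms in auto)

lemma wp_record_best:
  assumes "prepared s" "counter m s" "best_of m s" "wvar s rCost = assignment_cost (bits m)"
  shows "wp inp record_best (\<lambda>s'. prepared s' \<and> counter m s' \<and> best_of (Suc m) s' \<and>
    clock s' \<le> clock s + 20 * k + 40) s"
proof -
  have z: "nvar s vZero = 0"
    using assms(1) ready_registers unfolding prepared_def by blast
  have copy: "wp inp copy_counter (\<lambda>s'. prepared s' \<and> counter m s' \<and> best_of (Suc m) s' \<and>
      clock s' \<le> clock s + 20 * k + 40) s1"
    if s1: "prepared s1" "counter m s1" "nvar s1 vU = 0" "nvar s1 vFlag = 1"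
      "wvar s1 rBest = assignment_cost (bits m)" "clock s1 \<le> clock s + 20"
      and less: "\<And>m'. m' < m \<Longrightarrow> assignment_cost (bits m) \<le> assignment_cost (bits m')" for s1
  proof (rule wp_mono[OF wp_copy_counter[OF s1(1-3)]], goal_cases)
    case (1 s')
    have "best_of (Suc m) s'"
      using 1 s1 less unfolding best_of_def by (auto simp: less_Suc_eq)
    then show ?case
      using 1 s1(6) by simp
  qed
  show ?thesis
  proof (cases "m = 0")
    case True
    then have "nvar s vFlag = 0"
      using assms(3) by (simp add: best_of_def)
    then show ?thesis
      using assms(1,2,4) z True copy by (simp add: record_best_def)
  next
    case False
    then have best: "nvar s vFlag = 1" "\<forall>m'<m. wvar s rBest \<le> assignment_cost (bits m')"
        "\<exists>m0<m. wvar s rBest = assignment_cost (bits m0) \<and>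
          (\<forall>c\<le>k. narr s aBst c = 2 * c + of_bool (bits m0 c))"
      using assms(3) by (auto simp: best_of_def)
    show ?thesis
    proof (cases "wvar s rCost < wvar s rBest")
      case True
      then have "assignment_cost (bits m) \<le> assignment_cost (bits m')" if "m' < m" for m'
        using best(2) that assms(4) by force
      then show ?thesis
        using assms(1,2,4) z True by (auto simp: record_best_def intro!: copy)
    next
      case False
      then have "best_of (Suc m) s"
        using best assms(4) unfolding best_of_def by (auto simp: less_Suc_eq)
      then show ?thesis
        using assms(1,2) z best(1) False by (simp add: record_best_def)
    qed
  qed
qed

lemma wp_carry:
  assumes "prepared s" "counter m s" "m < 2 ^ k" "nvar s vC = 1" "nvar s vD = 2"
    "nvar s vA = narr s aCur 1" "best_of l s"
  shows "wp inp carry (\<lambda>s'. prepared s' \<and> best_of l s' \<and> nvar s' vC \<in> {1..Suc k} \<and>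
    nvar s' vD = 2 * nvar s' vC \<and> (\<forall>c<nvar s' vC. narr s' aCur c = 2 * c) \<and>
    (\<forall>c\<in>{1..<nvar s' vC}. bits m c) \<and> \<not> bits m (nvar s' vC) \<and>
    (\<forall>c\<le>Suc k. nvar s' vC < c \<longrightarrow> narr s' aCur c = 2 * c + of_bool (bits m c)) \<and>
    clock s' \<le> clock s + 20 * Suc k) s"
proof -
  have top: "\<not> bits m (Suc k)"
    using bit_imp_ge[of m k] assms(3) by (auto simp: bits_def)
  show ?thesis
    unfolding carry_def
  proof (rule wp_While[where m = "\<lambda>s. Suc k - nvar s vC" and
      J = "\<lambda>s'. prepared s' \<and> best_of l s' \<and> nvar s' vC \<in> {1..Suc k} \<and>
        nvar s' vD = 2 * nvar s' vC \<and> nvar s' vA = 2 * nvar s' vC + of_bool (bits m (nvar s' vC)) \<and>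
        (\<forall>c<nvar s' vC. narr s' aCur c = 2 * c) \<and> (\<forall>c\<in>{1..<nvar s' vC}. bits m c) \<and>
        (\<forall>c\<le>Suc k. nvar s' vC \<le> c \<longrightarrow> narr s' aCur c = 2 * c + of_bool (bits m c)) \<and>
        clock s' + 20 \<le> clock s + 20 * nvar s' vC"], goal_cases)
    case 1
    have "narr s aCur c = 2 * c + of_bool (bits m c)" if "c \<le> Suc k" for c
      using assms(2) that unfolding counter_def by blast
    moreover have "\<not> bits m 0"
      by (simp add: bits_def)
    ultimately show ?case
      using assms(1,4-7) by simp
  next
    case (2 s2)
    then have "bits m (nvar s2 vC)"
      by (cases "bits m (nvar s2 vC)") auto
    then have ne: "nvar s2 vC \<noteq> Suc k"
      using top by metis
    have r: "ready s2"
      using 2 by (simp add: prepared_def)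
    show ?case
      using 2 ne \<open>bits m (nvar s2 vC)\<close> ready_registers[OF r] by (auto simp: less_Suc_eq)
  next
    case (3 s2)
    then have "\<not> bits m (nvar s2 vC)"
      by (cases "bits m (nvar s2 vC)") auto
    then show ?case
      using 3 by auto
  qed
qed

lemma bits_Suc:
  assumes "\<forall>c\<in>{1..<d}. bits m c" "\<not> bits m d" "1 \<le> d"
  shows "bits (Suc m) c \<longleftrightarrow> (if c < d then False else if c = d then True else bits m c)"
proof (cases c)
  case 0
  then show ?thesis
    using assms(3) by (simp add: bits_def)
next
  case (Suc c')
  have "bit m i" if "i < d - 1" for i
    using assms(1) bspec[of _ _ "Suc i"] that by (force simp: bits_def)
  moreover have "\<not> bit m (d - 1)"
    using assms(2,3) by (simp add: bits_def)
  ultimately show ?thesis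
    using bit_Suc_carry[of "d - 1" m c'] Suc assms(3) by (auto simp: bits_def)
qed

text \<open>The carry is charged its worst case, linear in \<open>k\<close>. This is dominated by
  the quadratic cost of the evaluation in the same round.\<close>

lemma wp_increment:
  assumes "prepared s" "counter m s" "m < 2 ^ k" "best_of l s"
  shows "wp inp increment (\<lambda>s'. prepared s' \<and> counter (Suc m) s' \<and> best_of l s' \<and>
    nvar s' vC \<le> Suc k \<and> (nvar s' vC = Suc k \<longleftrightarrow> Suc m = 2 ^ k) \<and>
    clock s' \<le> clock s + 20 * k + 50) s"
proof -
  let ?s = "effect inp (Get vA aCur vC) (effect inp (VConst vD 2) (effect inp (VConst vC 1) s))"
  have "wp inp carry (\<lambda>s'. prepared s' \<and> best_of l s' \<and> nvar s' vC \<in> {1..Suc k} \<and>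
    nvar s' vD = 2 * nvar s' vC \<and> (\<forall>c<nvar s' vC. narr s' aCur c = 2 * c) \<and>
    (\<forall>c\<in>{1..<nvar s' vC}. bits m c) \<and> \<not> bits m (nvar s' vC) \<and>
    (\<forall>c\<le>Suc k. nvar s' vC < c \<longrightarrow> narr s' aCur c = 2 * c + of_bool (bits m c)) \<and>
    clock s' \<le> clock ?s + 20 * Suc k) ?s"
    by (rule wp_carry) (use assms in simp_all)
  then have "wp inp carry (wp inp (Do (VAdd vD vD vOne) ;; Do (Put aCur vC vD))
    (\<lambda>s'. prepared s' \<and> counter (Suc m) s' \<and> best_of l s' \<and>
    nvar s' vC \<le> Suc k \<and> (nvar s' vC = Suc k \<longleftrightarrow> Suc m = 2 ^ k) \<and>
    clock s' \<le> clock s + 20 * k + 50)) ?s"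
  proof (rule wp_mono, goal_cases)
    case (1 s')
    define d where "d = nvar s' vC"
    have d: "d \<in> {1..Suc k}" "\<forall>c\<in>{1..<d}. bits m c" "\<not> bits m d"
      using 1 unfolding d_def by auto
    have bits: "bits (Suc m) c \<longleftrightarrow> (if c < d then False else if c = d then True else bits m c)" for c
      by (rule bits_Suc) (use d in auto)
    have "d = Suc k \<longleftrightarrow> Suc m = 2 ^ k"
    proof
      assume "d = Suc k"
      then have "bits (Suc m) (Suc k)"
        using bits by simp
      then have "2 ^ k \<le> Suc m"
        using bit_imp_ge[of "Suc m" k] by (simp add: bits_def)
      then show "Suc m = 2 ^ k"
        using assms(3) by simp
    next
      assume "Suc m = 2 ^ k"
      then have "bits (Suc m) (Suc k)"
        by (simp add: bits_def bit_exp_iff)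
      moreover have "\<not> bits m (Suc k)"
        using bit_imp_ge[of m k] assms(3) by (auto simp: bits_def)
      ultimately show "d = Suc k"
        using bits[of "Suc k"] by (auto split: if_splits)
    qed
    moreover have "nvar s' vOne = 1"
      using 1 ready_registers(3) unfolding prepared_def by blast
    ultimately show ?case
      using 1 d bits unfolding counter_def d_def[symmetric] by (auto simp: d_def[symmetric])
  qed
  then show ?thesis
    by (simp only: increment_def wp_Seq wp_Do)
qed

lemma wp_enumerate:
  assumes "prepared s" "counter 0 s" "nvar s vFlag = 0"
  shows "wp inp enumerate (\<lambda>s'. prepared s' \<and> best_of (2 ^ k) s' \<and>
    clock s' \<le> clock s + 180 * 2 ^ k * (k + 1) ^ 2 + 3) s"
proof -
  have "wp inp (While (TLess vC vK1) (evaluate ;; record_best ;; increment))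
    (\<lambda>s'. prepared s' \<and> best_of (2 ^ k) s' \<and> clock s' \<le> clock s + 180 * 2 ^ k * (k + 1) ^ 2 + 3) s1"
    if s1: "prepared s1" "counter 0 s1" "nvar s1 vFlag = 0" "nvar s1 vC = 0" "clock s1 = clock s + 1" for s1
  \<comment> \<open>\<open>m\<close> counts the completed rounds and \<open>v = 2 ^ k - m\<close> is
    the variant. Neither is held in a register.\<close>
  proof (rule wp_While_variant[where v = "2 ^ k" and J = "\<lambda>v s'. \<exists>m. v + m = 2 ^ k \<and> prepared s' \<and> best_of m s' \<and>
        nvar s' vC \<le> Suc k \<and> (nvar s' vC = Suc k \<longleftrightarrow> m = 2 ^ k) \<and> counter m s' \<and>
        clock s' \<le> clock s + 1 + 180 * m * (k + 1) ^ 2"], goal_cases)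
    case 1
    have "(0 :: nat) \<noteq> 2 ^ k"
      by simp
    then show ?case
      using s1 by (intro exI[of _ 0]) (simp add: best_of_def)
  next
    case (2 v s2)
    then obtain m where m: "v + m = 2 ^ k" "prepared s2" "best_of m s2" "nvar s2 vC \<le> Suc k"
        "nvar s2 vC = Suc k \<longleftrightarrow> m = 2 ^ k" "counter m s2"
        "clock s2 \<le> clock s + 1 + 180 * m * (k + 1) ^ 2"
      by blast
    have "nvar s2 vC < Suc k"
      using 2(2) m(2) by (simp add: prepared_def)
    then have "m < 2 ^ k"
      using m(1,5) by (cases "m = 2 ^ k") auto
    show ?case
      unfolding wp_Seq
    proof (rule wp_mono[OF wp_evaluate[of "tick 2 s2" m]], goal_cases)
      case (3 s3)
      then have "best_of m s3"
        using m(3) by (simp add: best_of_def)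
      show ?case
      proof (rule wp_mono[OF wp_record_best[of s3 m]], goal_cases)
        case (5 s4)
        show ?case
        proof (rule wp_mono[OF wp_increment[of s4 m "Suc m"]], goal_cases)
          case (5 s5)
          have "2 + 40 * (k + 1) ^ 2 + (20 * k + 40) + (20 * k + 50) \<le> 180 * (k + 1) ^ 2"
            by (simp add: power2_eq_square algebra_simps)
          moreover have "clock s5 \<le> clock s2 + (2 + 40 * (k + 1) ^ 2 + (20 * k + 40) + (20 * k + 50))"
            using 5 \<open>_ \<and> _ \<and> _ \<and> clock s4 \<le> _\<close> 3 by simp
          ultimately have "clock s5 \<le> clock s + 1 + (180 * m * (k + 1) ^ 2 + 180 * (k + 1) ^ 2)"
            using m(7) by linarith
          then have "clock s5 \<le> clock s + 1 + 180 * Suc m * (k + 1) ^ 2"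
            by (simp add: algebra_simps)
          then show ?case
            using 5 m(1) \<open>m < 2 ^ k\<close> by (intro exI[of _ "v - 1"] conjI exI[of _ "Suc m"]) auto
        qed (use 5 \<open>m < 2 ^ k\<close> in auto)
      qed (use 3 \<open>best_of m s3\<close> in auto)
    qed (use m in auto)
  next
    case (3 v s2)
    then obtain m where m: "v + m = 2 ^ k" "prepared s2" "best_of m s2" "nvar s2 vC \<le> Suc k"
        "nvar s2 vC = Suc k \<longleftrightarrow> m = 2 ^ k"
        "clock s2 \<le> clock s + 1 + 180 * m * (k + 1) ^ 2"
      by blast
    have "m = 2 ^ k"
      using 3(2) m(2,4,5) by (simp add: prepared_def)
    then show ?case
      using m by simp
  qed
  then show ?thesis
    using assms by (simp add: enumerate_def)
qed

lemma wp_write_solution: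
  assumes "prepared s" "\<forall>c\<le>k. narr s aBst c = 2 * c + of_bool (b c)"
  shows "wp inp write_solution (\<lambda>s'. outp s' = map (choice A0 A1 B b) [1..<n + 1] \<and>
    clock s' \<le> clock s + 40 * n + 10) s"
proof -
  have "wp inp (While (TLess vI vN1)
       (Do (Get vC aBlk vI) ;; Do (Get vA aBst vC) ;; Do (VAdd vC vC vC) ;;
        If (TEq vA vC) (Do (Get vB aA0 vI)) (Do (Get vB aA1 vI)) ;;
        Do (Output vB) ;; Do (VAdd vI vI vOne)))
    (\<lambda>s'. outp s' = map (choice A0 A1 B b) [1..<n + 1] \<and> clock s' \<le> clock s + 40 * n + 10) s1"
    if s1: "prepared s1" "narr s1 = narr s" "nvar s1 vI = 1" "clock s1 = clock s + 1" for s1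
  proof (rule wp_count[where h = "Suc n" and l = 1 and
      J = "\<lambda>i s'. constants s' \<and> narr s' = narr s1 \<and> nvar s' vI = i \<and>
        outp s' = map (choice A0 A1 B b) [1..<i] \<and> clock s' + 40 \<le> clock s + 1 + 40 * i"], goal_cases)
    case 1
    then show ?case
      using s1 by (simp add: prepared_def ready_def)
  next
    case (3 i s2)
    then show ?case
      by (simp add: constants_def)
  next
    case (4 i s2)
    then have "B i \<le> k"
      using block_range(1)[of i] by simp
    then have bst: "narr s2 aBst (B i) = 2 * B i + of_bool (b (B i))"
      using 4 s1 assms(2) by simp
    have arr: "narr s2 aBlk = B" "narr s2 aA0 = A0" "narr s2 aA1 = A1"
      using 4 s1(1) ready_registers(8-10)[of s1] by (simp_all add: prepared_def)
    have "nvar s2 vOne = 1"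
      using 4 by (simp add: constants_def)
    moreover have "[1..<Suc i] = [1..<i] @ [i]"
      using 4(1) by simp
    ultimately show ?case
      using 4 bst arr by (simp add: choice_def del: upt_Suc)
  qed (use n_pos in auto)
  then show ?thesis
    using assms by (simp add: write_solution_def)
qed

end

section \<open>Optimality and running time of the whole program\<close>

text \<open>Members of \<open>solutions n R\<close> are arbitrary outside \<open>{1..n}\<close>, so
  that set is infinite once it is nonempty. Extending by the identity gives a finite set that can be
  counted.\<close>

definition restricted_permutations :: "nat \<Rightarrow> (nat \<Rightarrow> nat set) \<Rightarrow> (nat \<Rightarrow> nat) set" where
  "restricted_permutations n R = {f. f permutes {1..n} \<and> (\<forall>i\<in>{1..n}. f i \<in> R i)}"

lemma finite_restricted_permutations [simp]: "finite (restricted_permutations n R)"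
  by (rule finite_subset[OF _ finite_permutations[of "{1..n}"]])
    (auto simp: restricted_permutations_def)

definition tspvr_program :: cmd where
  "tspvr_program =
     load_instance ;; peel ;; trace_cycles ;; fill_offsets ;; fill_table ;; init_counter ;;
     enumerate ;; write_solution"

lemma exists_bits:
  "\<exists>m<2 ^ k. \<forall>j<k. bit (m :: nat) j \<longleftrightarrow> b j"
proof (intro exI conjI allI impI)
  let ?m = "horner_sum of_bool 2 (map b [0..<k]) :: nat"
  show "?m < 2 ^ k"
    using horner_sum_of_bool_2_less[of "map b [0..<k]"] by simp
  show "bit ?m j \<longleftrightarrow> b j" if "j < k" for j
    using that by (simp add: bit_horner_sum_bit_iff)
qed

text \<open>For \<open>2 \<le> n\<close> cyclic neighbours are distinct positions and so get
  distinct vertices, where \<open>arc_weight\<close> agrees with \<open>\<rho>\<close>. For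
  \<open>n = 1\<close> the tour consists of a loop, whose weight the input does not contain.\<close>

lemma tour_cost_eq_sum:
  assumes "bij_betw f {1..n} {1..n}" "2 \<le> n"
  shows "tour_cost n \<rho> f = (\<Sum>i\<in>{1..n}. arc_weight \<rho> (f i) (f (next_pos n i)))"
proof -
  have inj: "inj_on f {1..n}"
    using assms(1) by (simp add: bij_betw_def)
  have arc: "arc_weight \<rho> (f i) (f (next_pos n i)) = \<rho> (f i) (f (next_pos n i))" if "i \<in> {1..n}" for i
  proof -
    have "next_pos n i \<in> {1..n}" "next_pos n i \<noteq> i"
      using that assms(2) by (auto simp: next_pos_def)
    then have "f i \<noteq> f (next_pos n i)"
      using inj that by (metis inj_onD)
    then show ?thesis
      by (simp add: arc_weight_def)
  qed
  have "{1..n} = insert n {1..n - 1}" "n \<notin> {1..n - 1}"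
    using assms(2) by auto
  then have "(\<Sum>i\<in>{1..n}. \<rho> (f i) (f (next_pos n i))) =
      \<rho> (f n) (f (next_pos n n)) + (\<Sum>i\<in>{1..n - 1}. \<rho> (f i) (f (next_pos n i)))"
    by simp
  also have "(\<Sum>i\<in>{1..n - 1}. \<rho> (f i) (f (next_pos n i))) = (\<Sum>i\<in>{1..n - 1}. \<rho> (f i) (f (i + 1)))"
    by (intro sum.cong) (auto simp: next_pos_def)
  finally have "(\<Sum>i\<in>{1..n}. \<rho> (f i) (f (next_pos n i))) = tour_cost n \<rho> f"
    by (simp add: tour_cost_def next_pos_def)
  then show ?thesis
    using arc by simp
qed

context tspvr_decomposed
begin

lemma assignment_cost_choice:
  "assignment_cost b =
     (\<Sum>i\<in>{1..n}. arc_weight \<rho> (choice A0 A1 B b i) (choice A0 A1 B b (next_pos n i)))"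
  by (simp add: assignment_cost_def pos_weight_def select_def choice_def)

lemma optimal_choice:
  assumes "\<And>m. m < 2 ^ k \<Longrightarrow> assignment_cost b \<le> assignment_cost (bits m)"
  shows "optimal n R \<rho> (choice A0 A1 B b)"
  unfolding optimal_def is_arg_min_def
proof (intro conjI notI)
  let ?f = "choice A0 A1 B b"
  show f: "?f \<in> solutions n R"
    by (rule choice_in_solutions[OF decomposed])
  assume "\<exists>g. g \<in> solutions n R \<and> tour_cost n \<rho> g < tour_cost n \<rho> ?f"
  then obtain g where g: "g \<in> solutions n R" "tour_cost n \<rho> g < tour_cost n \<rho> ?f"
    by blast
  have bij: "bij_betw ?f {1..n} {1..n}" "bij_betw g {1..n} {1..n}"
    using f g(1) by (simp_all add: solutions_def)
  show False
  proof (cases "2 \<le> n")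
    case True
    obtain b' where b': "\<And>i. i \<in> {1..n} \<Longrightarrow> g i = choice A0 A1 B b' i"
      using solutions_are_choices[OF decomposed g(1)] by blast
    obtain m :: nat where m: "m < 2 ^ k" "\<forall>j<k. bit m j \<longleftrightarrow> b' (Suc j)"
      using exists_bits[of k "\<lambda>j. b' (Suc j)"] by blast
    have same: "g i = choice A0 A1 B (bits m) i" if i: "i \<in> {1..n}" for i
    proof (cases "i \<in> F")
      case True
      then show ?thesis
        using b'[OF i] decomposed unfolding decomposed_def choice_def by auto
    next
      case False
      then have "B i \<in> {1..k}"
        using decomposed i unfolding decomposed_def resolved_def by blast
      then have "bits m (B i) \<longleftrightarrow> b' (B i)"
        using m(2)[rule_format, of "B i - 1"] by (auto simp: bits_def)
      then show ?thesis
        using b'[OF i] by (simp add: choice_def)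
    qed
    have "tour_cost n \<rho> g = assignment_cost (bits m)"
      unfolding tour_cost_eq_sum[OF bij(2) True] assignment_cost_choice
      using same next_pos_range by (intro sum.cong) auto
    moreover have "tour_cost n \<rho> ?f = assignment_cost b"
      unfolding tour_cost_eq_sum[OF bij(1) True] assignment_cost_choice ..
    ultimately show False
      using g(2) assms[OF m(1)] by simp
  next
    \<comment> \<open>Here \<open>n = 1\<close>: all solutions agree at the only position, so their
      costs coincide, whatever the weight of the loop.\<close>
    case False
    then have "n = 1"
      using n_pos by simp
    then have "?f 1 = 1" "g 1 = 1"
      using bij by (auto simp: bij_betw_def)
    then show False
      using g(2) \<open>n = 1\<close> by (simp add: tour_cost_def)
  qed
qed

text \<open>Turns a bound on the number of solutions, which the counting part supplies, into a bound
  on the search time.\<close>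

lemma two_power_le_card: "2 ^ k \<le> card (restricted_permutations n R)"
proof -
  define h where "h S i = (if i \<in> {1..n} then choice A0 A1 B (\<lambda>c. c \<in> S) i else i)" for S i
  have "h S \<in> restricted_permutations n R" for S
  proof -
    have c: "choice A0 A1 B (\<lambda>c. c \<in> S) \<in> solutions n R"
      by (rule choice_in_solutions[OF decomposed])
    then have "bij_betw (h S) {1..n} {1..n}"
      unfolding solutions_def by (subst bij_betw_cong[where g = "choice A0 A1 B (\<lambda>c. c \<in> S)"])
        (auto simp: h_def)
    then have "h S permutes {1..n}"
      by (rule bij_imp_permutes) (auto simp: h_def)
    then show ?thesis
      using c by (auto simp: restricted_permutations_def solutions_def h_def)
  qed
  then have "h ` Pow {1..k} \<subseteq> restricted_permutations n R"
    by blast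
  then have "card (h ` Pow {1..k}) \<le> card (restricted_permutations n R)"
    by (intro card_mono) auto
  moreover have "inj_on h (Pow {1..k})"
  proof (rule inj_onI)
    fix S T assume ST: "S \<in> Pow {1..k}" "T \<in> Pow {1..k}" "h S = h T"
    have "choice A0 A1 B (\<lambda>c. c \<in> S) i = choice A0 A1 B (\<lambda>c. c \<in> T) i" if "i \<in> {1..n}" for i
      using fun_cong[OF ST(3), of i] that by (simp add: h_def)
    then have "c \<in> S \<longleftrightarrow> c \<in> T" if "c \<in> {1..k}" for c
      using choices_distinct[OF decomposed _ that, of "\<lambda>c. c \<in> S" "\<lambda>c. c \<in> T"] by blast
    then show "S = T"
      using ST by blast
  qed
  ultimately show ?thesis
    by (simp add: card_image card_Pow)
qed

lemma wp_search:
  assumes "ready s" "nvar s vFlag = 0" "warr s = (\<lambda>_. 0)"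
  shows "wp inp (fill_offsets ;; fill_table ;; init_counter ;; enumerate ;; write_solution)
    (\<lambda>s'. (\<exists>f. optimal n R \<rho> f \<and> outp s' = map f [1..<n + 1]) \<and>
      clock s' \<le> clock s + 400 * n + 100 + 180 * 2 ^ k * (k + 1) ^ 2) s"
  unfolding wp_Seq
proof (rule wp_mono[OF wp_fill_offsets[OF assms]], goal_cases)
  case (1 s1)
  show ?case
  proof (rule wp_mono[OF wp_fill_table[of s1]], goal_cases)
    case (5 s2)
    show ?case
    proof (rule wp_mono[OF wp_init_counter[of s2]], goal_cases)
      case (5 s3)
      show ?case
      proof (rule wp_mono[OF wp_enumerate[of s3]], goal_cases)
        case (4 s4)
        then obtain m0 where m0: "m0 < 2 ^ k" "wvar s4 rBest = assignment_cost (bits m0)"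
            "\<forall>c\<le>k. narr s4 aBst c = 2 * c + of_bool (bits m0 c)"
            "\<forall>m'<2 ^ k. wvar s4 rBest \<le> assignment_cost (bits m')"
          unfolding best_of_def by (auto split: if_splits)
        have clock: "clock s4 + (40 * n + 10) \<le> clock s + 400 * n + 100 + 180 * 2 ^ k * (k + 1) ^ 2"
          using 1 4 \<open>_ \<and> _ \<and> _ \<and> clock s3 \<le> _\<close> \<open>_ \<and> _ \<and> _ \<and> _ \<and> clock s2 \<le> _\<close> by simp
        have opt: "optimal n R \<rho> (choice A0 A1 B (bits m0))"
          by (rule optimal_choice) (use m0 in auto)
        show ?case
        proof (rule wp_mono[OF wp_write_solution[of s4 "bits m0"]], goal_cases)
          case (3 s5)
          then show ?case
            using opt clock by auto
        qed (use 4 m0 in auto)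
      qed (use 5 in auto)
    qed (use 5 in auto)
  qed (use 1 in auto)
qed

end

context tspvr
begin

theorem wp_tspvr_program:
  "wp inp tspvr_program (\<lambda>s. \<exists>k. (\<exists>f. optimal n R \<rho> f \<and> outp s = map f [1..<n + 1]) \<and>
     2 ^ k \<le> card (restricted_permutations n R) \<and>
     clock s \<le> 700 * n + 300 + 180 * 2 ^ k * (k + 1) ^ 2) start"
  unfolding tspvr_program_def wp_Seq[of _ load_instance] wp_Seq[of _ peel] wp_Seq[of _ trace_cycles]
proof (rule wp_mono[OF wp_load_instance], goal_cases)
  case (1 s1)
  show ?case
  proof (rule wp_mono[OF wp_peel[of s1]], goal_cases)
    case (2 s2)
    interpret residual: tspvr_residual n R \<rho> "assigned s2" "narr s2 aA0"
    proof unfold_locales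
      show "peeled (assigned s2) (narr s2 aA0)"
        using 2 by (simp add: peeling_def)
      show "\<forall>x\<in>{1..n}. card (incident (assigned s2) x) \<noteq> 1"
        using 2 by blast
      show "narr s2 aA0 i \<noteq> 0" if "i \<in> assigned s2" for i
        using that by (simp add: assigned_def)
    qed
    have s2: "residual.forced_fixed s2" "nvar s2 vK = 0"
      using 2 by (simp_all add: peeling_def residual.forced_fixed_def)
    show ?case
    proof (rule wp_mono[OF residual.wp_trace_cycles[OF s2(1) refl s2(2)]], goal_cases)
      case (1 s3)
      let ?k = "nvar s3 vK"
      interpret dec: tspvr_decomposed n R \<rho> "assigned s2" "narr s2 aA0" "nvar s3 vK" "narr s3 aA0"
        "narr s3 aA1" "narr s3 aBlk"
        by unfold_locales (use 1 in blast)
      have s3: "dec.ready s3" "nvar s3 vFlag = 0" "warr s3 = (\<lambda>_. 0)"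
        using 1 by (simp_all add: residual.forced_fixed_def dec.ready_def untouched_def)
      show ?case
      proof (rule wp_mono[OF dec.wp_search[OF s3]], goal_cases)
        case (1 s4)
        then show ?case
          using dec.two_power_le_card 2 \<open>loaded (Suc n) s1 \<and> _\<close> \<open>_ \<and> _ \<and> clock s3 \<le> _\<close>
          by (intro exI[of _ ?k]) auto
      qed
    qed
  qed (use 1 in auto)
qed

end

lemma wf_tspvr_program: "wf_cmd tspvr_program"
  by (simp add: tspvr_program_def load_instance_def load_one_def link_def peel_def peel_step_def
      trace_cycles_def visit_def fill_offsets_def fill_table_def accumulate_def init_counter_def
      enumerate_def evaluate_def evaluate_row_def record_best_def copy_counter_def increment_def
      carry_def write_solution_def)

theorem tspvr_program_solves:
  assumes "requisitions n R" "feasible n R"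
  obtains t k where "solves_within (compile 0 tspvr_program) n R \<rho> t"
    "2 ^ k \<le> card (restricted_permutations n R)" "t \<le> 700 * n + 300 + 180 * 2 ^ k * (k + 1) ^ 2"
proof -
  interpret tspvr n R \<rho>
    by unfold_locales (use assms in auto)
  show ?thesis
  proof (rule compile_run[OF wf_tspvr_program wp_tspvr_program])
    fix s
    assume "\<exists>k. (\<exists>f. optimal n R \<rho> f \<and> outp s = map f [1..<n + 1]) \<and>
        2 ^ k \<le> card (restricted_permutations n R) \<and>
        clock s \<le> 700 * n + 300 + 180 * 2 ^ k * (k + 1) ^ 2"
      and "halted (compile 0 tspvr_program) (run (compile 0 tspvr_program) inp (clock s))"
        "printed (run (compile 0 tspvr_program) inp (clock s)) = outp s"
    then show thesis
      using that unfolding solves_within_def by metis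
  qed
qed

section \<open>Counting feasible requisitions\<close>

definition requisition_sets :: "nat \<Rightarrow> nat set set" where
  "requisition_sets n = {S. S \<subseteq> {1..n} \<and> 1 \<le> card S \<and> card S \<le> 2}"

text \<open>Families are extensional outside \<open>{1..n}\<close>, so that they correspond
  one-to-one to bipartite graphs.\<close>

definition all_requisitions :: "nat \<Rightarrow> (nat \<Rightarrow> nat set) set" where
  "all_requisitions n = (\<Pi>\<^sub>E i\<in>{1..n}. requisition_sets n)"

lemma finite_requisition_sets [simp]: "finite (requisition_sets n)"
  by (rule finite_subset[of _ "Pow {1..n}"]) (auto simp: requisition_sets_def)

lemma finite_all_requisitions [simp]: "finite (all_requisitions n)"
  by (simp add: all_requisitions_def finite_PiE)

text \<open>Sending \<open>y\<close> to \<open>{x, y}\<close> is a bijection from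
  \<open>{1..n}\<close>, with \<open>y = x\<close> giving the singleton. The powers of
  \<open>n\<close> in both moments stem from this exact count.\<close>

lemma card_requisition_sets_containing:
  assumes "x \<in> {1..n}"
  shows "card {S \<in> requisition_sets n. x \<in> S} = n"
proof -
  have "{S \<in> requisition_sets n. x \<in> S} = (\<lambda>y. {x, y}) ` {1..n}"
  proof (intro equalityI subsetI)
    fix S assume S: "S \<in> {S \<in> requisition_sets n. x \<in> S}"
    then have fin: "finite S" and sub: "S \<subseteq> {1..n}" "x \<in> S" "card S \<le> 2"
      using finite_subset[of S "{1..n}"] by (auto simp: requisition_sets_def)
    then have "card (S - {x}) \<le> 1"
      by simp
    then consider "S - {x} = {}" | y where "S - {x} = {y}"
      using fin by (metis One_nat_def card_0_eq card_1_singletonE finite_Diff le_SucE le_zero_eq)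
    then show "S \<in> (\<lambda>y. {x, y}) ` {1..n}"
    proof cases
      case 1
      then have "S = {x, x}"
        using sub by auto
      then show ?thesis
        using assms by blast
    next
      case (2 y)
      then have "S = {x, y}" "y \<in> {1..n}"
        using sub by auto
      then show ?thesis
        by blast
    qed
  next
    fix S assume "S \<in> (\<lambda>y. {x, y}) ` {1..n}"
    then show "S \<in> {S \<in> requisition_sets n. x \<in> S}"
      using assms by (auto simp: requisition_sets_def card_insert_if)
  qed
  moreover have "inj_on (\<lambda>y. {x, y}) {1..n}"
    by (auto simp: inj_on_def doubleton_eq_iff)
  ultimately show ?thesis
    by (simp add: card_image)
qed

lemma card_requisition_sets_two:
  assumes "x \<in> {1..n}" "y \<in> {1..n}" "x \<noteq> y"
  shows "card {S \<in> requisition_sets n. x \<in> S \<and> y \<in> S} = 1"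
proof -
  have "{S \<in> requisition_sets n. x \<in> S \<and> y \<in> S} = {{x, y}}"
  proof (intro equalityI subsetI)
    fix S assume S: "S \<in> {S \<in> requisition_sets n. x \<in> S \<and> y \<in> S}"
    then have "finite S" "{x, y} \<subseteq> S" "card S \<le> card {x, y}"
      using finite_subset[of S "{1..n}"] assms(3) by (auto simp: requisition_sets_def)
    then have "{x, y} = S"
      by (intro card_seteq)
    then show "S \<in> {{x, y}}"
      by simp
  qed (use assms in \<open>auto simp: requisition_sets_def\<close>)
  then show ?thesis
    by simp
qed

definition fixed_points :: "nat \<Rightarrow> (nat \<Rightarrow> nat) \<Rightarrow> nat set" where
  "fixed_points n f = {i \<in> {1..n}. f i = i}"

lemma card_requisitions_through:
  assumes "f permutes {1..n}"
  shows "card {R \<in> all_requisitions n. f \<in> restricted_permutations n R} = n ^ n"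
proof -
  have "{R \<in> all_requisitions n. f \<in> restricted_permutations n R} =
      (\<Pi>\<^sub>E i\<in>{1..n}. {S \<in> requisition_sets n. f i \<in> S})"
    using assms by (auto simp: all_requisitions_def restricted_permutations_def PiE_def Pi_def)
  then have "card {R \<in> all_requisitions n. f \<in> restricted_permutations n R} =
      (\<Prod>i\<in>{1..n}. card {S \<in> requisition_sets n. f i \<in> S})"
    by (simp add: card_PiE)
  also have "\<dots> = (\<Prod>i\<in>{1..n}. n)"
    using permutes_in_image[OF assms] by (intro prod.cong refl card_requisition_sets_containing) blast
  finally show ?thesis
    by simp
qed

text \<open>The requisitions are chosen independently: where \<open>f\<close> and \<open>g\<close>
  agree there are \<open>n\<close> sets, elsewhere both values are prescribed and only one set
  remains. The places of agreement are the fixed points of \<open>inv f \<circ> g\<close>.\<close>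

lemma card_requisitions_through_two:
  assumes "f permutes {1..n}" "g permutes {1..n}"
  shows "card {R \<in> all_requisitions n. f \<in> restricted_permutations n R \<and> g \<in> restricted_permutations n R} =
    n ^ card (fixed_points n (inv f \<circ> g))"
proof -
  have agree: "f i = g i \<longleftrightarrow> (inv f \<circ> g) i = i" for i
    using permutes_inv_eq[OF assms(1)] by (metis comp_apply)
  have "{R \<in> all_requisitions n. f \<in> restricted_permutations n R \<and> g \<in> restricted_permutations n R} =
      (\<Pi>\<^sub>E i\<in>{1..n}. {S \<in> requisition_sets n. f i \<in> S \<and> g i \<in> S})"
    using assms by (auto simp: all_requisitions_def restricted_permutations_def PiE_def Pi_def)
  then have "card {R \<in> all_requisitions n. f \<in> restricted_permutations n R \<and> g \<in> restricted_permutations n R} =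
      (\<Prod>i\<in>{1..n}. card {S \<in> requisition_sets n. f i \<in> S \<and> g i \<in> S})"
    by (simp add: card_PiE)
  also have "\<dots> = (\<Prod>i\<in>{1..n}. if (inv f \<circ> g) i = i then n else 1)"
  proof (intro prod.cong refl)
    fix i assume "i \<in> {1..n}"
    then have "f i \<in> {1..n}" "g i \<in> {1..n}"
      using permutes_in_image[OF assms(1)] permutes_in_image[OF assms(2)] by blast+
    then show "card {S \<in> requisition_sets n. f i \<in> S \<and> g i \<in> S} = (if (inv f \<circ> g) i = i then n else 1)"
      using card_requisition_sets_containing[of "f i" n] card_requisition_sets_two[of "f i" n "g i"]
        agree[of i] by (cases "f i = g i") simp_all
  qed
  also have "\<dots> = n ^ card (fixed_points n (inv f \<circ> g))"
    by (simp add: prod.If_cases fixed_points_def Int_def)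
  finally show ?thesis .
qed

definition moment :: "nat \<Rightarrow> nat" where
  "moment n = (\<Sum>f | f permutes {1..n}. n ^ card (fixed_points n f))"

text \<open>Counting pairs (family, permutation) from the side of the permutations, each of which
  solves \<open>n ^ n\<close> families.\<close>

lemma sum_card_restricted_permutations:
  "(\<Sum>R\<in>all_requisitions n. card (restricted_permutations n R)) = fact n * n ^ n"
proof -
  let ?P = "{f. f permutes {1..n}}"
  have fin: "finite ?P"
    by (simp add: finite_permutations)
  have "(\<Sum>R\<in>all_requisitions n. card (restricted_permutations n R)) =
      (\<Sum>R\<in>all_requisitions n. \<Sum>f\<in>?P. of_bool (f \<in> restricted_permutations n R))"
  proof (intro sum.cong refl)
    fix R
    have "?P \<inter> {f. f \<in> restricted_permutations n R} = restricted_permutations n R"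
      by (auto simp: restricted_permutations_def)
    then show "card (restricted_permutations n R) = (\<Sum>f\<in>?P. of_bool (f \<in> restricted_permutations n R))"
      using fin by (simp add: sum_of_bool_eq)
  qed
  also have "\<dots> = (\<Sum>f\<in>?P. card {R \<in> all_requisitions n. f \<in> restricted_permutations n R})"
    by (subst sum.swap) (simp add: sum_of_bool_eq Int_def)
  also have "\<dots> = (\<Sum>f\<in>?P. n ^ n)"
    by (intro sum.cong refl) (simp add: card_requisitions_through)
  also have "\<dots> = fact n * n ^ n"
    by (simp add: card_permutations)
  finally show ?thesis .
qed

text \<open>The square counts pairs of solutions. For fixed \<open>f\<close>, composing with
  \<open>inv f\<close> permutes the symmetric group, so the inner sum over \<open>g\<close> is the
  same for every \<open>f\<close>.\<close>

lemma sum_card_restricted_permutations_squared: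
  "(\<Sum>R\<in>all_requisitions n. (card (restricted_permutations n R))\<^sup>2) = fact n * moment n"
proof -
  let ?P = "{f. f permutes {1..n}}"
  have fin: "finite ?P"
    by (simp add: finite_permutations)
  have "(\<Sum>R\<in>all_requisitions n. (card (restricted_permutations n R))\<^sup>2) =
      (\<Sum>R\<in>all_requisitions n. \<Sum>f\<in>?P. \<Sum>g\<in>?P.
        of_bool (f \<in> restricted_permutations n R \<and> g \<in> restricted_permutations n R))"
  proof (intro sum.cong refl)
    fix R
    have "?P \<inter> {f. f \<in> restricted_permutations n R} = restricted_permutations n R"
      by (auto simp: restricted_permutations_def)
    then have "card (restricted_permutations n R) = (\<Sum>f\<in>?P. of_bool (f \<in> restricted_permutations n R))"
      using fin by (simp add: sum_of_bool_eq)
    then have "(card (restricted_permutations n R))\<^sup>2 =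
        (\<Sum>f\<in>?P. of_bool (f \<in> restricted_permutations n R)) * (\<Sum>f\<in>?P. of_bool (f \<in> restricted_permutations n R))"
      by (simp add: power2_eq_square)
    also have "\<dots> = (\<Sum>f\<in>?P. \<Sum>g\<in>?P.
        of_bool (f \<in> restricted_permutations n R \<and> g \<in> restricted_permutations n R))"
      by (simp add: sum_product of_bool_conj)
    finally show "(card (restricted_permutations n R))\<^sup>2 = (\<Sum>f\<in>?P. \<Sum>g\<in>?P.
        of_bool (f \<in> restricted_permutations n R \<and> g \<in> restricted_permutations n R))" .
  qed
  also have "\<dots> = (\<Sum>f\<in>?P. \<Sum>R\<in>all_requisitions n. \<Sum>g\<in>?P.
        of_bool (f \<in> restricted_permutations n R \<and> g \<in> restricted_permutations n R))"
    by (rule sum.swap)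
  also have "\<dots> = (\<Sum>f\<in>?P. \<Sum>g\<in>?P. \<Sum>R\<in>all_requisitions n.
        of_bool (f \<in> restricted_permutations n R \<and> g \<in> restricted_permutations n R))"
    by (intro sum.cong refl sum.swap)
  also have "\<dots> = (\<Sum>f\<in>?P. \<Sum>g\<in>?P. n ^ card (fixed_points n (inv f \<circ> g)))"
    by (intro sum.cong refl) (simp add: card_requisitions_through_two[symmetric] sum_of_bool_eq Int_def)
  also have "\<dots> = (\<Sum>f\<in>?P. moment n)"
  proof (intro sum.cong refl)
    fix f assume "f \<in> ?P"
    then have "inv f permutes {1..n}"
      by (simp add: permutes_inv)
    then show "(\<Sum>g\<in>?P. n ^ card (fixed_points n (inv f \<circ> g))) = moment n"
      unfolding moment_def
      using setum_permutations_compose_left[of "inv f" "{1..n}" "\<lambda>f. n ^ card (fixed_points n f)"]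
      by simp
  qed
  also have "\<dots> = fact n * moment n"
    by (simp add: card_permutations)
  finally show ?thesis .
qed

section \<open>Bounding the fixed-point moment\<close>

text \<open>Permutations are grouped by their set \<open>M\<close> of moved points. Those that move
  exactly \<open>M\<close> are derangements of \<open>M\<close>, here bounded by all permutations of
  \<open>M\<close>.\<close>

lemma moment_le:
  "moment n \<le> (\<Sum>m\<le>n. (n choose m) * fact m * n ^ (n - m))"
proof -
  let ?P = "{f. f permutes {1..n}}"
  let ?moved = "\<lambda>f. {i \<in> {1..n}. f i \<noteq> i}"
  have "moment n = (\<Sum>M\<in>Pow {1..n}. \<Sum>f | f permutes {1..n} \<and> ?moved f = M. n ^ card (fixed_points n f))"
    unfolding moment_def
    by (subst sum.group[symmetric, of ?P "Pow {1..n}" ?moved]) (auto simp: finite_permutations)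
  also have "\<dots> \<le> (\<Sum>M\<in>Pow {1..n}. fact (card M) * n ^ (n - card M))"
  proof (rule sum_mono)
    fix M assume M: "M \<in> Pow {1..n}"
    then have finM: "finite M"
      using finite_subset by blast
    have "card (fixed_points n f) = n - card M" if "?moved f = M" for f
    proof -
      have "fixed_points n f = {1..n} - M"
        using that by (auto simp: fixed_points_def)
      then show ?thesis
        using M finM by (simp add: card_Diff_subset)
    qed
    then have "(\<Sum>f | f permutes {1..n} \<and> ?moved f = M. n ^ card (fixed_points n f)) =
        card {f. f permutes {1..n} \<and> ?moved f = M} * n ^ (n - card M)"
      by simp
    also have "card {f. f permutes {1..n} \<and> ?moved f = M} \<le> card {f. f permutes M}"
    proof (rule card_mono)
      show "finite {f. f permutes M}"
        using finM by (rule finite_permutations)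
      show "{f. f permutes {1..n} \<and> ?moved f = M} \<subseteq> {f. f permutes M}"
      proof clarify
        fix f assume f: "f permutes {1..n}"
        show "f permutes ?moved f"
          by (rule permutes_superset[OF f]) auto
      qed
    qed
    also have "\<dots> = fact (card M)"
      using finM by (simp add: card_permutations)
    finally show "(\<Sum>f | f permutes {1..n} \<and> ?moved f = M. n ^ card (fixed_points n f)) \<le>
        fact (card M) * n ^ (n - card M)"
      by simp
  qed
  also have "\<dots> = (\<Sum>m\<le>n. \<Sum>M | M \<in> Pow {1..n} \<and> card M = m. fact (card M) * n ^ (n - card M))"
    by (rule sum.group[symmetric]) (auto intro: card_mono[of "{1..n}", simplified])
  also have "\<dots> = (\<Sum>m\<le>n. (n choose m) * fact m * n ^ (n - m))"
  proof (intro sum.cong refl)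
    fix m
    have "(\<Sum>M | M \<in> Pow {1..n} \<and> card M = m. fact (card M) * n ^ (n - card M)) =
        card {M. M \<subseteq> {1..n} \<and> card M = m} * (fact m * n ^ (n - m))"
      by (simp add: Pow_def)
    then show "(\<Sum>M | M \<in> Pow {1..n} \<and> card M = m. fact (card M) * n ^ (n - card M)) =
        (n choose m) * fact m * n ^ (n - m)"
      using n_subsets[of "{1..n}" m] by simp
  qed
  finally show ?thesis .
qed

text \<open>The birthday probability: \<open>m\<close> independent uniform draws from
  \<open>n\<close> values are pairwise distinct.\<close>

definition falling :: "nat \<Rightarrow> nat \<Rightarrow> real" where
  "falling n m = (\<Prod>j<m. 1 - real j / real n)"

lemma falling_bounds:
  assumes "m \<le> n"
  shows "0 \<le> falling n m \<and> falling n m \<le> 1"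
proof -
  have "0 \<le> 1 - real j / real n \<and> 1 - real j / real n \<le> 1" if "j < m" for j
    using that assms by (simp add: divide_simps)
  then show ?thesis
    unfolding falling_def by (auto intro!: prod_nonneg prod_le_1)
qed

lemma choose_fact_power:
  assumes "m \<le> n" "1 \<le> n"
  shows "real ((n choose m) * fact m * n ^ (n - m)) = real n ^ n * falling n m"
  using assms(1)
proof (induction m)
  case 0
  then show ?case
    by (simp add: falling_def)
next
  case (Suc m)
  have pow: "real n ^ (n - m) = real n * real n ^ (n - Suc m)"
    using Suc.prems by (metis Suc_diff_Suc Suc_le_lessD power_Suc)
  have "(n choose Suc m) * fact (Suc m) = (n - m) * ((n choose m) * fact m)"
    using binomial_absorb_comp[of n m] binomial_absorption[of m n]
    by (metis (no_types, lifting) Suc_times_binomial_eq binomial_absorb_comp fact_Suc mult.assoc mult.commute of_nat_id)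
  then have "real ((n choose Suc m) * fact (Suc m)) = (real n - real m) * real ((n choose m) * fact m)"
    using Suc.prems by (simp add: of_nat_diff)
  then have "real n * real ((n choose Suc m) * fact (Suc m) * n ^ (n - Suc m)) =
      (real n - real m) * real ((n choose m) * fact m * n ^ (n - m))"
    using pow by simp
  also have "\<dots> = (real n - real m) * (real n ^ n * falling n m)"
    using Suc by simp
  also have "\<dots> = real n * (real n ^ n * falling n (Suc m))"
    using assms(2) by (simp add: falling_def field_simps)
  finally show ?case
    using assms(2) by simp
qed

text \<open>The sum is the expected number of draws up to the first repetition. The first
  \<open>T\<close> terms are at most 1 each. The term for \<open>m\<close> times
  \<open>m / n\<close> is the probability that draw \<open>m + 1\<close> is the first repetition;
  these probabilities sum to 1, so the terms with \<open>m \<ge> T\<close> sum to at most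
  \<open>n / T\<close>.\<close>

lemma sum_falling_le:
  assumes "1 \<le> n" "1 \<le> T"
  shows "(\<Sum>m\<le>n. falling n m) \<le> real T + real n / real T"
proof -
  have tele: "falling n m * (real m / real n) = falling n m - falling n (Suc m)" for m
    by (simp add: falling_def algebra_simps)
  have "(\<Sum>m\<in>{..n} - {..<T}. falling n m) \<le> real n / real T"
  proof -
    have "(\<Sum>m\<in>{..n} - {..<T}. falling n m * (real T / real n)) \<le>
        (\<Sum>m\<in>{..n} - {..<T}. falling n m * (real m / real n))"
      using falling_bounds assms by (intro sum_mono mult_left_mono divide_right_mono) auto
    also have "\<dots> = (\<Sum>m\<in>{..n} - {..<T}. falling n m - falling n (Suc m))"
      by (simp only: tele)
    also have "\<dots> \<le> (\<Sum>m\<le>n. falling n m - falling n (Suc m))"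
    proof (rule sum_mono2)
      fix m assume "m \<in> {..n} - ({..n} - {..<T})"
      then show "0 \<le> falling n m - falling n (Suc m)"
        using falling_bounds[of m n] by (simp flip: tele)
    qed auto
    also have "\<dots> = falling n 0 - falling n (Suc n)"
      by (rule sum_telescope)
    \<comment> \<open>The empty product is 1, and the factor with \<open>j = n\<close> makes
      \<open>falling n (Suc n)\<close> vanish.\<close>
    also have "\<dots> = 1"
      using assms by (simp add: falling_def)
    finally have "(\<Sum>m\<in>{..n} - {..<T}. falling n m) * (real T / real n) \<le> 1"
      by (simp only: sum_distrib_right)
    then show ?thesis
      using assms by (simp add: field_simps)
  qed
  moreover have "(\<Sum>m\<in>{..n} \<inter> {..<T}. falling n m) \<le> real T"
  proof -
    have "(\<Sum>m\<in>{..n} \<inter> {..<T}. falling n m) \<le> (\<Sum>m\<in>{..n} \<inter> {..<T}. 1)"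
      using falling_bounds by (intro sum_mono) auto
    also have "\<dots> \<le> real T"
      using card_mono[of "{..<T}" "{..n} \<inter> {..<T}"] by simp
    finally show ?thesis .
  qed
  moreover have "(\<Sum>m\<le>n. falling n m) =
      (\<Sum>m\<in>{..n} \<inter> {..<T}. falling n m) + (\<Sum>m\<in>{..n} - {..<T}. falling n m)"
    by (rule sum.Int_Diff) simp
  ultimately show ?thesis
    by linarith
qed

lemma moment_le_sqrt:
  assumes "1 \<le> n"
  shows "real (moment n) \<le> 3 * sqrt n * real n ^ n"
proof -
  \<comment> \<open>This choice balances \<open>T\<close> and \<open>n / T\<close>. Rounding up adds
    at most 1, hence at most \<open>sqrt n\<close>, which explains the factor 3.\<close>
  define T where "T = nat \<lceil>sqrt n\<rceil>"
  have sq: "1 \<le> sqrt (real n)"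
    using assms by simp
  have T: "sqrt n \<le> real T" "real T \<le> sqrt n + 1"
    unfolding T_def using sq by linarith+
  then have T1: "1 \<le> T"
    using sq by linarith
  have "real n / real T \<le> real n / sqrt n"
    using T sq T1 by (intro divide_left_mono mult_pos_pos) auto
  also have "\<dots> = sqrt n"
    by (simp add: real_div_sqrt)
  finally have "real T + real n / real T \<le> 3 * sqrt n"
    using T sq by linarith
  then have *: "(\<Sum>m\<le>n. falling n m) \<le> 3 * sqrt n"
    using sum_falling_le[OF assms T1] by linarith
  have "real (moment n) \<le> real (\<Sum>m\<le>n. (n choose m) * fact m * n ^ (n - m))"
    using moment_le of_nat_le_iff by blast
  also have "\<dots> = (\<Sum>m\<le>n. real n ^ n * falling n m)"
    unfolding of_nat_sum using assms by (intro sum.cong refl choose_fact_power) auto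
  also have "\<dots> = real n ^ n * (\<Sum>m\<le>n. falling n m)"
    by (simp add: sum_distrib_left)
  also have "\<dots> \<le> real n ^ n * (3 * sqrt n)"
    using * by (intro mult_left_mono) auto
  finally show ?thesis
    by (simp add: mult.commute)
qed

section \<open>Almost all feasible families have few solutions\<close>

definition feasible_requisition_families :: "nat \<Rightarrow> (nat \<Rightarrow> nat set) set" where
  "feasible_requisition_families n = {R \<in> all_requisitions n. restricted_permutations n R \<noteq> {}}"

lemma finite_feasible_requisition_families [simp]: "finite (feasible_requisition_families n)"
  by (simp add: feasible_requisition_families_def)

lemma card_feasible_lower_bound:
  assumes "1 \<le> n"
  shows "fact n * real n ^ n \<le> 3 * sqrt n * card (feasible_requisition_families n)"
proof -
  let ?F = "feasible_requisition_families n"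
  let ?s = "\<lambda>R. card (restricted_permutations n R)"
  define N where "N = fact n * real n ^ n"
  have "0 < N"
    using assms by (simp add: N_def)
  \<comment> \<open>Infeasible families contribute 0, so the moments over all families are those
    over the feasible ones.\<close>
  have sum: "(\<Sum>R\<in>?F. real (?s R)) = N"
  proof -
    have "(\<Sum>R\<in>?F. real (?s R)) = (\<Sum>R\<in>all_requisitions n. real (?s R))"
      by (rule sum.mono_neutral_left) (auto simp: feasible_requisition_families_def)
    also have "\<dots> = N"
      using arg_cong[OF sum_card_restricted_permutations[of n], of real] by (simp add: N_def)
    finally show ?thesis .
  qed
  have sum2: "(\<Sum>R\<in>?F. (real (?s R))\<^sup>2) = fact n * real (moment n)"
  proof -
    have "(\<Sum>R\<in>?F. (real (?s R))\<^sup>2) = (\<Sum>R\<in>all_requisitions n. (real (?s R))\<^sup>2)"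
      by (rule sum.mono_neutral_left) (auto simp: feasible_requisition_families_def)
    also have "\<dots> = fact n * real (moment n)"
      using arg_cong[OF sum_card_restricted_permutations_squared[of n], of real] by simp
    finally show ?thesis .
  qed
  have "N\<^sup>2 \<le> fact n * real (moment n) * card ?F"
    using sum_squared_le_sum_of_squares[of "\<lambda>R. real (?s R)" ?F] unfolding sum sum2 .
  also have "\<dots> \<le> fact n * (3 * sqrt n * real n ^ n) * card ?F"
    using moment_le_sqrt[OF assms] by (intro mult_right_mono mult_left_mono) auto
  also have "\<dots> = N * (3 * sqrt n * card ?F)"
    by (simp add: N_def)
  finally have "N * N \<le> N * (3 * sqrt n * card ?F)"
    by (simp add: power2_eq_square)
  then have "N \<le> 3 * sqrt n * card ?F"
    using \<open>0 < N\<close> by (rule mult_left_le_imp_le)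
  then show ?thesis
    by (simp only: N_def)
qed

text \<open>The inequality says that the number of solutions is at most \<open>n powr (2/3)\<close>,
  in integer arithmetic.\<close>

definition sparse_requisition_families :: "nat \<Rightarrow> (nat \<Rightarrow> nat set) set" where
  "sparse_requisition_families n =
     {R \<in> feasible_requisition_families n. card (restricted_permutations n R) ^ 3 \<le> n\<^sup>2}"

lemma card_sparse_lower_bound:
  assumes "1 \<le> n"
  shows "(1 - 3 * real n powr (-1/6)) * card (feasible_requisition_families n) \<le>
    card (sparse_requisition_families n)"
proof -
  let ?F = "feasible_requisition_families n"
  let ?S = "sparse_requisition_families n"
  let ?s = "\<lambda>R. card (restricted_permutations n R)"
  have n: "0 < real n"
    using assms by simp
  have large: "real n powr (2/3) \<le> real (?s R)" if "R \<in> ?F - ?S" for R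
  proof (rule ccontr)
    assume "\<not> ?thesis"
    then have "real (?s R) ^ 3 \<le> (real n powr (2/3)) ^ 3"
      by (intro power_mono) auto
    also have "\<dots> = real n ^ 2"
      using n by (simp add: powr_powr flip: powr_numeral)
    finally have "?s R ^ 3 \<le> n\<^sup>2"
      by (simp flip: of_nat_power)
    then show False
      using that by (simp add: sparse_requisition_families_def)
  qed
  have "real n powr (2/3) * card (?F - ?S) = (\<Sum>R\<in>?F - ?S. real n powr (2/3))"
    by simp
  also have "\<dots> \<le> (\<Sum>R\<in>?F - ?S. real (?s R))"
    using large by (rule sum_mono)
  also have "\<dots> \<le> (\<Sum>R\<in>all_requisitions n. real (?s R))"
    by (rule sum_mono2) (auto simp: feasible_requisition_families_def)
  also have "\<dots> = fact n * real n ^ n"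
    using arg_cong[OF sum_card_restricted_permutations[of n], of real] by simp
  also have "\<dots> \<le> 3 * sqrt n * card ?F"
    by (rule card_feasible_lower_bound[OF assms])
  finally have "card (?F - ?S) \<le> 3 * sqrt n * card ?F / real n powr (2/3)"
    using n by (simp add: pos_le_divide_eq mult.commute)
  also have "\<dots> = 3 * (real n powr (1/2) / real n powr (2/3)) * card ?F"
    using n by (simp add: powr_half_sqrt)
  also have "real n powr (1/2) / real n powr (2/3) = real n powr (-1/6)"
    by (simp flip: powr_diff)
  finally have "card (?F - ?S) \<le> 3 * real n powr (-1/6) * card ?F" .
  moreover have "real (card (?F - ?S)) = real (card ?F) - real (card ?S)"
  proof -
    have "?S \<subseteq> ?F"
      by (auto simp: sparse_requisition_families_def)
    then have "card (?F - ?S) = card ?F - card ?S" "card ?S \<le> card ?F"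
      using finite_subset[OF \<open>?S \<subseteq> ?F\<close>] by (auto intro: card_Diff_subset card_mono)
    then show ?thesis
      by simp
  qed
  ultimately show ?thesis
    by (simp add: algebra_simps)
qed

lemma inj_on_bipartite_graph: "inj_on (bipartite_graph n) (all_requisitions n)"
proof (rule inj_onI)
  fix R S assume RS: "R \<in> all_requisitions n" "S \<in> all_requisitions n"
    and eq: "bipartite_graph n R = bipartite_graph n S"
  have "R i = S i" if "i \<in> {1..n}" for i
    using that eq unfolding bipartite_graph_def by (auto simp: set_eq_iff)
  then show "R = S"
    using RS unfolding all_requisitions_def by (blast intro: PiE_ext)
qed

lemma feasible_iff_restricted_permutations:
  "feasible n R \<longleftrightarrow> restricted_permutations n R \<noteq> {}"
proof
  assume "feasible n R"
  then obtain f where f: "bij_betw f {1..n} {1..n}" "\<forall>i\<in>{1..n}. f i \<in> R i"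
    by (auto simp: feasible_def solutions_def)
  let ?g = "\<lambda>i. if i \<in> {1..n} then f i else i"
  have "bij_betw ?g {1..n} {1..n}"
    using f(1) by (subst bij_betw_cong[where g = f]) auto
  then have "?g permutes {1..n}"
    by (rule bij_imp_permutes) auto
  then have "?g \<in> restricted_permutations n R"
    using f(2) by (auto simp: restricted_permutations_def)
  then show "restricted_permutations n R \<noteq> {}"
    by blast
next
  assume "restricted_permutations n R \<noteq> {}"
  then show "feasible n R"
    by (auto simp: restricted_permutations_def feasible_def solutions_def intro: permutes_imp_bij)
qed

lemma bipartite_graph_eqD: "bipartite_graph n R = bipartite_graph n S \<Longrightarrow> i \<in> {1..n} \<Longrightarrow> R i = S i"
  unfolding bipartite_graph_def by (auto simp: set_eq_iff)

lemma restricted_permutations_cong: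
  "(\<And>i. i \<in> {1..n} \<Longrightarrow> R i = S i) \<Longrightarrow> restricted_permutations n R = restricted_permutations n S"
  by (auto simp: restricted_permutations_def)

text \<open>For \<open>n = 0\<close> the two sides differ: \<open>requisitions\<close> demands
  \<open>n \<ge> 1\<close>, whereas the empty family is solved by the identity.\<close>

lemma chi_eq:
  assumes "1 \<le> n"
  shows "chi n = bipartite_graph n ` feasible_requisition_families n"
proof (intro equalityI subsetI)
  fix G assume "G \<in> chi n"
  then obtain R where R: "G = bipartite_graph n R" "requisitions n R" "feasible n R"
    by (auto simp: chi_def)
  let ?R = "restrict R {1..n}"
  have "?R \<in> all_requisitions n"
    using R(2) by (auto simp: all_requisitions_def requisition_sets_def requisitions_def)
  moreover have "restricted_permutations n ?R = restricted_permutations n R"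
    by (rule restricted_permutations_cong) simp
  moreover have "bipartite_graph n ?R = G"
    unfolding R(1) by (auto simp: bipartite_graph_def)
  ultimately show "G \<in> bipartite_graph n ` feasible_requisition_families n"
    using R(3) unfolding feasible_requisition_families_def feasible_iff_restricted_permutations
    by blast
next
  fix G assume "G \<in> bipartite_graph n ` feasible_requisition_families n"
  then obtain R where R: "G = bipartite_graph n R" "R \<in> all_requisitions n" "feasible n R"
    by (auto simp: feasible_requisition_families_def feasible_iff_restricted_permutations)
  have "R i \<in> requisition_sets n" if "i \<in> {1..n}" for i
    using R(2) that unfolding all_requisitions_def by (rule PiE_mem)
  then have "requisitions n R"
    using assms by (simp add: requisitions_def requisition_sets_def)
  then show "G \<in> chi n"
    using R by (auto simp: chi_def)
qed

lemma finite_chi: "1 \<le> n \<Longrightarrow> finite (chi n)"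
  by (simp add: chi_eq)

lemma card_chi: "1 \<le> n \<Longrightarrow> card (chi n) = card (feasible_requisition_families n)"
  unfolding chi_eq by (intro card_image inj_on_subset[OF inj_on_bipartite_graph])
    (auto simp: feasible_requisition_families_def)

section \<open>Linear time for sparse families, and the limit\<close>

text \<open>The quotient of \<open>(k + 1) ^ 4\<close> by \<open>2 ^ k\<close> peaks at
  \<open>k = 5\<close> with 40.5, and 64 is a square above that, whose root 8 enters
  \<open>enumeration_time\<close>. From \<open>k = 5\<close> on, a step multiplies the fourth power
  by at most \<open>(7/6) ^ 4 < 2\<close>.\<close>

lemma poly_le_exp: "(k + 1) ^ 4 \<le> 64 * 2 ^ (k :: nat)"
proof (induction k rule: less_induct)
  case (less k)
  show ?case
  proof (cases "k \<le> 5")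
    case True
    then have "k \<in> {0, 1, 2, 3, 4, 5}"
      by auto
    then show ?thesis
      by (auto simp: eval_nat_numeral)
  next
    case False
    then obtain l where l: "k = Suc l" "5 \<le> l"
      by (cases k) auto
    have "6 * (l + 2) \<le> 7 * (l + 1)"
      using l(2) by simp
    then have "(6 * (l + 2)) ^ 4 \<le> (7 * (l + 1)) ^ 4"
      by (rule power_mono) simp
    then have "1296 * (l + 2) ^ 4 \<le> 2401 * (l + 1) ^ 4"
      by (simp only: power_mult_distrib) simp
    then have "(l + 2) ^ 4 \<le> 2 * (l + 1) ^ 4"
      by linarith
    moreover have "(l + 1) ^ 4 \<le> 64 * 2 ^ l"
      using less[of l] l(1) by simp
    ultimately show ?thesis
      using l(1) by simp
  qed
qed

text \<open>After squaring, the hypothesis on \<open>s ^ 3\<close> applies directly: the spare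
  factor \<open>2 ^ k\<close> between the square and the cube of \<open>2 ^ k\<close> absorbs
  \<open>(k + 1) ^ 4\<close>.\<close>

lemma enumeration_time:
  assumes "2 ^ k \<le> s" "s ^ 3 \<le> n\<^sup>2"
  shows "2 ^ k * (k + 1) ^ 2 \<le> 8 * (n :: nat)"
proof (rule power2_le_imp_le)
  have "(2 ^ k * (k + 1) ^ 2)\<^sup>2 = (2 ^ k) ^ 2 * (k + 1) ^ 4"
    by (simp add: power_mult_distrib flip: power_mult)
  also have "\<dots> \<le> (2 ^ k) ^ 2 * (64 * 2 ^ k)"
    by (intro mult_left_mono poly_le_exp) simp
  also have "\<dots> = 64 * (2 ^ k) ^ 3"
    by (simp add: power2_eq_square power3_eq_cube)
  also have "\<dots> \<le> 64 * s ^ 3"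
    using assms(1) by (intro mult_left_mono power_mono) auto
  also have "\<dots> \<le> (8 * n)\<^sup>2"
    using assms(2) by (simp add: power_mult_distrib)
  finally show "(2 ^ k * (k + 1) ^ 2)\<^sup>2 \<le> (8 * n)\<^sup>2" .
qed simp

abbreviation tspvr_machine :: "instr list" where
  "tspvr_machine \<equiv> compile 0 tspvr_program"

text \<open>The time bound depends on the instance only through \<open>n\<close> and its solutions,
  which the graph determines, so it is uniform in the weights. The constant is
  \<open>700 + 300 + 8 * 180\<close>, with the additive 300 bounded by
  \<open>300 * n\<close>.\<close>

lemma sparse_in_chi_star:
  assumes "1 \<le> n" "R \<in> sparse_requisition_families n"
  shows "bipartite_graph n R \<in> chi_star tspvr_machine 2440 n"
proof -
  have R: "R \<in> feasible_requisition_families n" "card (restricted_permutations n R) ^ 3 \<le> n\<^sup>2"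
    using assms(2) by (auto simp: sparse_requisition_families_def)
  have "\<exists>t. real t \<le> 2440 * real n \<and> solves_within tspvr_machine n S \<rho> t"
    if S: "tspvr_instance n S \<rho>" "bipartite_graph n S = bipartite_graph n R" for S \<rho>
  proof -
    have perms: "restricted_permutations n S = restricted_permutations n R"
      using bipartite_graph_eqD[OF S(2)] by (rule restricted_permutations_cong)
    then have "feasible n S"
      using R(1) by (simp add: feasible_iff_restricted_permutations feasible_requisition_families_def)
    moreover have "requisitions n S"
      using S(1) by (simp add: tspvr_instance_def)
    ultimately obtain t k where t: "solves_within tspvr_machine n S \<rho> t"
        "2 ^ k \<le> card (restricted_permutations n S)" "t \<le> 700 * n + 300 + 180 * 2 ^ k * (k + 1) ^ 2"
      using tspvr_program_solves by blast
    have "2 ^ k * (k + 1) ^ 2 \<le> 8 * n"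
      using enumeration_time[OF t(2)] R(2) perms by simp
    then have "t \<le> 2440 * n"
      using t(3) assms(1) by (simp add: mult.assoc)
    then have "real t \<le> 2440 * real n"
      by (metis of_nat_le_iff of_nat_mult of_nat_numeral)
    then show ?thesis
      using t(1) by blast
  qed
  moreover have "bipartite_graph n R \<in> chi n"
    using R(1) chi_eq[OF assms(1)] by blast
  ultimately show ?thesis
    by (simp add: chi_star_def)
qed

lemma card_chi_star_ratio:
  assumes "1 \<le> n"
  shows "1 - 3 * real n powr (-1/6) \<le> card (chi_star tspvr_machine 2440 n) / card (chi n)"
    and "card (chi_star tspvr_machine 2440 n) / card (chi n) \<le> 1"
proof -
  let ?F = "feasible_requisition_families n"
  have pos: "0 < real (card ?F)"
  proof -
    have "0 < fact n * real n ^ n"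
      using assms by simp
    then have "0 < 3 * sqrt n * card ?F"
      using card_feasible_lower_bound[OF assms] by linarith
    then show ?thesis
      using assms by (simp add: zero_less_mult_iff)
  qed
  have fin: "finite (chi_star tspvr_machine 2440 n)" and sub: "chi_star tspvr_machine 2440 n \<subseteq> chi n"
    using finite_chi[OF assms] by (auto simp: chi_star_def)
  have "card (sparse_requisition_families n) = card (bipartite_graph n ` sparse_requisition_families n)"
    by (intro card_image[symmetric] inj_on_subset[OF inj_on_bipartite_graph])
      (auto simp: sparse_requisition_families_def feasible_requisition_families_def)
  also have "\<dots> \<le> card (chi_star tspvr_machine 2440 n)"
    using sparse_in_chi_star[OF assms] by (intro card_mono fin) blast
  finally have "(1 - 3 * real n powr (-1/6)) * card ?F \<le> card (chi_star tspvr_machine 2440 n)"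
    using card_sparse_lower_bound[OF assms] by linarith
  then show "1 - 3 * real n powr (-1/6) \<le> card (chi_star tspvr_machine 2440 n) / card (chi n)"
    using pos unfolding card_chi[OF assms] by (simp add: pos_le_divide_eq)
  have "card (chi_star tspvr_machine 2440 n) \<le> card (chi n)"
    by (rule card_mono[OF finite_chi[OF assms] sub])
  then show "card (chi_star tspvr_machine 2440 n) / card (chi n) \<le> 1"
    using pos unfolding card_chi[OF assms] by (simp add: divide_le_eq_1_pos)
qed

theorem mainTheorem2:
  "\<exists>(P :: instr list) (C :: real). solves_tspvr P \<and>
     (\<lambda>n. real (card (chi_star P C n)) / real (card (chi n))) \<longlonglongrightarrow> 1"
proof (intro exI conjI)
  show "solves_tspvr tspvr_machine"
    unfolding solves_tspvr_def tspvr_instance_def using tspvr_program_solves by metis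
  have "(\<lambda>n. 1 - 3 * real n powr (-1/6)) \<longlonglongrightarrow> 1 - 3 * 0"
    by (intro tendsto_intros tendsto_neg_powr filterlim_real_sequentially) simp
  then have lower: "(\<lambda>n. 1 - 3 * real n powr (-1/6)) \<longlonglongrightarrow> 1"
    by simp
  show "(\<lambda>n. real (card (chi_star tspvr_machine 2440 n)) / real (card (chi n))) \<longlonglongrightarrow> 1"
  proof (rule tendsto_sandwich[OF _ _ lower tendsto_const])
    show "\<forall>\<^sub>F n in sequentially. 1 - 3 * real n powr (-1/6) \<le>
        real (card (chi_star tspvr_machine 2440 n)) / real (card (chi n))"
      using card_chi_star_ratio(1) eventually_sequentially by blast
    show "\<forall>\<^sub>F n in sequentially. real (card (chi_star tspvr_machine 2440 n)) / real (card (chi n)) \<le> 1"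
      using card_chi_star_ratio(2) eventually_sequentially by blast
  qed
qed

end
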